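(* Write $p'$ for the conjugate exponent, $\frac1p+\frac1{p'}=1$. (i) Let $1\le p\le 2$. There is a constant $C_p$ (independent of $f$) such that for every $f\in\mathcal{S}(\mathbb{H}^n)$, $$\left(\int_{\Omega}\left(\int_{\mathbb{C}^n}|\mathcal{F}(f)(a,w)|^2\,dw\right)^{p'/2}|\lambda|^{np'/2}\,d\mu(a)\right)^{1/p'}\le C_p\,\|f\|_{L^p(\mathbb{H}^n)},$$ where for $p=1$ (so $p'=\infty$) the left-hand side is read as the essential supremum over $a\in\Omega$ with respect to $\mu$ of $|\lambda|^{n/2}\big(\int_{\mathbb{C}^n}|\mathcal{F}(f)(a,w)|^2dw\big)^{1/2}$. (ii) Let $2<p<\infty$. There is a constant $C_p$ (independent of $f$) such that for every $f\in\mathcal{S}(\mathbb{H}^n)$, $$\|f\|_{L^p(\mathbb{H}^n)}\le C_p\left(\int_{\Omega}\left(\int_{\mathbb{C}^n}|\mathcal{F}(f)(a,w)|^2\,dw\right)^{p'/2}|\lambda|^{np'/2}\,d\mu(a)\right)^{1/p'}.$$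
   Context: Let $n\ge 1$. The Heisenberg group $\mathbb{H}^n=\mathbb{C}^n\times\mathbb{R}$ has group law $(z,t)(w,s)=(z+w,\,t+s+\tfrac12\operatorname{Im}(z\cdot\overline{w}))$ (so $(z,t)^{-1}=(-z,-t)$) and Haar measure $dz\,dt$ (Lebesgue measure); $L^p(\mathbb{H}^n)$ is taken with respect to it, and $\mathcal{S}(\mathbb{H}^n)$ is the Schwartz space of $\mathbb{C}^n\times\mathbb{R}\cong\mathbb{R}^{2n+1}$. Write $\mathbb{R}^*=\mathbb{R}\setminus\{0\}$. Laguerre functions: for $\lambda\in\mathbb{R}^*$ and $k\in\{0,1,2,\dots\}$, $\varphi^{n-1}_{k,\lambda}(z)=L^{n-1}_k\big(\tfrac12|\lambda||z|^2\big)e^{-\frac14|\lambda||z|^2}$, where $L_k^{\delta}(t)=\frac{t^{-\delta}e^t}{k!}\big(\frac{d}{dt}\big)^k(e^{-t}t^{k+\delta})$ is the Laguerre polynomial of type $\delta$ and degree $k$. Heisenberg fan: $\Omega=\bigcup_{k\ge 0}R_k\cup R_\infty\subset\mathbb{R}^2$, where $R_k=\{(\lambda,(2k+n)|\lambda|):\lambda\in\mathbb{R}^*\}$ and $R_\infty=\{(0,\tau):\tau\ge 0\}$. Throughout, $a=(\lambda,(2k+n)|\lambda|)$ denotes a point of $R_k$ (and $\lambda$ its first coordinate); put $e_a(z,t)=e^{i\lambda t}\varphi^{n-1}_{k,\lambda}(z)$ and $c_{n,k}=\frac{k!\,(n-1)!}{(k+n-1)!}$. Normalized Strichartz Fourier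 transform: for $f\in L^1\cap L^2(\mathbb{H}^n)$, $a\in R_k$, $w\in\mathbb{C}^n$, $$\mathcal{F}(f)(a,w)=c_{n,k}\int_{\mathbb{H}^n}f(z,t)\,e_a\big((z,t)^{-1}(w,0)\big)\,dz\,dt.$$ (Values on $R_\infty$ are irrelevant here, since $R_\infty$ is a null set for the measures below.) The measures $\nu_2$ and $\mu$ on $\Omega$ are $$\int_\Omega\phi\,d\nu_2=(2\pi)^{-2n-1}\int_{-\infty}^\infty\Big(\sum_{k=0}^\infty c_{n,k}^{-2}\,\phi(\lambda,(2k+n)|\lambda|)\Big)|\lambda|^{2n}\,d\lambda,\qquad d\mu(a)=|\lambda|^{-n}\,d\nu_2(a).$$ *)

theory Defs
  imports "HOL-Probability.Essential_Supremum" "HOL-Computational_Algebra.Polynomial"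
begin

section \<open>Real powers of extended nonnegative reals\<close>

text \<open>Only used for exponents \<open>r > 0\<close>, where \<open>0\<close> and \<open>\<infinity>\<close> are mapped to themselves.\<close>

definition epowr :: "ennreal \<Rightarrow> real \<Rightarrow> ennreal" (infixr "epowr" 80) where
  "x epowr r = (if x = \<infinity> then \<infinity> else ennreal (enn2real x powr r))"

section \<open>Schwartz functions on a Euclidean space\<close>

fun iter_partial :: "'a::euclidean_space list \<Rightarrow> ('a \<Rightarrow> 'b::real_normed_vector) \<Rightarrow> 'a \<Rightarrow> 'b" where
  "iter_partial [] f = f"
| "iter_partial (v # vs) f = (\<lambda>x. frechet_derivative (iter_partial vs f) (at x) v)"

text \<open>Differentiability of all iterated partial derivatives is smoothness; the second conjunct
  is rapid decay of all of them.\<close>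

definition schwartz :: "('a::euclidean_space \<Rightarrow> 'b::real_normed_vector) \<Rightarrow> bool" where
  "schwartz f \<longleftrightarrow> (\<forall>vs. set vs \<subseteq> Basis \<longrightarrow>
     (\<forall>x. iter_partial vs f differentiable (at x)) \<and>
     (\<forall>N::nat. bounded (range (\<lambda>x. (norm x) ^ N *\<^sub>R iter_partial vs f x))))"

section \<open>The Heisenberg group\<close>

text \<open>The type \<open>'n\<close> indexes the coordinates of \<open>\<complex>\<^sup>n\<close>, so \<open>n = CARD('n)\<close>.
  The Haar measure is \<^const>\<open>lborel\<close>.\<close>

type_synonym 'n heisenberg = "(complex ^ 'n) \<times> real"

definition heis_mult :: "'n::finite heisenberg \<Rightarrow> 'n heisenberg \<Rightarrow> 'n heisenberg" where
  "heis_mult x y = (fst x + fst y, snd x + snd y + Im (\<Sum>i\<in>UNIV. fst x $ i * cnj (fst y $ i)) / 2)"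

definition heis_inv :: "'n::finite heisenberg \<Rightarrow> 'n heisenberg" where
  "heis_inv x = (- fst x, - snd x)"

definition lp_norm :: "real \<Rightarrow> ('n::finite heisenberg \<Rightarrow> complex) \<Rightarrow> ennreal" where
  "lp_norm p f = (\<integral>\<^sup>+ x. ennreal (cmod (f x) powr p) \<partial>lborel) epowr (1 / p)"

section \<open>Laguerre functions\<close>

text \<open>\<open>laguerre d k\<close> is the polynomial of degree \<open>k\<close> and integer type \<open>d\<close>. Rodrigues' formula
  is imposed for \<open>t > 0\<close> only, because \<open>t\<^sup>-\<^sup>d\<close> is meaningless at \<open>0\<close>.\<close>

definition laguerre :: "nat \<Rightarrow> nat \<Rightarrow> real poly" where
  "laguerre d k = (THE L. \<forall>t>0. poly L t =
     t powi (- int d) * exp t / fact k * (deriv ^^ k) (\<lambda>s. exp (- s) * s ^ (k + d)) t)"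

lemma laguerre_iter_deriv:
  "(deriv ^^ k) (\<lambda>s. exp (- s) * poly p s) =
     (\<lambda>s::real. exp (- s) * poly (((\<lambda>q. pderiv q - q) ^^ k) p) s)"
proof (induction k)
  case (Suc k)
  let ?q = "((\<lambda>q. pderiv q - q) ^^ k) p"
  have "deriv (\<lambda>s. exp (- s) * poly ?q s) s = exp (- s) * poly (pderiv ?q - ?q) s" for s :: real
    by (rule DERIV_imp_deriv) (auto intro!: derivative_eq_intros poly_DERIV simp: algebra_simps)
  then show ?case using Suc by auto
qed simp

lemma laguerre_pow_dvd:
  "[:0, 1:] ^ d dvd ((\<lambda>q. pderiv q - q) ^^ k) ([:0, 1::real:] ^ (k + d))"
proof -
  have step: "[:0, 1:] ^ m dvd pderiv q - q" if "[:0, 1:] ^ Suc m dvd q" for m and q :: "real poly"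
  proof -
    obtain r where q: "q = [:0, 1:] ^ Suc m * r" using \<open>[:0, 1:] ^ Suc m dvd q\<close> by (elim dvdE)
    have "pderiv q = [:0, 1:] ^ Suc m * pderiv r + r * pderiv ([:0, 1:] ^ Suc m)"
      unfolding q by (rule pderiv_mult)
    also have "pderiv ([:0, 1:] ^ Suc m :: real poly) = smult (of_nat (Suc m)) ([:0, 1:] ^ m)"
      by (subst pderiv_power_Suc) (simp add: pderiv_pCons)
    finally have "pderiv q = [:0, 1:] ^ m * ([:0, 1:] * pderiv r + smult (of_nat (Suc m)) r)"
      by (simp only: power_Suc distrib_left mult_smult_left mult_smult_right mult_ac)
    then have "[:0, 1:] ^ m dvd pderiv q" by (rule dvdI)
    moreover have "[:0, 1:] ^ m dvd q"
      by (rule dvd_trans[OF le_imp_power_dvd that]) simp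
    ultimately show ?thesis by (rule dvd_diff)
  qed
  have "j \<le> k \<Longrightarrow> [:0, 1:] ^ (k + d - j) dvd ((\<lambda>q. pderiv q - q) ^^ j) ([:0, 1::real:] ^ (k + d))" for j
  proof (induction j)
    case (Suc j)
    then show ?case using step[of "k + d - Suc j"] by (simp add: Suc_diff_Suc del: power_Suc)
  qed simp
  from this[of k] show ?thesis by simp
qed

lemma laguerre_rodrigues:
  assumes "t > 0"
  shows "poly (laguerre d k) t =
    t powi (- int d) * exp t / fact k * (deriv ^^ k) (\<lambda>s. exp (- s) * s ^ (k + d)) t"
proof -
  let ?P = "\<lambda>L. \<forall>t>0. poly L t =
     t powi (- int d) * exp t / fact k * (deriv ^^ k) (\<lambda>s. exp (- s) * s ^ (k + d)) t"
  obtain r where r: "((\<lambda>q. pderiv q - q) ^^ k) ([:0, 1::real:] ^ (k + d)) = [:0, 1:] ^ d * r"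
    using laguerre_pow_dvd[of d k] by (elim dvdE)
  have "(\<lambda>s::real. exp (- s) * s ^ (k + d)) = (\<lambda>s. exp (- s) * poly ([:0, 1:] ^ (k + d)) s)"
    by simp
  then have D: "(deriv ^^ k) (\<lambda>s. exp (- s) * s ^ (k + d)) t = exp (- t) * (t ^ d * poly r t)" for t :: real
    using laguerre_iter_deriv[of k "[:0, 1:] ^ (k + d)"] r by simp
  have ex: "?P (smult (1 / fact k) r)"
    unfolding D by (auto simp: power_int_minus field_simps exp_minus)
  have unique: "L = M" if "?P L" "?P M" for L M :: "real poly"
  proof (rule ccontr)
    assume "L \<noteq> M"
    then have "finite {x. poly (L - M) x = 0}" by (intro poly_roots_finite) simp
    moreover have "{0<..} \<subseteq> {x. poly (L - M) x = 0}" using that by auto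
    ultimately show False using infinite_Ioi finite_subset by blast
  qed
  have "?P (laguerre d k)"
    unfolding laguerre_def by (rule theI[of ?P, OF ex]) (rule unique[OF _ ex])
  with assms show ?thesis by blast
qed

definition laguerre_fun :: "nat \<Rightarrow> real \<Rightarrow> complex ^ 'n \<Rightarrow> real" where
  "laguerre_fun k l z =
     poly (laguerre (CARD('n) - 1) k) (\<bar>l\<bar> * (norm z)\<^sup>2 / 2) * exp (- (\<bar>l\<bar> * (norm z)\<^sup>2 / 4))"

section \<open>The Heisenberg fan and its measures\<close>

definition fan_ray :: "nat \<Rightarrow> nat \<Rightarrow> (real \<times> real) set" where
  "fan_ray n k = {(l, (2 * real k + real n) * \<bar>l\<bar>) | l. l \<noteq> 0}"

definition fan :: "nat \<Rightarrow> (real \<times> real) set" where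
  "fan n = (\<Union>k. fan_ray n k) \<union> {(0, \<tau>) | \<tau>. \<tau> \<ge> 0}"

text \<open>The index of the ray containing the point \<open>a\<close>; unspecified on the limiting ray.\<close>

definition fan_index :: "nat \<Rightarrow> real \<times> real \<Rightarrow> nat" where
  "fan_index n a = (THE k. a \<in> fan_ray n k)"

lemma fan_index_eq: "a \<in> fan_ray n k \<Longrightarrow> fan_index n a = k"
  unfolding fan_index_def by (rule the_equality) (auto simp: fan_ray_def)

definition fan_coeff :: "nat \<Rightarrow> nat \<Rightarrow> real" where
  "fan_coeff n k = fact k * fact (n - 1) / fact (k + n - 1)"

definition fan_point :: "nat \<Rightarrow> real \<times> nat \<Rightarrow> real \<times> real" where
  "fan_point n = (\<lambda>(l, k). (l, (2 * real k + real n) * \<bar>l\<bar>))"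

text \<open>The measure \<open>\<nu>\<^sub>2\<close>, as the image of a weighted measure on \<open>\<real> \<times> \<nat>\<close>; the integral formula
  characterising it is \<open>nn_integral_nu2\<close> below.\<close>

definition nu2 :: "nat \<Rightarrow> (real \<times> real) measure" where
  "nu2 n = distr
     (density (lborel \<Otimes>\<^sub>M count_space UNIV)
       (\<lambda>(l, k). ennreal ((2 * pi) powi (- 2 * int n - 1) * fan_coeff n k powi (- 2) * \<bar>l\<bar> ^ (2 * n))))
     (restrict_space borel (fan n)) (fan_point n)"

definition mu :: "nat \<Rightarrow> (real \<times> real) measure" where
  "mu n = density (nu2 n) (\<lambda>a. ennreal (\<bar>fst a\<bar> powi (- int n)))"

lemma fan_point_in_fan: "fan_point n x \<in> fan n"
  by (cases x) (auto simp: fan_point_def fan_def fan_ray_def)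

lemma measurable_fan_point [measurable]:
  "fan_point n \<in> lborel \<Otimes>\<^sub>M count_space UNIV \<rightarrow>\<^sub>M restrict_space borel (fan n)"
proof (rule measurable_restrict_space2)
  show "fan_point n \<in> space (lborel \<Otimes>\<^sub>M count_space UNIV) \<rightarrow> fan n"
    using fan_point_in_fan by blast
  show "fan_point n \<in> borel_measurable (lborel \<Otimes>\<^sub>M count_space UNIV)"
    unfolding fan_point_def split_beta' borel_prod[symmetric] by measurable
qed

lemma nn_integral_nu2:
  assumes [measurable]: "\<phi> \<in> borel_measurable (restrict_space borel (fan n))"
  shows "(\<integral>\<^sup>+ a. \<phi> a \<partial>nu2 n) =
    ennreal ((2 * pi) powi (- 2 * int n - 1)) *
    (\<integral>\<^sup>+ l. (\<Sum>k. ennreal (fan_coeff n k powi (- 2)) * \<phi> (l, (2 * real k + real n) * \<bar>l\<bar>))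
        * ennreal (\<bar>l\<bar> ^ (2 * n)) \<partial>lborel)"
proof -
  have *: "(\<lambda>x. \<phi> (fan_point n x)) \<in> borel_measurable (lborel \<Otimes>\<^sub>M count_space UNIV)"
    by measurable
  have m: "(\<lambda>l. \<phi> (l, (2 * real k + real n) * \<bar>l\<bar>)) \<in> borel_measurable borel" for k
    using measurable_compose[OF measurable_Pair2'[of k "count_space UNIV" lborel] *]
    by (simp add: fan_point_def)
  define K where "K = (2 * pi) powi (- 2 * int n - 1)"
  define A where "A k = fan_coeff n k powi (- 2)" for k
  have K: "K \<ge> 0" and A: "A k \<ge> 0" for k
    by (simp_all add: K_def A_def fan_coeff_def)
  have "(\<integral>\<^sup>+ a. \<phi> a \<partial>nu2 n) = (\<integral>\<^sup>+ x. (case x of (l, k) \<Rightarrow> ennreal (K * A k * \<bar>l\<bar> ^ (2 * n))) *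
      \<phi> (fan_point n x) \<partial>(lborel \<Otimes>\<^sub>M count_space UNIV))"
    unfolding nu2_def K_def A_def
    by (subst nn_integral_distr, simp, simp, subst nn_integral_density) (use * in simp_all)
  also have "\<dots> = (\<integral>\<^sup>+ l. (\<Sum>k. ennreal (K * A k * \<bar>l\<bar> ^ (2 * n)) * \<phi> (fan_point n (l, k))) \<partial>lborel)"
    by (subst sigma_finite_measure.nn_integral_fst[symmetric, OF sigma_finite_measure_count_space])
       (use * in \<open>simp_all add: nn_integral_count_space_nat\<close>)
  also have "\<dots> = (\<integral>\<^sup>+ l. ennreal K * ((\<Sum>k. ennreal (A k) * \<phi> (fan_point n (l, k))) *
      ennreal (\<bar>l\<bar> ^ (2 * n))) \<partial>lborel)"
    by (intro nn_integral_cong) (simp add: ennreal_mult K A mult_ac flip: ennreal_suminf_cmult)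
  also have "\<dots> = ennreal K * (\<integral>\<^sup>+ l. (\<Sum>k. ennreal (A k) * \<phi> (fan_point n (l, k))) *
      ennreal (\<bar>l\<bar> ^ (2 * n)) \<partial>lborel)"
    by (rule nn_integral_cmult) (use m in \<open>simp add: fan_point_def\<close>)
  finally show ?thesis by (simp add: K_def A_def fan_point_def)
qed

section \<open>The normalized Strichartz Fourier transform\<close>

definition fan_char :: "real \<times> real \<Rightarrow> 'n::finite heisenberg \<Rightarrow> complex" where
  "fan_char a x = exp (\<i> * of_real (fst a * snd x)) *
     of_real (laguerre_fun (fan_index CARD('n) a) (fst a) (fst x))"

definition strichartz :: "('n::finite heisenberg \<Rightarrow> complex) \<Rightarrow> real \<times> real \<Rightarrow> complex ^ 'n \<Rightarrow> complex" where
  "strichartz f a w = of_real (fan_coeff CARD('n) (fan_index CARD('n) a)) *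
     (\<integral>x. f x * fan_char a (heis_mult (heis_inv x) (w, 0)) \<partial>lborel)"

text \<open>The norm of \<open>|\<lambda>|\<^sup>n\<^sup>/\<^sup>2 G(a,w)\<close> in \<open>L\<^sup>q(\<Omega>, \<mu>; L\<^sup>2(\<complex>\<^sup>n))\<close> for \<open>1 \<le> q \<le> \<infinity>\<close>. It is taken
  with values in \<open>[0, \<infinity>]\<close> because for \<open>q < 2\<close> it may be infinite for transforms of Schwartz functions.\<close>

definition fan_norm :: "ennreal \<Rightarrow> (real \<times> real \<Rightarrow> complex ^ 'n::finite \<Rightarrow> complex) \<Rightarrow> ennreal" where
  "fan_norm q G =
    (if q = \<infinity>
     then esssup (mu CARD('n)) (\<lambda>a. ennreal (\<bar>fst a\<bar> powr (real CARD('n) / 2)) *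
            (\<integral>\<^sup>+ w. ennreal ((cmod (G a w))\<^sup>2) \<partial>lborel) epowr (1 / 2))
     else (\<integral>\<^sup>+ a. (\<integral>\<^sup>+ w. ennreal ((cmod (G a w))\<^sup>2) \<partial>lborel) epowr (enn2real q / 2) *
            ennreal (\<bar>fst a\<bar> powr (real CARD('n) * enn2real q / 2)) \<partial>mu CARD('n)) epowr (1 / enn2real q))"

end

theory Submission
  imports Defs "HOL-Probability.Characteristic_Functions" "HOL-Probability.Sinc_Integral"
begin

text \<open>
  Write \<open>f\<^sup>\<lambda>\<close> for the Fourier transform of \<open>f\<close> in the central variable and \<open>M = (2 \<pi> / |\<lambda>|)\<^sup>n\<close>.
  On the ray \<open>R\<^sub>k\<close> the Strichartz transform of \<open>f\<close> is \<open>c\<^sub>n\<^sub>,\<^sub>k\<close> times the twisted convolution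
  \<open>f\<^sup>\<lambda> \<times> \<phi>\<^sub>k\<close>. The generating function \<open>\<Sum>\<^sub>k r\<^sup>k \<phi>\<^sub>k\<close> of the Laguerre functions is a Gaussian
  \<open>G\<^sub>r\<close>, and a direct computation gives \<open>G\<^sub>r \<times> G\<^sub>s = M G\<^sub>r\<^sub>s\<close>. Comparing coefficients,
  \<open>\<phi>\<^sub>k \<times> \<phi>\<^sub>k = M \<phi>\<^sub>k\<close>, which yields the \<open>L\<^sup>2\<close> norm and the maximum of \<open>\<phi>\<^sub>k\<close>, and turns
  \<open>\<parallel>g \<times> \<phi>\<^sub>k\<parallel>\<^sup>2\<close> into a quadratic form in \<open>g\<close> with kernel \<open>M \<phi>\<^sub>k\<close>. Summing these forms by Abel's
  method, \<open>G\<^sub>r\<close> is an approximate identity of mass tending to \<open>M\<close> as \<open>r \<rightarrow> 1\<close>; hence Bessel's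
  inequality for all \<open>g\<close> and Plancherel's formula for continuous \<open>g\<close>. The same approximate identity
  argument treats the central variable.

  For \<open>p = 1\<close> the estimate comes from the maximum of \<open>\<phi>\<^sub>k\<close>, for \<open>p = 2\<close> from Bessel's inequality.
  Between them one interpolates by Marcinkiewicz's method, applied to the square \<open>energy\<close> of the norm of
  the transform on a ray, which is subadditive up to a factor \<open>2\<close>.
  Part (ii) is dual to (i): with \<open>g = f |f|\<^sup>p\<^sup>-\<^sup>2\<close>, Plancherel's formula for \<open>f\<close>, \<open>g\<close> and \<open>f + g\<close>
  bounds the integral of \<open>|f|\<^sup>p\<close> by a pairing of the transforms of \<open>f\<close> and \<open>g\<close>, and (i) applies to \<open>g\<close>.
\<close>

section \<open>Gaussian integrals\<close>

text \<open>Interpolation cuts f at a height, which destroys continuity, so part (i) must hold on a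
  class stable under truncation: measurable functions below a fixed integrable weight. Hence
  Bessel's inequality is derived from a Schur bound, uniform along the approximate identity.
  Plancherel's equality needs convergence of the approximate identity and is claimed for continuous
  functions only; part (ii) uses it just for f, g and f + g, which are continuous.

  The powers of |\<lambda>| and the coefficients in the measures are tuned to the two endpoints. One
  has |\<lambda>|^n M = (2 \<pi>)^n, and c = \<open>c_{n,k}\<close> is 1 / \<phi>_k(0). For p = 2
  the factors c^(-2) and |\<lambda>|^(2n) of \<nu>_2 cancel the square of the normalization and M^2,
  leaving the 1 / (2 \<pi>) of the one-dimensional Plancherel formula. For p = 1 the weighted square
  norm on a ray is at most (2 \<pi>)^n c times the squared L^1 norm, and c \<le> 1. Every constant
  is thus independent of k and \<lambda>.\<close>

lemma nn_integral_lborel_affine: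
  fixes f :: "'a::euclidean_space \<Rightarrow> ennreal"
  assumes [measurable]: "f \<in> borel_measurable borel" and c: "c \<noteq> 0"
  shows "(\<integral>\<^sup>+x. f x \<partial>lborel) = ennreal (\<bar>c\<bar> ^ DIM('a)) * (\<integral>\<^sup>+x. f (t + c *\<^sub>R x) \<partial>lborel)"
  by (subst lborel_affine[OF c, of t])
     (simp add: nn_integral_density nn_integral_distr nn_integral_cmult)

lemma integrable_lborel_affine:
  fixes f :: "'a::euclidean_space \<Rightarrow> 'b :: {banach, second_countable_topology}"
  assumes f: "integrable lborel f" and c: "c \<noteq> 0"
  shows "integrable lborel (\<lambda>x. f (t + c *\<^sub>R x))"
proof -
  have [measurable]: "f \<in> borel_measurable borel"
    using f[THEN borel_measurable_integrable] by simp
  show ?thesis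
    using f c nn_integral_lborel_affine[of "\<lambda>x. ennreal (norm (f x))" c t] unfolding integrable_iff_bounded
    by (auto simp: ennreal_mult_less_top)
qed

lemma integral_lborel_affine:
  fixes f :: "'a::euclidean_space \<Rightarrow> 'b :: {banach, second_countable_topology}"
  assumes f: "integrable lborel f" and c: "c \<noteq> 0"
  shows "(\<integral>x. f x \<partial>lborel) = \<bar>c\<bar> ^ DIM('a) *\<^sub>R (\<integral>x. f (t + c *\<^sub>R x) \<partial>lborel)"
proof -
  have [measurable]: "f \<in> borel_measurable borel"
    using f[THEN borel_measurable_integrable] by simp
  show ?thesis
    using f c integrable_lborel_affine[OF f c]
    by (subst lborel_affine[OF c, of t]) (simp add: integral_density integral_distr)
qed

section \<open>Product integrands and an integrable product weight\<close>

lemma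
  fixes f :: "'a::euclidean_space \<Rightarrow> real \<Rightarrow> complex"
  assumes f: "\<And>b. b \<in> Basis \<Longrightarrow> integrable lborel (f b)"
  shows integrable_prod_Basis: "integrable lborel (\<lambda>x. \<Prod>b\<in>Basis. f b (x \<bullet> b))"
    and integral_prod_Basis: "(\<integral>x. (\<Prod>b\<in>Basis. f b (x \<bullet> b)) \<partial>lborel) = (\<Prod>b\<in>Basis. \<integral>x. f b x \<partial>lborel)"
proof -
  interpret product_sigma_finite "\<lambda>_::'a. lborel :: real measure" ..
  have [measurable]: "f b \<in> borel_measurable borel" if "b \<in> Basis" for b
    using f[OF that, THEN borel_measurable_integrable] by simp
  have m: "(\<lambda>x. \<Prod>b\<in>Basis. f b (x \<bullet> b)) \<in> borel_measurable borel"
    by (rule borel_measurable_prod) measurable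
  have eq: "(\<Prod>b\<in>Basis. f b ((\<Sum>b\<in>Basis. g b *\<^sub>R b) \<bullet> b)) = (\<Prod>b\<in>Basis. f b (g b))" for g :: "'a \<Rightarrow> real"
    by (intro prod.cong refl) simp
  show "integrable lborel (\<lambda>x. \<Prod>b\<in>Basis. f b (x \<bullet> b))"
    unfolding lborel_eq[where 'a='a]
    by (subst integrable_distr_eq) (use m product_integrable_prod[OF finite_Basis f] in \<open>simp_all add: eq\<close>)
  show "(\<integral>x. (\<Prod>b\<in>Basis. f b (x \<bullet> b)) \<partial>lborel) = (\<Prod>b\<in>Basis. \<integral>x. f b x \<partial>lborel)"
    unfolding lborel_eq[where 'a='a]
    by (subst integral_distr) (use m product_integral_prod[OF finite_Basis f] in \<open>simp_all add: eq\<close>)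
qed

text \<open>A product over coordinates is chosen rather than a power of the norm: integrability
  follows coordinate by coordinate from 1 / (1 + x^2), and the weight of a pair is the product of
  the weights, so bounds by it pass to sections and to partial integrals.\<close>

definition decay_weight :: "'a::euclidean_space \<Rightarrow> real" where
  "decay_weight x = (\<Prod>b\<in>Basis. inverse (1 + (x \<bullet> b)\<^sup>2))"

lemma decay_weight_pos: "0 < decay_weight x"
  unfolding decay_weight_def by (intro prod_pos) (auto intro: add_pos_nonneg)

lemma decay_weight_le_1: "decay_weight x \<le> 1"
  unfolding decay_weight_def by (intro prod_le_1) (auto simp: inverse_le_1_iff)

lemma continuous_decay_weight: "continuous_on A decay_weight"
  unfolding decay_weight_def
  by (intro continuous_on_prod continuous_intros) (auto simp: add_nonneg_eq_0_iff)

lemma measurable_decay_weight [measurable]: "decay_weight \<in> borel_measurable borel"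
  by (intro borel_measurable_continuous_onI continuous_decay_weight)

lemma integrable_decay_weight: "integrable lborel (decay_weight :: 'a::euclidean_space \<Rightarrow> real)"
proof -
  have "integrable lborel (\<lambda>x::real. inverse (1 + x\<^sup>2))"
    using integrable_inverse_1_plus_square by (simp add: set_integrable_def)
  then have "integrable lborel (\<lambda>x. complex_of_real (inverse (1 + x\<^sup>2)))"
    by (rule integrable_of_real)
  from integrable_prod_Basis[where f="\<lambda>_::'a. \<lambda>x. complex_of_real (inverse (1 + x\<^sup>2))", OF this]
  have "integrable lborel (\<lambda>x::'a. complex_of_real (decay_weight x))"
    by (simp add: decay_weight_def)
  then have "integrable lborel (\<lambda>x::'a. norm (complex_of_real (decay_weight x)))"
    by (rule integrable_norm)
  then show ?thesis using decay_weight_pos[where 'a='a] by (simp add: less_imp_le)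
qed

section \<open>Fourier integrals of Gaussians\<close>

lemma measurable_cis [measurable]: "cis \<in> borel_measurable borel"
  unfolding cis_conv_exp[abs_def] by (intro borel_measurable_continuous_onI continuous_intros)

text \<open>Completing the square in the real exponent alone reduces the integral to the
  characteristic function of the standard normal distribution. The oscillating factor is carried
  along by the real affine substitution, so no contour is shifted.\<close>

lemma
  fixes a u v :: real
  assumes a: "a > 0"
  shows integrable_gauss_real: "integrable lborel (\<lambda>x. complex_of_real (exp (- a * x\<^sup>2 + u * x)) * cis (v * x))" (is ?I)
    and integral_gauss_real: "(\<integral>x. complex_of_real (exp (- a * x\<^sup>2 + u * x)) * cis (v * x) \<partial>lborel) =
      complex_of_real (sqrt (pi / a) * exp ((u\<^sup>2 - v\<^sup>2) / (4 * a))) * cis (u * v / (2 * a))" (is ?E)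
proof -
  \<comment> \<open>The frequency v in the variable sqrt (2 a) x, which turns exp (- a x^2) into the
    normal density up to a factor.\<close>
  define t where "t = v / sqrt (2 * a)"
  have s: "sqrt (2 * a) > 0" "sqrt (2 * a) * sqrt (2 * a) = 2 * a" using a by auto
  let ?g = "\<lambda>x::real. complex_of_real (std_normal_density x) * cis (t * x)"
  have "integrable std_normal_distribution (\<lambda>x. cis (t * x))"
    by (intro finite_measure.integrable_const_bound[where B=1])
       (auto intro!: prob_space.finite_measure real_distribution.axioms(1) real_dist_normal_dist)
  then have gi: "integrable lborel ?g"
    by (subst (asm) integrable_density) (auto simp: scaleR_conv_of_real normal_density_nonneg)
  have "(\<integral>x. ?g x \<partial>lborel) = char std_normal_distribution t"
    unfolding char_def by (subst integral_density) (auto simp: scaleR_conv_of_real normal_density_nonneg cis_conv_exp)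
  then have ge: "(\<integral>x. ?g x \<partial>lborel) = complex_of_real (exp (- (t^2) / 2))"
    by (simp add: char_std_normal_distribution)
  let ?c = "sqrt (2 * a)" and ?d = "- u / sqrt (2 * a)"
  \<comment> \<open>Collects what does not depend on x: the constant from completing the square, the
    phase of the shift and the normalization of the density.\<close>
  define K where "K = complex_of_real (sqrt (2 * pi) * exp (u\<^sup>2 / (4 * a))) * cis (u * v / (2 * a))"
  have eq: "complex_of_real (exp (- a * x\<^sup>2 + u * x)) * cis (v * x) = K * ?g (?d + ?c * x)" for x
  proof -
    have e1: "(?d + ?c * x)\<^sup>2 / 2 = a * x\<^sup>2 - u * x + u\<^sup>2 / (4 * a)"
    proof -
      have "(?d + ?c * x)\<^sup>2 = ?d\<^sup>2 + 2 * ?d * ?c * x + ?c\<^sup>2 * x\<^sup>2" by (simp add: power2_eq_square algebra_simps)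
      moreover have "?d\<^sup>2 = u\<^sup>2 / (2 * a)" using a by (simp add: power_divide)
      moreover have "?d * ?c = - u" using s by simp
      moreover have "?c\<^sup>2 = 2 * a" using a by simp
      ultimately show ?thesis using a by (simp add: field_simps)
    qed
    have e2: "t * (?d + ?c * x) = v * x - u * v / (2 * a)"
    proof -
      have "t * ?c = v" "t * ?d = - (u * v / (?c * ?c))" using s(1) by (simp_all add: t_def)
      moreover have "t * (?d + ?c * x) = (t * ?c) * x + t * ?d" by (simp only: algebra_simps)
      ultimately show ?thesis using s(2) by simp
    qed
    have "std_normal_density (?d + ?c * x) = exp (- (a * x\<^sup>2 - u * x + u\<^sup>2 / (4 * a))) / sqrt (2 * pi)"
      unfolding std_normal_density_def e1[symmetric] by simp
    then have "sqrt (2 * pi) * exp (u\<^sup>2 / (4 * a)) * std_normal_density (?d + ?c * x) = exp (- a * x\<^sup>2 + u * x)"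
      by (simp add: exp_add[symmetric])
    moreover have "cis (u * v / (2 * a)) * cis (t * (?d + ?c * x)) = cis (v * x)"
      unfolding e2 by (simp add: cis_mult)
    ultimately have "complex_of_real (exp (- a * x\<^sup>2 + u * x)) * cis (v * x) =
        complex_of_real (sqrt (2 * pi) * exp (u\<^sup>2 / (4 * a)) * std_normal_density (?d + ?c * x)) *
        (cis (u * v / (2 * a)) * cis (t * (?d + ?c * x)))" by (simp only:)
    then show ?thesis
      unfolding K_def by (simp only: of_real_mult mult_ac)
  qed
  have c0: "?c \<noteq> 0" using s by simp
  show ?I
    unfolding eq by (intro integrable_mult_right lborel_integrable_real_affine gi c0)
  have "(\<integral>x. K * ?g (?d + ?c * x) \<partial>lborel) = K * (\<integral>x. ?g (?d + ?c * x) \<partial>lborel)"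
    by (rule integral_mult_right_zero)
  also have "(\<integral>x. ?g x \<partial>lborel) = ?c *\<^sub>R (\<integral>x. ?g (?d + ?c * x) \<partial>lborel)"
    using lborel_integral_real_affine[OF c0, of ?g ?d] s(1) by simp
  then have "(\<integral>x. ?g (?d + ?c * x) \<partial>lborel) = complex_of_real (exp (- (t^2) / 2) / ?c)"
    using ge c0 by (simp add: scaleR_conv_of_real field_simps)
  also have "K * \<dots> = complex_of_real (sqrt (pi / a) * exp ((u\<^sup>2 - v\<^sup>2) / (4 * a))) * cis (u * v / (2 * a))"
  proof -
    have "t\<^sup>2 / 2 = v\<^sup>2 / (4 * a)" using a by (simp add: t_def power_divide)
    moreover have "sqrt (2 * pi) / ?c = sqrt (pi / a)" using a by (simp add: real_sqrt_divide[symmetric])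
    moreover have "exp (u\<^sup>2 / (4 * a)) * exp (- (t^2) / 2) = exp (u\<^sup>2 / (4 * a) - t\<^sup>2 / 2)"
      by (simp flip: exp_add)
    moreover have "sqrt (2 * pi) * exp (u\<^sup>2 / (4 * a)) * (exp (- (t^2) / 2) / ?c) =
        sqrt (2 * pi) / ?c * (exp (u\<^sup>2 / (4 * a)) * exp (- (t^2) / 2))" by simp
    ultimately have "sqrt (2 * pi) * exp (u\<^sup>2 / (4 * a)) * (exp (- (t^2) / 2) / ?c) = sqrt (pi / a) * exp ((u\<^sup>2 - v\<^sup>2) / (4 * a))"
      by (simp only: diff_divide_distrib)
    then have "complex_of_real (sqrt (pi / a) * exp ((u\<^sup>2 - v\<^sup>2) / (4 * a))) =
        complex_of_real (sqrt (2 * pi) * exp (u\<^sup>2 / (4 * a)) * (exp (- (t^2) / 2) / ?c))" by (simp only:)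
    then show ?thesis unfolding K_def
      by (simp only: of_real_mult mult_ac)
  qed
  finally show ?E unfolding eq .
qed

lemma prod_cis: "finite A \<Longrightarrow> (\<Prod>x\<in>A. cis (f x)) = cis (\<Sum>x\<in>A. f x)"
  by (induction A rule: finite_induct) (auto simp: cis_mult)

text \<open>The real linear term u and the phase v are both kept because a twisted convolution of
  two Gaussians produces both; see \<open>twisted_gauss\<close>.\<close>

lemma
  fixes u v :: "'a::euclidean_space"
  assumes a: "a > 0"
  shows integrable_gauss: "integrable lborel (\<lambda>x. complex_of_real (exp (- a * (norm x)\<^sup>2 + u \<bullet> x)) * cis (v \<bullet> x))" (is ?I)
    and integral_gauss: "(\<integral>x. complex_of_real (exp (- a * (norm x)\<^sup>2 + u \<bullet> x)) * cis (v \<bullet> x) \<partial>lborel) =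
      complex_of_real (sqrt (pi / a) ^ DIM('a) * exp (((norm u)\<^sup>2 - (norm v)\<^sup>2) / (4 * a))) * cis (u \<bullet> v / (2 * a))" (is ?E)
proof -
  let ?f = "\<lambda>b x. complex_of_real (exp (- a * x\<^sup>2 + (u \<bullet> b) * x)) * cis ((v \<bullet> b) * x)"
  have inn: "(\<Sum>b\<in>Basis. (x \<bullet> b) * (y \<bullet> b)) = x \<bullet> y" for x y :: 'a
    by (simp add: euclidean_inner[of x y])
  have sq: "(\<Sum>b\<in>Basis. (x \<bullet> b)\<^sup>2) = (norm x)\<^sup>2" for x :: 'a
    by (simp add: power2_eq_square inn power2_norm_eq_inner[unfolded power2_eq_square])
  have eq: "(\<Prod>b\<in>Basis. ?f b (x \<bullet> b)) = complex_of_real (exp (- a * (norm x)\<^sup>2 + u \<bullet> x)) * cis (v \<bullet> x)" for x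
  proof -
    have "(\<Prod>b\<in>Basis. ?f b (x \<bullet> b)) = complex_of_real (exp (\<Sum>b\<in>Basis. - a * (x \<bullet> b)\<^sup>2 + (u \<bullet> b) * (x \<bullet> b))) *
        cis (\<Sum>b\<in>Basis. (v \<bullet> b) * (x \<bullet> b))"
      by (simp only: prod.distrib prod_cis finite_Basis of_real_prod exp_sum)
    then show ?thesis by (simp only: sum.distrib inn sum_distrib_left[symmetric] sq)
  qed
  show ?I using integrable_prod_Basis[where f="?f", OF integrable_gauss_real[OF a]] unfolding eq .
  have "(\<integral>x. complex_of_real (exp (- a * (norm x)\<^sup>2 + u \<bullet> x)) * cis (v \<bullet> x) \<partial>lborel) =
      (\<Prod>b\<in>Basis. complex_of_real (sqrt (pi / a) * exp (((u \<bullet> b)\<^sup>2 - (v \<bullet> b)\<^sup>2) / (4 * a))) * cis ((u \<bullet> b) * (v \<bullet> b) / (2 * a)))"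
    using integral_prod_Basis[where f="?f", OF integrable_gauss_real[OF a]]
    by (simp only: eq integral_gauss_real[OF a])
  also have "\<dots> = complex_of_real (\<Prod>b\<in>(Basis::'a set). sqrt (pi / a) * exp (((u \<bullet> b)\<^sup>2 - (v \<bullet> b)\<^sup>2) / (4 * a))) *
      cis (\<Sum>b\<in>Basis. (u \<bullet> b) * (v \<bullet> b) / (2 * a))"
    by (subst prod.distrib) (simp only: prod_cis finite_Basis of_real_prod)
  also have "(\<Sum>b\<in>Basis. (u \<bullet> b) * (v \<bullet> b) / (2 * a)) = u \<bullet> v / (2 * a)"
    by (simp only: sum_divide_distrib[symmetric] inn)
  also have "(\<Prod>b\<in>(Basis::'a set). sqrt (pi / a) * exp (((u \<bullet> b)\<^sup>2 - (v \<bullet> b)\<^sup>2) / (4 * a))) =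
      sqrt (pi / a) ^ DIM('a) * exp (\<Sum>b\<in>Basis. ((u \<bullet> b)\<^sup>2 - (v \<bullet> b)\<^sup>2) / (4 * a))"
    by (simp only: prod.distrib exp_sum finite_Basis prod_constant)
  also have "(\<Sum>b\<in>Basis. ((u \<bullet> b)\<^sup>2 - (v \<bullet> b)\<^sup>2) / (4 * a)) = ((norm u)\<^sup>2 - (norm v)\<^sup>2) / (4 * a)"
    by (simp only: sum_divide_distrib[symmetric] sum_subtractf sq)
  finally show ?E .
qed

lemma
  assumes a: "a > 0"
  shows integrable_gauss_mass: "integrable lborel (\<lambda>x::'a::euclidean_space. exp (- a * (norm x)\<^sup>2))"
    and integral_gauss_mass: "(\<integral>x. exp (- a * (norm (x::'a))\<^sup>2) \<partial>lborel) = sqrt (pi / a) ^ DIM('a)"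
proof -
  have i: "integrable lborel (\<lambda>x::'a. complex_of_real (exp (- a * (norm x)\<^sup>2)))"
    using integrable_gauss[OF a, where u="0::'a" and v=0] by simp
  from integrable_Re[OF this] show "integrable lborel (\<lambda>x::'a. exp (- a * (norm x)\<^sup>2))" by simp
  have "(\<integral>x. complex_of_real (exp (- a * (norm (x::'a))\<^sup>2)) \<partial>lborel) = complex_of_real (sqrt (pi / a) ^ DIM('a))"
    using integral_gauss[OF a, where u="0::'a" and v=0] by simp
  then show "(\<integral>x. exp (- a * (norm (x::'a))\<^sup>2) \<partial>lborel) = sqrt (pi / a) ^ DIM('a)"
    by (simp only: integral_complex_of_real of_real_eq_iff)
qed

text \<open>A bound for the partial sums of the norms by one integrable g yields summability at each
  point and, after integration, summability of the L^1 norms, which is what termwise integration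
  requires.\<close>

lemma
  fixes f :: "nat \<Rightarrow> 'a \<Rightarrow> 'b::{banach, second_countable_topology}"
  assumes m[measurable]: "\<And>i. f i \<in> borel_measurable M" and g: "integrable M g"
    and bound: "\<And>N x. x \<in> space M \<Longrightarrow> (\<Sum>i<N. norm (f i x)) \<le> g x"
  shows integrable_sums_dominated: "integrable M (\<lambda>x. \<Sum>i. f i x)"
    and integral_sums_dominated: "(\<lambda>i. \<integral>x. f i x \<partial>M) sums (\<integral>x. (\<Sum>i. f i x) \<partial>M)"
proof -
  have summ: "summable (\<lambda>i. norm (f i x))" if "x \<in> space M" for x
    by (rule summableI_nonneg_bounded) (use bound[OF that] in auto)
  have int: "integrable M (f i)" for i
  proof (rule Bochner_Integration.integrable_bound[OF g])
    show "AE x in M. norm (f i x) \<le> norm (g x)"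
    proof (rule AE_I2)
      fix x assume x: "x \<in> space M"
      have "norm (f i x) \<le> (\<Sum>j<Suc i. norm (f j x))" by (auto intro: sum_nonneg)
      with bound[OF x, of "Suc i"] show "norm (f i x) \<le> norm (g x)" by simp
    qed
  qed simp
  have *: "summable (\<lambda>i. \<integral>x. norm (f i x) \<partial>M)"
  proof (rule summableI_nonneg_bounded)
    fix N
    have "(\<Sum>i<N. \<integral>x. norm (f i x) \<partial>M) = (\<integral>x. (\<Sum>i<N. norm (f i x)) \<partial>M)"
      using int by (subst Bochner_Integration.integral_sum) auto
    also have "\<dots> \<le> (\<integral>x. g x \<partial>M)"
      using int g bound by (intro integral_mono) auto
    finally show "(\<Sum>i<N. \<integral>x. norm (f i x) \<partial>M) \<le> (\<integral>x. g x \<partial>M)" .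
  qed simp
  show "integrable M (\<lambda>x. \<Sum>i. f i x)" "(\<lambda>i. \<integral>x. f i x \<partial>M) sums (\<integral>x. (\<Sum>i. f i x) \<partial>M)"
    using integrable_suminf[OF int _ *] sums_integral[OF int _ *] summ by auto
qed

section \<open>Gaussian averages of quadratic forms\<close>

lemma measurable_fst_borel [measurable (raw)]:
  "f \<in> borel_measurable M \<Longrightarrow> (\<lambda>x. fst (f x :: 'a::second_countable_topology \<times> 'b::second_countable_topology)) \<in> borel_measurable M"
  by (rule measurable_compose[of f M borel]) (simp_all flip: borel_prod)

lemma measurable_snd_borel [measurable (raw)]:
  "f \<in> borel_measurable M \<Longrightarrow> (\<lambda>x. snd (f x :: 'a::second_countable_topology \<times> 'b::second_countable_topology)) \<in> borel_measurable M"
  by (rule measurable_compose[of f M borel]) (simp_all flip: borel_prod)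

abbreviation sq_norm :: "('a::euclidean_space \<Rightarrow> complex) \<Rightarrow> ennreal" where
  "sq_norm f \<equiv> \<integral>\<^sup>+ x. ennreal ((cmod (f x))\<^sup>2) \<partial>lborel"

lemma cmod_mult_le_squares: "cmod a * cmod b \<le> ((cmod a)\<^sup>2 + (cmod b)\<^sup>2) / 2"
  using sum_squares_bound[of "cmod a" "cmod b"] by simp

lemma
  fixes a b :: "'a::euclidean_space \<Rightarrow> complex"
  assumes a: "integrable lborel a" and b: "integrable lborel b"
  shows integrable_tensor: "integrable lborel (\<lambda>p::'a \<times> 'a. a (fst p) * b (snd p))"
    and integral_tensor: "(\<integral>p. a (fst p) * b (snd p) \<partial>(lborel :: ('a \<times> 'a) measure)) = (\<integral>x. a x \<partial>lborel) * (\<integral>x. b x \<partial>lborel)"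
proof -
  have [measurable]: "a \<in> borel_measurable borel" "b \<in> borel_measurable borel"
    using a b borel_measurable_integrable by auto
  have i: "integrable (lborel \<Otimes>\<^sub>M lborel) (\<lambda>p::'a \<times> 'a. a (fst p) * b (snd p))"
    by (rule lborel_pair.Fubini_integrable)
       (use a b in \<open>simp_all add: norm_mult\<close>)
  then show "integrable lborel (\<lambda>p::'a \<times> 'a. a (fst p) * b (snd p))"
    by (simp add: lborel_prod)
  have "(\<integral>p. a (fst p) * b (snd p) \<partial>(lborel :: ('a \<times> 'a) measure)) = (\<integral>x. \<integral>y. a x * b y \<partial>lborel \<partial>lborel)"
    using lborel_pair.integral_fst'[OF i] by (simp add: lborel_prod)
  then show "(\<integral>p. a (fst p) * b (snd p) \<partial>(lborel :: ('a \<times> 'a) measure)) = (\<integral>x. a x \<partial>lborel) * (\<integral>x. b x \<partial>lborel)"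
    by simp
qed

context
  fixes g :: "'a::euclidean_space \<Rightarrow> complex" and \<kappa> :: "'a \<Rightarrow> 'b::euclidean_space \<Rightarrow> complex"
    and C B :: real
  assumes g: "integrable lborel g"
    and \<kappa>: "(\<lambda>(x, y). \<kappa> x y) \<in> borel_measurable borel"
    and bound: "\<And>x y. cmod (\<kappa> x y) \<le> C"
    and sq_int: "\<And>x. sq_norm (\<kappa> x) \<le> ennreal B"
begin

text \<open>Write the squared modulus as an integral over pairs (x, x') and exchange it with the
  integral over y. Absolute convergence: by 2ab \<le> a^2 + b^2 the y-integral of |\<kappa>(x,y)
  \<kappa>(x',y)| is at most B, uniformly, and the tensor product of g with its conjugate is
  integrable. The form is nonnegative as an integral of squares. It serves the twisted kernel and
  the damped Fourier kernel alike.\<close>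

lemma integrable_kernel_form:
  "integrable lborel (\<lambda>p. g (fst p) * cnj (g (snd p)) * (\<integral>y. \<kappa> (fst p) y * cnj (\<kappa> (snd p) y) \<partial>lborel))"
  and nn_integral_kernel_form:
  "(\<integral>\<^sup>+ y. ennreal ((cmod (\<integral>x. g x * \<kappa> x y \<partial>lborel))\<^sup>2) \<partial>lborel) =
    ennreal (Re (\<integral>p. g (fst p) * cnj (g (snd p)) * (\<integral>y. \<kappa> (fst p) y * cnj (\<kappa> (snd p) y) \<partial>lborel) \<partial>lborel))"
  and kernel_form_nonneg:
  "0 \<le> Re (\<integral>p. g (fst p) * cnj (g (snd p)) * (\<integral>y. \<kappa> (fst p) y * cnj (\<kappa> (snd p) y) \<partial>lborel) \<partial>lborel)"
proof -
  have gm[measurable]: "g \<in> borel_measurable borel"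
    using g borel_measurable_integrable by auto
  have \<kappa>2[measurable (raw)]: "(\<lambda>x. \<kappa> (u x) (v x)) \<in> borel_measurable M"
    if "u \<in> borel_measurable M" "v \<in> borel_measurable M" for u v and M :: "'c measure"
    using measurable_compose[OF borel_measurable_Pair[OF that] \<kappa>] by simp
  have gi: "integrable lborel (\<lambda>p::'a \<times> 'a. g (fst p) * cnj (g (snd p)))"
    by (rule integrable_tensor) (use g in simp_all)
  have row: "integrable lborel (\<lambda>x. g x * \<kappa> x y)" for y
  proof (rule Bochner_Integration.integrable_bound)
    show "integrable lborel (\<lambda>x. C * cmod (g x))" using g by simp
    show "AE x in lborel. norm (g x * \<kappa> x y) \<le> norm (C * cmod (g x))"
      using bound order_trans[OF norm_ge_zero bound]
      by (auto intro!: AE_I2 simp: norm_mult abs_mult mult.commute[of "cmod (g _)"] intro!: mult_right_mono)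
  qed measurable
  let ?\<Phi> = "\<lambda>p y. g (fst p) * cnj (g (snd p)) * (\<kappa> (fst p) y * cnj (\<kappa> (snd p) y))"
  have fib: "(\<integral>\<^sup>+ y. ennreal (cmod (\<kappa> x y * cnj (\<kappa> x' y))) \<partial>lborel) \<le> ennreal B" for x x'
  proof -
    have "(\<integral>\<^sup>+ y. ennreal (cmod (\<kappa> x y * cnj (\<kappa> x' y))) \<partial>lborel) \<le>
        (\<integral>\<^sup>+ y. ennreal (1/2) * (ennreal ((cmod (\<kappa> x y))\<^sup>2) + ennreal ((cmod (\<kappa> x' y))\<^sup>2)) \<partial>lborel)"
    proof (rule nn_integral_mono)
      fix y
      have "ennreal (cmod (\<kappa> x y * cnj (\<kappa> x' y))) \<le> ennreal (1/2 * ((cmod (\<kappa> x y))\<^sup>2 + (cmod (\<kappa> x' y))\<^sup>2))"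
        using cmod_mult_le_squares[of "\<kappa> x y" "\<kappa> x' y"] by (intro ennreal_leI) (simp add: norm_mult)
      also have "\<dots> = ennreal (1/2) * (ennreal ((cmod (\<kappa> x y))\<^sup>2) + ennreal ((cmod (\<kappa> x' y))\<^sup>2))"
        by (subst ennreal_mult) auto
      finally show "ennreal (cmod (\<kappa> x y * cnj (\<kappa> x' y))) \<le> \<dots>" .
    qed
    also have "\<dots> = ennreal (1/2) * ((sq_norm (\<kappa> x)) + (sq_norm (\<kappa> x')))"
      by (subst nn_integral_cmult, measurable) (subst nn_integral_add, measurable)
    also have "\<dots> \<le> ennreal (1/2) * (ennreal B + ennreal B)"
      by (intro mult_left_mono add_mono sq_int) auto
    also have "\<dots> = ennreal B"
    proof (cases "B \<ge> 0")
      case True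
      have "ennreal (1/2) * (ennreal B + ennreal B) = ennreal (1/2) * ennreal (B + B)"
        by (simp only: ennreal_plus[OF True True])
      also have "\<dots> = ennreal (1/2 * (B + B))"
        by (rule ennreal_mult[symmetric]) (use True in auto)
      also have "1/2 * (B + B) = B" by simp
      finally show ?thesis .
    qed (simp add: ennreal_neg)
    finally show ?thesis .
  qed
  have \<Phi>m: "(\<lambda>(p, y). ?\<Phi> p y) \<in> borel_measurable (lborel \<Otimes>\<^sub>M lborel)"
  proof -
    have m: "(\<lambda>x. fst (fst x)) \<in> borel_measurable ((lborel :: ('a \<times> 'a) measure) \<Otimes>\<^sub>M (lborel :: 'b measure))"
      "(\<lambda>x. snd (fst x)) \<in> borel_measurable ((lborel :: ('a \<times> 'a) measure) \<Otimes>\<^sub>M (lborel :: 'b measure))"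
      by (rule measurable_compose[OF measurable_fst], simp)+
    have m3: "snd \<in> borel_measurable ((lborel :: ('a \<times> 'a) measure) \<Otimes>\<^sub>M (lborel :: 'b measure))"
      using measurable_snd[of "lborel :: ('a \<times> 'a) measure" "lborel :: 'b measure"] by simp
    have cm: "cnj \<in> borel_measurable borel"
      by (intro borel_measurable_continuous_onI continuous_intros)
    show ?thesis
      unfolding split_beta'
      by (intro borel_measurable_times measurable_compose[OF m(1) gm] measurable_compose[OF measurable_compose[OF m(2) gm] cm]
          \<kappa>2[OF m(1) m3] measurable_compose[OF \<kappa>2[OF m(2) m3] cm])
  qed
  have "(\<integral>\<^sup>+ p. \<integral>\<^sup>+ y. ennreal (cmod (?\<Phi> p y)) \<partial>lborel \<partial>(lborel :: ('a \<times> 'a) measure)) \<le>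
      (\<integral>\<^sup>+ p. ennreal (cmod (g (fst p) * cnj (g (snd p)))) * ennreal B \<partial>lborel)"
  proof (rule nn_integral_mono)
    fix p :: "'a \<times> 'a"
    have "(\<integral>\<^sup>+ y. ennreal (cmod (?\<Phi> p y)) \<partial>lborel) =
        ennreal (cmod (g (fst p) * cnj (g (snd p)))) * (\<integral>\<^sup>+ y. ennreal (cmod (\<kappa> (fst p) y * cnj (\<kappa> (snd p) y))) \<partial>lborel)"
      by (subst nn_integral_cmult[symmetric]) (simp_all add: norm_mult ennreal_mult)
    also have "\<dots> \<le> ennreal (cmod (g (fst p) * cnj (g (snd p)))) * ennreal B"
      by (intro mult_left_mono fib) auto
    finally show "(\<integral>\<^sup>+ y. ennreal (cmod (?\<Phi> p y)) \<partial>lborel) \<le> ennreal (cmod (g (fst p) * cnj (g (snd p)))) * ennreal B" .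
  qed
  also have "\<dots> < \<infinity>"
    using gi by (subst nn_integral_multc) (auto simp: integrable_iff_bounded ennreal_mult_less_top)
  finally have "integrable (lborel \<Otimes>\<^sub>M lborel) (\<lambda>(p, y). ?\<Phi> p y)"
    using \<Phi>m by (subst integrable_iff_bounded) (simp add: lborel_pair.nn_integral_snd lborel.nn_integral_fst[symmetric] split_beta')
  note \<Phi>i = this
  have intp: "(\<integral>p. ?\<Phi> p y \<partial>lborel) = complex_of_real ((cmod (\<integral>x. g x * \<kappa> x y \<partial>lborel))\<^sup>2)" for y
  proof -
    have "(\<integral>p. ?\<Phi> p y \<partial>lborel) = (\<integral>p. (g (fst p) * \<kappa> (fst p) y) * (cnj (g (snd p) * \<kappa> (snd p) y)) \<partial>(lborel :: ('a \<times> 'a) measure))"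
      by (intro Bochner_Integration.integral_cong) (simp_all add: mult_ac)
    also have "\<dots> = (\<integral>x. g x * \<kappa> x y \<partial>lborel) * (\<integral>x. cnj (g x * \<kappa> x y) \<partial>lborel)"
      by (rule integral_tensor[OF row]) (use row[of y] in \<open>simp only: integrable_cnj\<close>)
    also have "(\<integral>x. cnj (g x * \<kappa> x y) \<partial>lborel) = cnj (\<integral>x. g x * \<kappa> x y \<partial>lborel)"
      by (rule Bochner_Integration.integral_cnj)
    finally show ?thesis by (simp add: complex_norm_square[symmetric] del: of_real_power)
  qed
  have inty: "(\<integral>y. ?\<Phi> p y \<partial>lborel) = g (fst p) * cnj (g (snd p)) * (\<integral>y. \<kappa> (fst p) y * cnj (\<kappa> (snd p) y) \<partial>lborel)" for p
    by (rule integral_mult_right_zero)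
  show "integrable lborel (\<lambda>p. g (fst p) * cnj (g (snd p)) * (\<integral>y. \<kappa> (fst p) y * cnj (\<kappa> (snd p) y) \<partial>lborel))"
    using lborel_pair.integrable_fst[OF \<Phi>i] by (simp only: inty)
  have ii: "integrable lborel (\<lambda>y. complex_of_real ((cmod (\<integral>x. g x * \<kappa> x y \<partial>lborel))\<^sup>2))"
    using lborel_pair.integrable_snd[OF \<Phi>i] by (simp only: intp)
  have "(\<integral>y. complex_of_real ((cmod (\<integral>x. g x * \<kappa> x y \<partial>lborel))\<^sup>2) \<partial>lborel) =
    (\<integral>p. g (fst p) * cnj (g (snd p)) * (\<integral>y. \<kappa> (fst p) y * cnj (\<kappa> (snd p) y) \<partial>lborel) \<partial>lborel)"
    using lborel_pair.Fubini_integral[OF \<Phi>i] by (simp only: inty intp)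
  from arg_cong[OF this, of Re] have "(\<integral>y. (cmod (\<integral>x. g x * \<kappa> x y \<partial>lborel))\<^sup>2 \<partial>lborel) =
    Re (\<integral>p. g (fst p) * cnj (g (snd p)) * (\<integral>y. \<kappa> (fst p) y * cnj (\<kappa> (snd p) y) \<partial>lborel) \<partial>lborel)"
    by (simp only: integral_complex_of_real Re_complex_of_real)
  note re = this
  show "0 \<le> Re (\<integral>p. g (fst p) * cnj (g (snd p)) * (\<integral>y. \<kappa> (fst p) y * cnj (\<kappa> (snd p) y) \<partial>lborel) \<partial>lborel)"
    unfolding re[symmetric] by (rule Bochner_Integration.integral_nonneg) simp
  have "integrable lborel (\<lambda>y. (cmod (\<integral>x. g x * \<kappa> x y \<partial>lborel))\<^sup>2)"
    using integrable_Re[OF ii] by (simp only: Re_complex_of_real)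
  with re show "(\<integral>\<^sup>+ y. ennreal ((cmod (\<integral>x. g x * \<kappa> x y \<partial>lborel))\<^sup>2) \<partial>lborel) =
    ennreal (Re (\<integral>p. g (fst p) * cnj (g (snd p)) * (\<integral>y. \<kappa> (fst p) y * cnj (\<kappa> (snd p) y) \<partial>lborel) \<partial>lborel))"
    by (subst nn_integral_eq_integral) auto
qed

end

text \<open>Monotone convergence, packaged for two summation methods: Abel means over k (counting
  measure, weights r^k) and Gaussian damping in the frequency l. The limit may be infinite.\<close>

lemma nn_integral_approach:
  fixes f :: "'a \<Rightarrow> real" and \<rho> :: "nat \<Rightarrow> 'a \<Rightarrow> real"
  assumes [measurable]: "f \<in> borel_measurable M" "\<And>N. \<rho> N \<in> borel_measurable M"
    and f: "\<And>x. 0 \<le> f x" and mono: "\<And>N x. \<rho> N x \<le> \<rho> (Suc N) x" and lim: "\<And>x. (\<lambda>N. \<rho> N x) \<longlonglongrightarrow> 1"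
  shows "(\<lambda>N. \<integral>\<^sup>+ x. ennreal (f x * \<rho> N x) \<partial>M) \<longlonglongrightarrow> (\<integral>\<^sup>+ x. ennreal (f x) \<partial>M)"
proof (rule nn_integral_LIMSEQ)
  show "incseq (\<lambda>N x. ennreal (f x * \<rho> N x))"
    using f mono by (auto intro!: incseq_SucI le_funI ennreal_leI mult_left_mono)
  show "(\<lambda>N. ennreal (f x * \<rho> N x)) \<longlonglongrightarrow> ennreal (f x)" for x
    using tendsto_mult[OF tendsto_const lim, of "f x" x] by (intro tendsto_ennrealI) simp
qed measurable

text \<open>The common shape of both summation methods: \<theta> is the twist in the variable z and
  0 in the central variable. Times (\<tau> / \<pi>)^(d/2), in dimension d, the Gaussian is an
  approximate identity as \<tau> grows.\<close>

definition gauss_form :: "real \<Rightarrow> ('a \<Rightarrow> 'a \<Rightarrow> real) \<Rightarrow> ('a::euclidean_space \<Rightarrow> complex) \<Rightarrow> complex" where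
  "gauss_form \<tau> \<theta> g = (\<integral>p. g (fst p) * cnj (g (snd p)) *
     (complex_of_real (exp (- \<tau> * (norm (fst p - snd p))\<^sup>2)) * cis (\<theta> (fst p) (snd p))) \<partial>lborel)"

lemma nn_integral_gauss_translate:
  assumes "\<tau> > 0"
  shows "(\<integral>\<^sup>+ y. ennreal (exp (- \<tau> * (norm (x - y :: 'a::euclidean_space))\<^sup>2)) \<partial>lborel) = ennreal (sqrt (pi / \<tau>) ^ DIM('a))"
proof -
  have "(\<integral>\<^sup>+ y. ennreal (exp (- \<tau> * (norm (y :: 'a))\<^sup>2)) \<partial>lborel) = ennreal (sqrt (pi / \<tau>) ^ DIM('a))"
    by (subst nn_integral_eq_integral[OF integrable_gauss_mass[OF assms]]) (simp_all only: integral_gauss_mass[OF assms] exp_ge_zero AE_I2)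
  moreover have "(\<integral>\<^sup>+ y. ennreal (exp (- \<tau> * (norm (y :: 'a))\<^sup>2)) \<partial>lborel) =
      (\<integral>\<^sup>+ y. ennreal (exp (- \<tau> * (norm (x - y :: 'a))\<^sup>2)) \<partial>lborel)"
    by (subst nn_integral_lborel_affine[of _ "-1" x]) auto
  ultimately show ?thesis by simp
qed

text \<open>Schur's test: the phase drops out, 2ab \<le> a^2 + b^2 separates the two copies of g,
  and both marginals of the Gaussian kernel have mass (\<pi> / \<tau>)^(d/2).\<close>

lemma gauss_form_bound:
  fixes g :: "'a::euclidean_space \<Rightarrow> complex"
  assumes \<tau>: "\<tau> > 0" and [measurable]: "g \<in> borel_measurable borel"
  shows "ennreal (cmod (gauss_form \<tau> \<theta> g)) \<le> ennreal (sqrt (pi / \<tau>) ^ DIM('a)) * sq_norm g"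
proof -
  let ?E = "\<lambda>x y :: 'a. ennreal (exp (- \<tau> * (norm (x - y))\<^sup>2))"
  let ?S = "sq_norm g"
  let ?c = "ennreal (sqrt (pi / \<tau>) ^ DIM('a))"
  have half: "(\<integral>\<^sup>+ p. ennreal ((cmod (g (fst p)))\<^sup>2) * ?E (fst p) (snd p) \<partial>lborel) = ?c * ?S"
  proof -
    have "(\<integral>\<^sup>+ p. ennreal ((cmod (g (fst p)))\<^sup>2) * ?E (fst p) (snd p) \<partial>lborel) =
       (\<integral>\<^sup>+ x. \<integral>\<^sup>+ y. ennreal ((cmod (g x))\<^sup>2) * ?E x y \<partial>lborel \<partial>lborel)"
      by (subst lborel_prod[symmetric], subst lborel.nn_integral_fst[symmetric]) auto
    also have "\<dots> = (\<integral>\<^sup>+ x. ennreal ((cmod (g x))\<^sup>2) * ?c \<partial>lborel)"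
      by (subst nn_integral_cmult, simp) (simp only: nn_integral_gauss_translate[OF \<tau>])
    also have "\<dots> = ?c * ?S"
      by (subst nn_integral_multc) (auto simp: mult.commute)
    finally show ?thesis .
  qed
  have half': "(\<integral>\<^sup>+ p. ennreal ((cmod (g (snd p)))\<^sup>2) * ?E (fst p) (snd p) \<partial>lborel) = ?c * ?S"
  proof -
    have "(\<integral>\<^sup>+ p. ennreal ((cmod (g (snd p)))\<^sup>2) * ?E (fst p) (snd p) \<partial>lborel) =
       (\<integral>\<^sup>+ y. \<integral>\<^sup>+ x. ennreal ((cmod (g y))\<^sup>2) * ?E y x \<partial>lborel \<partial>lborel)"
      by (subst lborel_prod[symmetric], subst lborel_pair.nn_integral_snd[symmetric]) (auto simp: norm_minus_commute)
    also have "\<dots> = (\<integral>\<^sup>+ x. ennreal ((cmod (g x))\<^sup>2) * ?c \<partial>lborel)"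
      by (subst nn_integral_cmult, simp) (simp only: nn_integral_gauss_translate[OF \<tau>])
    also have "\<dots> = ?c * ?S"
      by (subst nn_integral_multc) (auto simp: mult.commute)
    finally show ?thesis .
  qed
  \<comment> \<open>If the integrand is not integrable, the form is 0 by convention and the bound is
    trivial.\<close>
  have "ennreal (cmod (gauss_form \<tau> \<theta> g)) \<le> (\<integral>\<^sup>+ p. ennreal (cmod (g (fst p) * cnj (g (snd p)) *
     (complex_of_real (exp (- \<tau> * (norm (fst p - snd p))\<^sup>2)) * cis (\<theta> (fst p) (snd p))))) \<partial>lborel)"
    unfolding gauss_form_def by (cases "integrable lborel (\<lambda>p. g (fst p) * cnj (g (snd p)) *
     (complex_of_real (exp (- \<tau> * (norm (fst p - snd p))\<^sup>2)) * cis (\<theta> (fst p) (snd p))))")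
      (auto intro!: integral_norm_bound_ennreal simp: not_integrable_integral_eq)
  also have "\<dots> \<le> (\<integral>\<^sup>+ p. ennreal (1/2) * (ennreal ((cmod (g (fst p)))\<^sup>2) * ?E (fst p) (snd p) +
      ennreal ((cmod (g (snd p)))\<^sup>2) * ?E (fst p) (snd p)) \<partial>lborel)"
  proof (rule nn_integral_mono)
    fix p :: "'a \<times> 'a"
    let ?e = "exp (- \<tau> * (norm (fst p - snd p))\<^sup>2)"
    have "cmod (g (fst p) * cnj (g (snd p)) * (complex_of_real ?e * cis (\<theta> (fst p) (snd p)))) =
      cmod (g (fst p)) * cmod (g (snd p)) * ?e"
      by (simp add: norm_mult)
    also have "\<dots> \<le> ((cmod (g (fst p)))\<^sup>2 + (cmod (g (snd p)))\<^sup>2) / 2 * ?e"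
      by (intro mult_right_mono cmod_mult_le_squares) simp
    also have "\<dots> = 1/2 * ((cmod (g (fst p)))\<^sup>2 * ?e + (cmod (g (snd p)))\<^sup>2 * ?e)"
      by (simp add: algebra_simps)
    finally have le: "cmod (g (fst p) * cnj (g (snd p)) * (complex_of_real ?e * cis (\<theta> (fst p) (snd p)))) \<le> \<dots>" .
    have split: "ennreal (1/2 * (x * e + y * e)) = ennreal (1/2) * (ennreal x * ennreal e + ennreal y * ennreal e)"
      if "0 \<le> x" "0 \<le> y" "0 \<le> e" for x y e :: real
    proof -
      have "0 \<le> x * e" "0 \<le> y * e" "0 \<le> (1/2::real)" using that by auto
      then show ?thesis using that
        by (simp only: ennreal_mult ennreal_plus add_nonneg_nonneg)
    qed
    show "ennreal (cmod (g (fst p) * cnj (g (snd p)) * (complex_of_real ?e * cis (\<theta> (fst p) (snd p))))) \<le>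
       ennreal (1/2) * (ennreal ((cmod (g (fst p)))\<^sup>2) * ?E (fst p) (snd p) +
      ennreal ((cmod (g (snd p)))\<^sup>2) * ?E (fst p) (snd p))"
      by (subst split[symmetric]) (use le in \<open>auto intro!: ennreal_leI simp del: mult_minus_left\<close>)
  qed
  also have "\<dots> = ennreal (1/2) * (?c * ?S + ?c * ?S)"
    by (subst nn_integral_cmult, measurable, subst nn_integral_add, measurable) (simp only: half half')
  also have "\<dots> = ?c * ?S"
  proof -
    have "ennreal (1/2) * (x + x) = x" for x
    proof -
      have "ennreal (1/2) * (x + x) = (ennreal (1/2) * 2) * x" by (simp only: mult.assoc mult_2[symmetric])
      also have "ennreal (1/2) * 2 = ennreal (1/2 * 2)" by (subst ennreal_mult) auto
      finally show ?thesis by simp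
    qed
    then show ?thesis by blast
  qed
  finally show ?thesis .
qed

text \<open>Substituting y = x + v / sqrt \<tau> moves the concentration into the argument of g.
  Dominated convergence in v and then in x gives the limit, and the phase tends to \<theta>(x,x) =
  0. Continuity enters as convergence at every point, boundedness as the majorant.\<close>

lemma gauss_form_tendsto:
  fixes g :: "'a::euclidean_space \<Rightarrow> complex" and \<theta> :: "'a \<Rightarrow> 'a \<Rightarrow> real"
  assumes g: "integrable lborel g" "continuous_on UNIV g" "\<And>x. cmod (g x) \<le> C"
    and \<theta>: "continuous_on UNIV (\<lambda>p. \<theta> (fst p) (snd p))" "\<And>x. \<theta> x x = 0"
    and \<tau>: "\<And>N::nat. \<tau> N > 0" "filterlim \<tau> at_top sequentially"
  shows "(\<lambda>N. complex_of_real (sqrt (\<tau> N / pi) ^ DIM('a)) * gauss_form (\<tau> N) \<theta> g) \<longlonglongrightarrow>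
    complex_of_real (\<integral>x. (cmod (g x))\<^sup>2 \<partial>lborel)"
proof -
  have gm[measurable]: "g \<in> borel_measurable borel"
    using g borel_measurable_integrable by auto
  have C: "C \<ge> 0" using g(3) norm_ge_zero order_trans by blast
  have [measurable]: "(\<lambda>p. \<theta> (fst p) (snd p)) \<in> borel_measurable borel"
    by (intro borel_measurable_continuous_onI \<theta>)
  have \<theta>m[measurable (raw)]: "(\<lambda>x. \<theta> (u x) (v x)) \<in> borel_measurable M"
    if "u \<in> borel_measurable M" "v \<in> borel_measurable M" for u v and M :: "'c measure"
    using measurable_compose[OF borel_measurable_Pair[OF that], of "\<lambda>p. \<theta> (fst p) (snd p)"] by simp
  have cm[measurable]: "cnj \<in> borel_measurable borel"
    by (intro borel_measurable_continuous_onI continuous_intros)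
  let ?s = "\<lambda>N. 1 / sqrt (\<tau> N)"
  let ?H = "\<lambda>N x v. g x * cnj (g (x + ?s N *\<^sub>R v)) * (complex_of_real (exp (- 1 * (norm v)\<^sup>2)) * cis (\<theta> x (x + ?s N *\<^sub>R v)))"
  have s0: "?s \<longlonglongrightarrow> 0"
    by (rule tendsto_divide_0[OF tendsto_const filterlim_at_top_imp_at_infinity[OF filterlim_compose[OF sqrt_at_top \<tau>(2)]]])
  have eq: "complex_of_real (sqrt (\<tau> N) ^ DIM('a)) * gauss_form (\<tau> N) \<theta> g = (\<integral>x. \<integral>v. ?H N x v \<partial>lborel \<partial>lborel)" for N
  proof -
    let ?G = "\<lambda>x y. g x * cnj (g y) * (complex_of_real (exp (- \<tau> N * (norm (x - y))\<^sup>2)) * cis (\<theta> x y))"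
    have Gi: "integrable lborel (\<lambda>p. ?G (fst p) (snd p))"
    proof (rule Bochner_Integration.integrable_bound)
      show "integrable lborel (\<lambda>p::'a \<times> 'a. g (fst p) * cnj (g (snd p)))"
        by (rule integrable_tensor) (use g in simp_all)
      show "AE p in lborel. norm (?G (fst p) (snd p)) \<le> norm (g (fst p) * cnj (g (snd p)))"
        using \<tau>(1)[of N] by (auto intro!: AE_I2 simp: norm_mult mult_left_le less_imp_le)
    qed measurable
    have "gauss_form (\<tau> N) \<theta> g = (\<integral>x. \<integral>y. ?G x y \<partial>lborel \<partial>lborel)"
      unfolding gauss_form_def using lborel_pair.integral_fst'[of "\<lambda>p. ?G (fst p) (snd p)"] Gi
      by (simp add: lborel_prod)
    moreover have "complex_of_real (sqrt (\<tau> N) ^ DIM('a)) * (\<integral>y. ?G x y \<partial>lborel) = (\<integral>v. ?H N x v \<partial>lborel)" for x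
    proof -
      have i: "integrable lborel (?G x)"
      proof (rule Bochner_Integration.integrable_bound)
        show "integrable lborel (\<lambda>y. g x * cnj (g y))" using g by simp
        show "AE y in lborel. norm (?G x y) \<le> norm (g x * cnj (g y))"
          using \<tau>(1)[of N] by (auto intro!: AE_I2 simp: norm_mult mult_left_le less_imp_le)
      qed measurable
      have "(\<integral>y. ?G x y \<partial>lborel) = \<bar>?s N\<bar> ^ DIM('a) *\<^sub>R (\<integral>v. ?G x (x + ?s N *\<^sub>R v) \<partial>lborel)"
        by (rule integral_lborel_affine[OF i]) (use \<tau>(1)[of N] in simp)
      also have "(\<lambda>v. ?G x (x + ?s N *\<^sub>R v)) = ?H N x"
        using \<tau>(1)[of N] by (intro ext) (simp add: power_mult_distrib power_divide)
      finally show ?thesis using \<tau>(1)[of N] by (simp add: scaleR_conv_of_real power_divide)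
    qed
    ultimately show ?thesis by (simp flip: integral_mult_right_zero)
  qed
  let ?L = "\<lambda>x. \<integral>v. g x * cnj (g x) * complex_of_real (exp (- 1 * (norm (v::'a))\<^sup>2)) \<partial>lborel"
  have ebd: "integrable lborel (\<lambda>v::'a. exp (- 1 * (norm v)\<^sup>2))"
    by (rule integrable_gauss_mass) simp
  have Hb: "norm (?H N x v) \<le> cmod (g x) * C * exp (- 1 * (norm v)\<^sup>2)" for N x v
    using g(3) by (simp add: norm_mult mult_left_mono mult_right_mono)
  have inner: "(\<lambda>N. \<integral>v. ?H N x v \<partial>lborel) \<longlonglongrightarrow> ?L x" for x
  proof (rule integral_dominated_convergence)
    show "integrable lborel (\<lambda>v::'a. cmod (g x) * C * exp (- 1 * (norm v)\<^sup>2))"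
      using ebd by (intro integrable_mult_right)
    show "AE v in lborel. (\<lambda>N. ?H N x v) \<longlonglongrightarrow> g x * cnj (g x) * complex_of_real (exp (- 1 * (norm v)\<^sup>2))"
    proof (rule AE_I2)
      fix v
      have xv: "(\<lambda>N. x + ?s N *\<^sub>R v) \<longlonglongrightarrow> x"
        using tendsto_add[OF tendsto_const tendsto_scaleR[OF s0 tendsto_const], of x v] by simp
      have "isCont g x" "isCont (\<lambda>p. \<theta> (fst p) (snd p)) (x, x)"
        using g(2) \<theta>(1) by (auto simp: continuous_on_eq_continuous_at)
      from isCont_tendsto_compose[OF this(1) xv] isCont_tendsto_compose[OF this(2) tendsto_Pair[OF tendsto_const xv]]
      have l: "(\<lambda>N. g (x + ?s N *\<^sub>R v)) \<longlonglongrightarrow> g x" "(\<lambda>N. \<theta> x (x + ?s N *\<^sub>R v)) \<longlonglongrightarrow> 0"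
        using \<theta>(2) by auto
      have "(\<lambda>N. ?H N x v) \<longlonglongrightarrow> g x * cnj (g x) * (complex_of_real (exp (- 1 * (norm v)\<^sup>2)) * cis 0)"
        using l by (intro tendsto_intros)
      then show "(\<lambda>N. ?H N x v) \<longlonglongrightarrow> g x * cnj (g x) * complex_of_real (exp (- 1 * (norm v)\<^sup>2))"
        by simp
    qed
    show "AE v in lborel. norm (?H N x v) \<le> cmod (g x) * C * exp (- 1 * (norm v)\<^sup>2)" for N
      using Hb by blast
  qed measurable
  have Leq: "?L x = complex_of_real (sqrt pi ^ DIM('a)) * complex_of_real ((cmod (g x))\<^sup>2)" for x
  proof -
    have "?L x = g x * cnj (g x) * complex_of_real (\<integral>v. exp (- 1 * (norm (v::'a))\<^sup>2) \<partial>lborel)"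
      by (simp only: integral_mult_right_zero integral_complex_of_real)
    also have "(\<integral>v. exp (- 1 * (norm (v::'a))\<^sup>2) \<partial>lborel) = sqrt pi ^ DIM('a)"
      using integral_gauss_mass[of 1, where 'a='a] by simp
    finally show ?thesis by (simp only: complex_norm_square mult.commute)
  qed
  have outer: "(\<lambda>N. \<integral>x. \<integral>v. ?H N x v \<partial>lborel \<partial>lborel) \<longlonglongrightarrow> (\<integral>x. ?L x \<partial>lborel)"
  proof (rule integral_dominated_convergence)
    show "integrable lborel (\<lambda>x. cmod (g x) * (C * sqrt pi ^ DIM('a)))"
      using g(1) by simp
    show "AE x in lborel. (\<lambda>N. \<integral>v. ?H N x v \<partial>lborel) \<longlonglongrightarrow> ?L x"
      using inner by blast
    show "AE x in lborel. norm (\<integral>v. ?H N x v \<partial>lborel) \<le> cmod (g x) * (C * sqrt pi ^ DIM('a))" for N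
    proof (rule AE_I2)
      fix x
      have i: "integrable lborel (\<lambda>v::'a. cmod (g x) * C * exp (- 1 * (norm v)\<^sup>2))"
        using ebd by (intro integrable_mult_right)
      have "norm (\<integral>v. ?H N x v \<partial>lborel) \<le> (\<integral>v. cmod (g x) * C * exp (- 1 * (norm (v::'a))\<^sup>2) \<partial>lborel)"
        by (rule Bochner_Integration.integral_norm_bound_integral[OF Bochner_Integration.integrable_bound[OF i] i Hb])
          (use order_trans[OF Hb abs_ge_self] in auto)
      also have "\<dots> = cmod (g x) * (C * sqrt pi ^ DIM('a))"
        using integral_gauss_mass[of 1, where 'a='a] by simp
      finally show "norm (\<integral>v. ?H N x v \<partial>lborel) \<le> cmod (g x) * (C * sqrt pi ^ DIM('a))" .
    qed
    show "(\<lambda>x. \<integral>v. ?H N x v \<partial>lborel) \<in> borel_measurable lborel" for N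
      by measurable
    show "(\<lambda>x. ?L x) \<in> borel_measurable lborel"
      unfolding Leq by measurable
  qed
  have "(\<lambda>N. complex_of_real (1 / sqrt pi ^ DIM('a)) * (\<integral>x. \<integral>v. ?H N x v \<partial>lborel \<partial>lborel)) \<longlonglongrightarrow>
      complex_of_real (1 / sqrt pi ^ DIM('a)) * (\<integral>x. ?L x \<partial>lborel)"
    by (intro tendsto_mult tendsto_const outer)
  moreover have "complex_of_real (1 / sqrt pi ^ DIM('a)) * (\<integral>x. ?L x \<partial>lborel) = complex_of_real (\<integral>x. (cmod (g x))\<^sup>2 \<partial>lborel)"
    unfolding Leq by (simp del: of_real_power)
  moreover have "complex_of_real (sqrt (\<tau> N / pi) ^ DIM('a)) * gauss_form (\<tau> N) \<theta> g =
     complex_of_real (1 / sqrt pi ^ DIM('a)) * (\<integral>x. \<integral>v. ?H N x v \<partial>lborel \<partial>lborel)" for N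
    unfolding eq[symmetric] by (simp add: real_sqrt_divide power_divide)
  ultimately show ?thesis by simp
qed

context
  fixes g :: "'a::euclidean_space \<Rightarrow> complex" and \<theta> :: "'a \<Rightarrow> 'a \<Rightarrow> real"
    and \<tau> c :: "nat \<Rightarrow> real" and c' :: real and S :: ennreal
  assumes \<tau>: "\<And>N. \<tau> N > 0" and c: "\<And>N. 0 \<le> c N" "c \<longlonglongrightarrow> c'" "0 < c'"
    and lim: "(\<lambda>N. ennreal (c N * Re (complex_of_real (sqrt (\<tau> N / pi) ^ DIM('a)) * gauss_form (\<tau> N) \<theta> g))) \<longlonglongrightarrow> S"
begin

text \<open>The Schur bound exactly compensates (\<tau> / \<pi>)^(d/2), so each approximant is at
  most c_N times the square norm, and the inequality passes to the limit for every measurable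
  g.\<close>

lemma gauss_form_limit_le:
  assumes [measurable]: "g \<in> borel_measurable borel"
  shows "S \<le> ennreal c' * sq_norm g"
proof (cases "sq_norm g = top")
  case True
  then show ?thesis using c(3) by (simp add: ennreal_mult_top)
next
  case False
  define X where "X = sq_norm g"
  have le: "ennreal (c N * Re (complex_of_real (sqrt (\<tau> N / pi) ^ DIM('a)) * gauss_form (\<tau> N) \<theta> g)) \<le> X * ennreal (c N)" for N
  proof -
    let ?G = "gauss_form (\<tau> N) \<theta> g"
    let ?s = "sqrt (\<tau> N / pi) ^ DIM('a)"
    have "sqrt (\<tau> N / pi) * sqrt (pi / \<tau> N) = 1"
      using \<tau>[of N] by (simp flip: real_sqrt_mult)
    then have s: "?s > 0" "?s * sqrt (pi / \<tau> N) ^ DIM('a) = 1"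
      using \<tau>[of N] by (simp, simp only: power_mult_distrib[symmetric] power_one)
    have "Re (complex_of_real a * z) \<le> a * cmod z" if "0 \<le> a" for a z
      using that by (simp add: mult_left_mono complex_Re_le_cmod)
    from this[OF less_imp_le[OF s(1)], of ?G] have "ennreal (Re (complex_of_real ?s * ?G)) \<le> ennreal ?s * ennreal (cmod ?G)"
      using s(1) by (subst ennreal_mult[symmetric]) (auto intro: ennreal_leI)
    also have "\<dots> \<le> ennreal ?s * (ennreal (sqrt (pi / \<tau> N) ^ DIM('a)) * X)"
      unfolding X_def by (intro mult_left_mono gauss_form_bound \<tau> assms) simp
    also have "\<dots> = ennreal (?s * sqrt (pi / \<tau> N) ^ DIM('a)) * X"
      by (subst ennreal_mult) (use s(1) \<tau>[of N] in \<open>auto simp: mult.assoc\<close>)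
    also have "\<dots> = X" unfolding s(2) by simp
    finally have "ennreal (c N) * ennreal (Re (complex_of_real ?s * ?G)) \<le> ennreal (c N) * X"
      by (intro mult_left_mono) auto
    then show ?thesis
      using c(1)[of N] by (subst (asm) ennreal_mult'[symmetric]) (auto simp: mult_ac)
  qed
  have "(\<lambda>N. X * ennreal (c N)) \<longlonglongrightarrow> X * ennreal c'"
    using False by (intro ennreal_tendsto_cmult tendsto_ennrealI c) (auto simp: X_def top.not_eq_extremum)
  then have "S \<le> X * ennreal c'"
    using le by (intro LIMSEQ_le[OF lim]) auto
  then show ?thesis by (simp only: X_def mult.commute)
qed

text \<open>Under continuity and boundedness the approximate identity converges to the square norm,
  and the limit S given by the summation method must agree with that one.\<close>

lemma gauss_form_limit_eq:
  assumes g: "integrable lborel g" "continuous_on UNIV g" "\<And>x. cmod (g x) \<le> C"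
    and \<theta>: "continuous_on UNIV (\<lambda>p. \<theta> (fst p) (snd p))" "\<And>x. \<theta> x x = 0"
    and \<tau>': "filterlim \<tau> at_top sequentially"
  shows "S = ennreal c' * sq_norm g"
proof -
  have gm[measurable]: "g \<in> borel_measurable borel"
    using g borel_measurable_integrable by auto
  have g2: "integrable lborel (\<lambda>z. (cmod (g z))\<^sup>2)"
  proof (rule Bochner_Integration.integrable_bound)
    show "integrable lborel (\<lambda>z. C * cmod (g z))" using g by simp
    show "AE z in lborel. norm ((cmod (g z))\<^sup>2) \<le> norm (C * cmod (g z))"
      using g(3) order_trans[OF norm_ge_zero g(3)] by (auto intro!: AE_I2 mult_right_mono simp: power2_eq_square abs_mult)
  qed measurable
  have "(\<lambda>N. Re (complex_of_real (sqrt (\<tau> N / pi) ^ DIM('a)) * gauss_form (\<tau> N) \<theta> g)) \<longlonglongrightarrow>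
      Re (complex_of_real (\<integral>z. (cmod (g z))\<^sup>2 \<partial>lborel))"
    by (rule tendsto_Re, rule gauss_form_tendsto[OF g \<theta> \<tau> \<tau>'])
  from LIMSEQ_unique[OF lim tendsto_ennrealI[OF tendsto_mult[OF c(2) this]]]
  have "S = ennreal (c' * (\<integral>z. (cmod (g z))\<^sup>2 \<partial>lborel))"
    by (simp only: Re_complex_of_real)
  then show ?thesis
    using c(3) by (subst nn_integral_eq_integral[OF g2]) (auto simp: ennreal_mult)
qed

end

section \<open>Laguerre polynomials and their generating function\<close>

text \<open>Coefficients are removed in order: once those below n vanish, division by r^n leaves a
  series whose value at 0 is c_n, and its sum is 0 for all small r \<noteq> 0.\<close>

lemma power_series_zero:
  fixes c :: "nat \<Rightarrow> real"
  assumes \<epsilon>: "\<epsilon> > 0" and zero: "\<And>r. \<bar>r\<bar> < \<epsilon> \<Longrightarrow> (\<lambda>n. c n * r ^ n) sums 0"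
  shows "c n = 0"
proof (induction n rule: less_induct)
  case (less n)
  have "(\<lambda>i. c (i + n) * r ^ i) sums 0" if "r \<noteq> 0" "norm r < \<epsilon>" for r :: real
  proof -
    have "(\<lambda>i. c (i + n) * r ^ (i + n)) sums (0 - (\<Sum>i<n. c i * r ^ i))"
      using zero[of r] that by (intro sums_split_initial_segment) auto
    also have "(\<Sum>i<n. c i * r ^ i) = 0" using less by (intro sum.neutral) auto
    finally have "(\<lambda>i. c (i + n) * r ^ (i + n) / r ^ n) sums (0 / r ^ n)"
      by (intro sums_divide) auto
    then show ?thesis using that by (simp add: power_add)
  qed
  from powser_limit_0_strong[OF \<epsilon> this] have "((\<lambda>_. 0) \<longlongrightarrow> c (0 + n)) (at (0::real))" by simp
  from LIM_unique[OF this tendsto_const] show ?case by simp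
qed

text \<open>The generating functions are used at real r only, with complex integrals as
  coefficients; hence the reduction to real and imaginary parts.\<close>

lemma power_series_unique:
  fixes a b :: "nat \<Rightarrow> complex"
  assumes \<epsilon>: "\<epsilon> > 0"
    and a: "\<And>r. \<bar>r\<bar> < \<epsilon> \<Longrightarrow> (\<lambda>n. a n * complex_of_real (r ^ n)) sums s r"
    and b: "\<And>r. \<bar>r\<bar> < \<epsilon> \<Longrightarrow> (\<lambda>n. b n * complex_of_real (r ^ n)) sums s r"
  shows "a n = b n"
proof (rule complex_eqI)
  have d: "(\<lambda>n. (a n - b n) * complex_of_real (r ^ n)) sums 0" if "\<bar>r\<bar> < \<epsilon>" for r
    using sums_diff[OF a[OF that] b[OF that]] by (simp add: algebra_simps)
  have "Re (a n - b n) = 0"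
    by (rule power_series_zero[OF \<epsilon>, where c="\<lambda>n. Re (a n - b n)"]) (use sums_Re[OF d] in \<open>simp del: of_real_power\<close>)
  moreover have "Im (a n - b n) = 0"
    by (rule power_series_zero[OF \<epsilon>, where c="\<lambda>n. Im (a n - b n)"]) (use sums_Im[OF d] in \<open>simp del: of_real_power\<close>)
  ultimately show "Re (a n) = Re (b n)" "Im (a n) = Im (b n)" by simp_all
qed

text \<open>The binomial theorem for two commuting operators, differentiation and minus the
  identity.\<close>

lemma iter_pderiv_minus_id:
  fixes p :: "real poly"
  shows "((\<lambda>q. pderiv q - q) ^^ k) p = (\<Sum>j\<le>k. smult ((-1) ^ j * of_nat (k choose j)) ((pderiv ^^ (k - j)) p))"
proof (induction k)
  case (Suc k)
  let ?T = "\<lambda>i. (pderiv ^^ i) p"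
  let ?c = "\<lambda>k j. (-1) ^ j * of_nat (k choose j) :: real"
  have "((\<lambda>q. pderiv q - q) ^^ Suc k) p = (\<Sum>j\<le>k. smult (?c k j) (?T (Suc k - j))) - (\<Sum>j\<le>k. smult (?c k j) (?T (k - j)))"
    using Suc by (simp add: higher_pderiv_sum[of 1, simplified] pderiv_smult Suc_diff_le)
  also have "(\<Sum>j\<le>k. smult (?c k j) (?T (Suc k - j))) = (\<Sum>j\<le>Suc k. smult (?c k j) (?T (Suc k - j)))"
    by simp
  also have "\<dots> = ?T (Suc k) + (\<Sum>j\<le>k. smult (?c k (Suc j)) (?T (k - j)))"
    by (subst sum.atMost_Suc_shift) simp
  also have "\<dots> - (\<Sum>j\<le>k. smult (?c k j) (?T (k - j))) = ?T (Suc k) + (\<Sum>j\<le>k. smult (?c (Suc k) (Suc j)) (?T (k - j)))"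
  proof -
    have "?c k (Suc j) - ?c k j = ?c (Suc k) (Suc j)" for j by (simp add: algebra_simps)
    then have "smult (?c k (Suc j)) q - smult (?c k j) q = smult (?c (Suc k) (Suc j)) q" for j and q :: "real poly"
      by (simp only: smult_diff_left[symmetric])
    then show ?thesis by (simp only: add_diff_eq[symmetric] sum_subtractf[symmetric])
  qed
  also have "\<dots> = (\<Sum>j\<le>Suc k. smult (?c (Suc k) j) (?T (Suc k - j)))"
    by (subst sum.atMost_Suc_shift) simp
  finally show ?case .
qed simp

text \<open>Rodrigues' formula freed from exponentials and negative powers: both sides agree at all
  t > 0, hence as polynomials.\<close>

lemma laguerre_times_power:
  "[:0, 1:] ^ d * smult (fact k) (laguerre d k) = ((\<lambda>q. pderiv q - q) ^^ k) ([:0, 1:] ^ (k + d))"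
    (is "?L = ?R")
proof (rule ccontr)
  assume "?L \<noteq> ?R"
  then have "finite {x. poly (?L - ?R) x = 0}" by (intro poly_roots_finite) simp
  moreover have "poly ?L t = poly ?R t" if "t > 0" for t
  proof -
    have "(\<lambda>s::real. exp (- s) * s ^ (k + d)) = (\<lambda>s. exp (- s) * poly ([:0, 1:] ^ (k + d)) s)"
      by simp
    then have D: "(deriv ^^ k) (\<lambda>s. exp (- s) * s ^ (k + d)) t = exp (- t) * poly ?R t"
      using laguerre_iter_deriv[of k "[:0, 1:] ^ (k + d)"] by simp
    show ?thesis using that unfolding poly_mult poly_smult laguerre_rodrigues[OF that] D
      by (simp add: power_int_minus exp_minus field_simps)
  qed
  then have "{0<..} \<subseteq> {x. poly (?L - ?R) x = 0}" by auto
  ultimately show False using infinite_Ioi finite_subset by blast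
qed

lemma coeff_laguerre:
  "coeff (laguerre d k) i = (if i \<le> k then (-1) ^ i * real ((k + d) choose (k - i)) / fact i else 0)"
proof -
  have X: "[:0, 1::real:] ^ m = monom 1 m" for m by (simp add: monom_altdef)
  have "fact k * coeff (laguerre d k) i = coeff (monom 1 d * smult (fact k) (laguerre d k)) (d + i)"
    by (simp add: coeff_monom_mult)
  also have "\<dots> = (\<Sum>j\<le>k. (-1) ^ j * of_nat (k choose j) * (pochhammer (of_nat (Suc (d + i))) (k - j) * coeff (monom 1 (k + d)) (d + i + (k - j))))"
    unfolding laguerre_times_power[unfolded X] iter_pderiv_minus_id
    by (simp add: coeff_sum coeff_higher_pderiv)
  \<comment> \<open>The derivative of order k - j of X^(k+d) is a multiple of X^(d+j), so X^(d+i)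
    arises only for j = i.\<close>
  also have "\<dots> = (\<Sum>j\<le>k. if j = i then (-1) ^ i * of_nat (k choose i) * pochhammer (of_nat (Suc (d + i))) (k - i) else 0)"
    by (intro sum.cong refl) auto
  also have "\<dots> = (if i \<le> k then (-1) ^ i * of_nat (k choose i) * pochhammer (of_nat (Suc (d + i))) (k - i) else 0)"
    by simp
  finally have *: "fact k * coeff (laguerre d k) i = \<dots>" .
  have poch: "pochhammer (of_nat (Suc n)) m * fact n = (fact (n + m) :: real)" for n m
  proof (induction m)
    case (Suc m)
    have "pochhammer (of_nat (Suc n)) (Suc m) * fact n = (pochhammer (of_nat (Suc n)) m * fact n) * (of_nat (Suc (n + m)) :: real)"
      by (simp add: pochhammer_Suc mult_ac)
    then show ?case unfolding Suc by (simp add: mult.commute)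
  qed simp
  show ?thesis
  proof (cases "i \<le> k")
    case True
    have p: "pochhammer (of_nat (Suc (d + i))) (k - i) = (fact (d + k) :: real) / fact (d + i)"
      using poch[of "d + i" "k - i"] True by (simp add: field_simps)
    have c: "real (k choose i) = fact k / (fact i * fact (k - i))"
      using True by (rule binomial_fact)
    have c': "real ((k + d) choose (k - i)) = fact (d + k) / (fact (k - i) * fact (d + i))"
      using True binomial_fact[of "k - i" "k + d", where 'a=real] by (simp add: add.commute)
    have "fact k * coeff (laguerre d k) i = (-1) ^ i * of_nat (k choose i) * pochhammer (of_nat (Suc (d + i))) (k - i)"
      using * True by (simp only: if_True)
    also have "\<dots> = fact k * ((-1) ^ i * real ((k + d) choose (k - i)) / fact i)"
      unfolding p c c' by (simp add: mult_ac)
    finally have "fact k * coeff (laguerre d k) i = fact k * ((-1) ^ i * real ((k + d) choose (k - i)) / fact i)" .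
    then have "coeff (laguerre d k) i = (-1) ^ i * real ((k + d) choose (k - i)) / fact i"
      by (simp only: mult_left_cancel[OF fact_nonzero])
    then show ?thesis using True by simp
  qed (use * in simp)
qed

lemma poly_laguerre:
  "poly (laguerre d k) x = (\<Sum>i\<le>k. (-1) ^ i * real ((k + d) choose (k - i)) / fact i * x ^ i)"
proof -
  have "degree (laguerre d k) \<le> k" by (rule degree_le) (simp add: coeff_laguerre)
  then have "poly (laguerre d k) x = (\<Sum>i\<le>k. coeff (laguerre d k) i * x ^ i)"
    unfolding poly_altdef by (intro sum.mono_neutral_left) (auto simp: coeff_eq_0)
  also have "\<dots> = (\<Sum>i\<le>k. (-1) ^ i * real ((k + d) choose (k - i)) / fact i * x ^ i)"
    by (intro sum.cong) (auto simp: coeff_laguerre)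
  finally show ?thesis .
qed

section \<open>Generating functions\<close>

lemma negative_binomial_sums:
  fixes r :: real
  assumes "\<bar>r\<bar> < 1"
  shows "(\<lambda>m. real ((m + N) choose m) * r ^ m) sums (1 / (1 - r) ^ Suc N)"
proof -
  have "(\<lambda>m. (- real (Suc N) gchoose m) * (- r) ^ m) sums (1 + - r) powr (- real (Suc N))"
    by (rule gen_binomial_real) (use assms in simp)
  moreover have "(- real (Suc N) gchoose m) * (- r) ^ m = real ((m + N) choose m) * r ^ m" for m
  proof -
    have "real ((m + N) choose m) = (real (Suc N) + real m - 1 gchoose m)"
      by (simp add: binomial_gbinomial add.commute)
    moreover have "(- real (Suc N) gchoose m) = (-1) ^ m * (real (Suc N) + real m - 1 gchoose m)"
      by (rule gbinomial_minus)
    moreover have "(- r) ^ m = (-1) ^ m * r ^ m" by (rule power_minus)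
    moreover have "(-1) ^ m * (-1) ^ m = (1::real)" by (simp flip: power_mult_distrib)
    ultimately show ?thesis by simp
  qed
  moreover have "(1 + - r) powr (- real (Suc N)) = 1 / (1 - r) ^ Suc N"
    using assms powr_realpow[of "1 - r" "Suc N"] by (simp add: powr_minus divide_inverse del: power_Suc of_nat_Suc)
  ultimately show ?thesis by (simp only:)
qed

text \<open>With m = k - i the triangle becomes a full quadrant: the sum over m is a negative
  binomial series, the sum over i an exponential series, and the same computation with |x| and |r|
  gives absolute summability. The sign (-1)^i is left out, so that -x can be inserted for the
  generating function and x \<ge> 0 for a bound on absolute values.\<close>

lemma laguerre_double_sum:
  fixes r x :: real
  assumes r: "\<bar>r\<bar> < 1"
  shows "((\<lambda>(k, i). r ^ k * (real ((k + d) choose (k - i)) / fact i * x ^ i)) has_sum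
    (exp (x * r / (1 - r)) / (1 - r) ^ Suc d)) (SIGMA k:UNIV. {..k})"
proof -
  define f where "f = (\<lambda>(i, m). (x * r) ^ i / fact i * (real ((m + (i + d)) choose m) * r ^ m))"
  have inner: "((\<lambda>m. (y * s) ^ i / fact i * (real ((m + (i + d)) choose m) * s ^ m)) has_sum
      ((y * s / (1 - s)) ^ i / fact i * (1 / (1 - s) ^ Suc d))) UNIV" if s: "\<bar>s\<bar> < 1" for i and s y :: real
  proof -
    have "summable (\<lambda>m. norm (real ((m + (i + d)) choose m) * s ^ m))"
      using sums_summable[OF negative_binomial_sums[of "\<bar>s\<bar>" "i + d"]] s by (simp add: abs_mult power_abs)
    from norm_summable_imp_has_sum[OF this negative_binomial_sums[OF s]]
    have "((\<lambda>m. (y * s) ^ i / fact i * (real ((m + (i + d)) choose m) * s ^ m)) has_sum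
      ((y * s) ^ i / fact i * (1 / (1 - s) ^ Suc (i + d)))) UNIV"
      by (rule has_sum_cmult_right)
    then show ?thesis by (simp add: power_add power_divide mult_ac)
  qed
  have outer: "((\<lambda>i. (y * s / (1 - s)) ^ i / fact i * (1 / (1 - s) ^ Suc d)) has_sum
      (exp (y * s / (1 - s)) * (1 / (1 - s) ^ Suc d))) UNIV" for s y :: real
  proof (rule has_sum_cmult_left)
    show "((\<lambda>i. (y * s / (1 - s)) ^ i / fact i) has_sum exp (y * s / (1 - s))) UNIV"
      using exp_converges[of "y * s / (1 - s)"] summable_norm_exp[of "y * s / (1 - s)"]
      by (intro norm_summable_imp_has_sum) (auto simp: divide_inverse mult.commute)
  qed
  have abs: "(\<lambda>p. norm (f p)) summable_on UNIV \<times> UNIV"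
  proof (subst Infinite_Sum.abs_summable_on_Sigma_iff, intro conjI ballI)
    have n: "norm (f (i, m)) = (\<bar>x\<bar> * \<bar>r\<bar>) ^ i / fact i * (real ((m + (i + d)) choose m) * \<bar>r\<bar> ^ m)" for i m
      by (simp add: f_def abs_mult power_abs power_mult_distrib)
    have i: "((\<lambda>m. norm (f (i, m))) has_sum ((\<bar>x\<bar> * \<bar>r\<bar> / (1 - \<bar>r\<bar>)) ^ i / fact i * (1 / (1 - \<bar>r\<bar>) ^ Suc d))) UNIV" for i
      unfolding n by (rule inner) (use r in simp)
    show "(\<lambda>m. norm (f (i, m))) summable_on UNIV" for i
      using i by (rule has_sum_imp_summable)
    have eq: "(\<Sum>\<^sub>\<infinity>m. norm (f (i, m))) = (\<bar>x\<bar> * \<bar>r\<bar> / (1 - \<bar>r\<bar>)) ^ i / fact i * (1 / (1 - \<bar>r\<bar>) ^ Suc d)" for i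
      using i by (rule infsumI)
    have "(\<lambda>i. (\<bar>x\<bar> * \<bar>r\<bar> / (1 - \<bar>r\<bar>)) ^ i / fact i * (1 / (1 - \<bar>r\<bar>) ^ Suc d)) summable_on UNIV"
      using outer[of "\<bar>x\<bar>" "\<bar>r\<bar>"] by (rule has_sum_imp_summable)
    moreover have "norm ((\<bar>x\<bar> * \<bar>r\<bar> / (1 - \<bar>r\<bar>)) ^ i / fact i * (1 / (1 - \<bar>r\<bar>) ^ Suc d)) =
      (\<bar>x\<bar> * \<bar>r\<bar> / (1 - \<bar>r\<bar>)) ^ i / fact i * (1 / (1 - \<bar>r\<bar>) ^ Suc d)" for i
      using r by (simp add: abs_mult power_abs)
    ultimately show "(\<lambda>i. norm (\<Sum>\<^sub>\<infinity>m. norm (f (i, m)))) summable_on UNIV"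
      unfolding eq by simp
  qed
  then have fs: "f summable_on UNIV \<times> UNIV" by (rule Infinite_Sum.abs_summable_summable)
  have "(f has_sum (exp (x * r / (1 - r)) * (1 / (1 - r) ^ Suc d))) (UNIV \<times> UNIV)"
  proof -
    obtain s where s: "(f has_sum s) (UNIV \<times> UNIV)" using fs by (auto simp: summable_on_def)
    have "((\<lambda>i. (x * r / (1 - r)) ^ i / fact i * (1 / (1 - r) ^ Suc d)) has_sum s) UNIV"
      using has_sum_SigmaD[OF s, of "\<lambda>i. (x * r / (1 - r)) ^ i / fact i * (1 / (1 - r) ^ Suc d)"] inner[OF r, of x] by (simp add: f_def)
    from has_sum_unique[OF this outer] s show ?thesis by simp
  qed
  moreover have "(f has_sum s) (UNIV \<times> UNIV) \<longleftrightarrow>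
      ((\<lambda>(k, i). r ^ k * (real ((k + d) choose (k - i)) / fact i * x ^ i)) has_sum s) (SIGMA k:UNIV. {..k})" for s
    by (rule has_sum_reindex_bij_witness[where i="\<lambda>(k, i). (i, k - i)" and j="\<lambda>(i, m). (i + m, i)"])
       (auto simp: f_def power_add power_mult_distrib add_ac)
  ultimately show ?thesis by simp
qed

lemma laguerre_generating_function:
  fixes r x :: real
  assumes r: "\<bar>r\<bar> < 1"
  shows "(\<lambda>k. r ^ k * poly (laguerre d k) x) sums (exp (- x * r / (1 - r)) / (1 - r) ^ Suc d)"
proof -
  have "((\<lambda>k. \<Sum>i\<le>k. r ^ k * (real ((k + d) choose (k - i)) / fact i * (- x) ^ i)) has_sum
      (exp (- x * r / (1 - r)) / (1 - r) ^ Suc d)) UNIV"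
    by (rule has_sum_SigmaD[OF laguerre_double_sum[OF r]]) (auto intro: has_sum_finite)
  moreover have "(\<Sum>i\<le>k. r ^ k * (real ((k + d) choose (k - i)) / fact i * (- x) ^ i)) = r ^ k * poly (laguerre d k) x" for k
    unfolding poly_laguerre sum_distrib_left by (intro sum.cong refl) (simp add: power_minus[of x])
  ultimately show ?thesis by (intro has_sum_imp_sums) simp
qed

lemma laguerre_abs_sum_le:
  fixes r x :: real
  assumes r: "0 \<le> r" "r < 1" and x: "0 \<le> x"
  shows "(\<Sum>k<N. r ^ k * \<bar>poly (laguerre d k) x\<bar>) \<le> exp (x * r / (1 - r)) / (1 - r) ^ Suc d"
proof -
  have s: "((\<lambda>k. \<Sum>i\<le>k. r ^ k * (real ((k + d) choose (k - i)) / fact i * x ^ i)) has_sum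
      (exp (x * r / (1 - r)) / (1 - r) ^ Suc d)) UNIV"
    by (rule has_sum_SigmaD[OF laguerre_double_sum]) (use r in \<open>auto intro: has_sum_finite\<close>)
  have "(\<Sum>k<N. r ^ k * \<bar>poly (laguerre d k) x\<bar>) \<le> (\<Sum>k<N. \<Sum>i\<le>k. r ^ k * (real ((k + d) choose (k - i)) / fact i * x ^ i))"
  proof (rule sum_mono)
    fix k
    have "\<bar>poly (laguerre d k) x\<bar> \<le> (\<Sum>i\<le>k. \<bar>(-1) ^ i * real ((k + d) choose (k - i)) / fact i * x ^ i\<bar>)"
      unfolding poly_laguerre by (rule sum_abs)
    also have "\<dots> = (\<Sum>i\<le>k. real ((k + d) choose (k - i)) / fact i * x ^ i)"
      using x by (simp add: abs_mult power_abs)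
    finally show "r ^ k * \<bar>poly (laguerre d k) x\<bar> \<le> (\<Sum>i\<le>k. r ^ k * (real ((k + d) choose (k - i)) / fact i * x ^ i))"
      unfolding sum_distrib_left[symmetric] using r by (intro mult_left_mono) auto
  qed
  also have "\<dots> \<le> (\<Sum>k. \<Sum>i\<le>k. r ^ k * (real ((k + d) choose (k - i)) / fact i * x ^ i))"
    by (rule sum_le_suminf[OF sums_summable[OF has_sum_imp_sums[OF s]]]) (use r x in \<open>auto intro!: sum_nonneg\<close>)
  also have "\<dots> = exp (x * r / (1 - r)) / (1 - r) ^ Suc d"
    by (rule sums_unique[OF has_sum_imp_sums[OF s], symmetric])
  finally show ?thesis .
qed

lemma poly_laguerre_0: "poly (laguerre d k) 0 = real ((k + d) choose k)"
proof -
  have "poly (laguerre d k) 0 = (\<Sum>i\<le>k. if i = 0 then real ((k + d) choose k) else 0)"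
    unfolding poly_laguerre by (intro sum.cong refl) auto
  then show ?thesis by simp
qed

text \<open>The normalization \<open>fan_coeff\<close> therefore divides by the value at the origin,
  which \<open>abs_laguerre_fun_le\<close> identifies as the maximum.\<close>

lemma laguerre_fun_0:
  "laguerre_fun k l (0 :: complex ^ 'n::finite) = 1 / fan_coeff CARD('n) k"
proof -
  have "CARD('n) \<ge> 1" by (simp add: Suc_leI)
  then show ?thesis
    using binomial_fact[OF le_add1[of k "CARD('n) - 1"], where 'a=real]
    by (simp add: laguerre_fun_def poly_laguerre_0 fan_coeff_def)
qed

text \<open>The closed form of the generating function. With r = exp (-2s) the quotient (1 + r) / (1
  - r) is coth s, so this is the heat kernel of the twisted Laplacian up to normalization and
  scaling of time. It concentrates at 0 as r tends to 1.\<close>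

definition laguerre_gauss :: "real \<Rightarrow> real \<Rightarrow> complex ^ 'n \<Rightarrow> real" where
  "laguerre_gauss r l z = exp (- (\<bar>l\<bar> / 4 * ((1 + r) / (1 - r))) * (norm z)\<^sup>2) / (1 - r) ^ CARD('n)"

lemma laguerre_fun_generating_function:
  assumes r: "\<bar>r\<bar> < 1"
  shows "(\<lambda>k. r ^ k * laguerre_fun k l (z :: complex ^ 'n::finite)) sums laguerre_gauss r l z"
proof -
  let ?x = "\<bar>l\<bar> * (norm z)\<^sup>2 / 2"
  have n: "Suc (CARD('n) - 1) = CARD('n)" by simp
  have "(\<lambda>k. r ^ k * poly (laguerre (CARD('n) - 1) k) ?x * exp (- (\<bar>l\<bar> * (norm z)\<^sup>2 / 4))) sums
      (exp (- ?x * r / (1 - r)) / (1 - r) ^ Suc (CARD('n) - 1) * exp (- (\<bar>l\<bar> * (norm z)\<^sup>2 / 4)))"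
    by (intro sums_mult2 laguerre_generating_function r)
  also have "exp (- ?x * r / (1 - r)) / (1 - r) ^ Suc (CARD('n) - 1) * exp (- (\<bar>l\<bar> * (norm z)\<^sup>2 / 4)) = laguerre_gauss r l z"
  proof -
    have "- ?x * r / (1 - r) + - (\<bar>l\<bar> * (norm z)\<^sup>2 / 4) = - (\<bar>l\<bar> / 4 * ((1 + r) / (1 - r))) * (norm z)\<^sup>2"
      using r by (simp add: field_simps)
    then show ?thesis unfolding laguerre_gauss_def n by (simp add: mult_exp_exp)
  qed
  finally show ?thesis by (simp add: laguerre_fun_def mult_ac)
qed

text \<open>Dropping the signs turns the 1 + r of the exponent into 1 - 3r, so this majorant decays
  in z only for r < 1/3. That is why coefficients are later compared for |r| \<le> 1/4.\<close>

lemma laguerre_fun_abs_sum_le: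
  assumes r: "0 \<le> r" "r < 1"
  shows "(\<Sum>k<N. r ^ k * \<bar>laguerre_fun k l (z :: complex ^ 'n::finite)\<bar>) \<le>
    exp (- (\<bar>l\<bar> / 4 * ((1 - 3 * r) / (1 - r))) * (norm z)\<^sup>2) / (1 - r) ^ CARD('n)"
proof -
  let ?x = "\<bar>l\<bar> * (norm z)\<^sup>2 / 2"
  have n: "Suc (CARD('n) - 1) = CARD('n)" by simp
  have "(\<Sum>k<N. r ^ k * \<bar>laguerre_fun k l z\<bar>) =
      (\<Sum>k<N. r ^ k * \<bar>poly (laguerre (CARD('n) - 1) k) ?x\<bar>) * exp (- (\<bar>l\<bar> * (norm z)\<^sup>2 / 4))"
    unfolding sum_distrib_right by (intro sum.cong) (auto simp: laguerre_fun_def abs_mult)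
  also have "\<dots> \<le> exp (?x * r / (1 - r)) / (1 - r) ^ Suc (CARD('n) - 1) * exp (- (\<bar>l\<bar> * (norm z)\<^sup>2 / 4))"
    by (intro mult_right_mono laguerre_abs_sum_le r) auto
  also have "\<dots> = exp (- (\<bar>l\<bar> / 4 * ((1 - 3 * r) / (1 - r))) * (norm z)\<^sup>2) / (1 - r) ^ CARD('n)"
  proof -
    have "?x * r / (1 - r) + - (\<bar>l\<bar> * (norm z)\<^sup>2 / 4) = - (\<bar>l\<bar> / 4 * ((1 - 3 * r) / (1 - r))) * (norm z)\<^sup>2"
      using r by (simp add: field_simps)
    then show ?thesis unfolding n by (simp add: mult_exp_exp)
  qed
  finally show ?thesis .
qed

section \<open>Twisted convolution with Laguerre functions\<close>

definition sympl :: "complex ^ 'n \<Rightarrow> complex ^ 'n::finite \<Rightarrow> real" where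
  "sympl z w = Im (\<Sum>i\<in>UNIV. z $ i * cnj (w $ i))"

text \<open>Turns the symplectic form into the inner product, so that in
  \<open>twisted_gauss\<close> the twist becomes the phase of an ordinary Gaussian integral.\<close>

definition mult_i :: "complex ^ 'n \<Rightarrow> complex ^ 'n" where
  "mult_i w = (\<chi> i. \<i> * w $ i)"

lemma sympl_eq_inner: "sympl z w = mult_i w \<bullet> z"
  by (simp add: sympl_def mult_i_def inner_vec_def inner_complex_def Im_sum algebra_simps)

lemma norm_mult_i: "norm (mult_i w) = norm w"
  by (simp add: mult_i_def norm_vec_def norm_mult)

lemma sympl_self [simp]: "sympl z z = 0"
  by (simp add: sympl_def Im_sum algebra_simps)

lemma sympl_swap: "sympl z w = - sympl w z"
  by (simp add: sympl_def Im_sum algebra_simps sum_negf[symmetric])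

lemma sympl_diff_left: "sympl (x - y) w = sympl x w - sympl y w"
  by (simp add: sympl_eq_inner inner_diff_right)

lemma sympl_add_right: "sympl z (x + y) = sympl z x + sympl z y"
  by (subst (1 2 3) sympl_swap) (simp add: sympl_eq_inner inner_add_right)

lemma sympl_zero_right [simp]: "sympl z 0 = 0"
  by (simp add: sympl_def)

lemma continuous_on_sympl [continuous_intros]:
  "continuous_on A f \<Longrightarrow> continuous_on A g \<Longrightarrow> continuous_on A (\<lambda>x. sympl (f x) (g x))"
  unfolding sympl_def by (intro continuous_intros)

lemma measurable_sympl [measurable (raw)]:
  fixes f g :: "'a \<Rightarrow> complex ^ 'n::finite"
  assumes "f \<in> borel_measurable M" "g \<in> borel_measurable M"
  shows "(\<lambda>x. sympl (f x) (g x)) \<in> borel_measurable M"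
proof -
  have "(\<lambda>p. sympl (fst p) (snd p)) \<in> borel_measurable (borel :: ((complex ^ 'n) \<times> (complex ^ 'n)) measure)"
    by (intro borel_measurable_continuous_onI continuous_intros)
  from measurable_compose[OF borel_measurable_Pair[OF assms] this] show ?thesis by simp
qed

lemma continuous_laguerre_fun: "continuous_on A (laguerre_fun k l)"
  unfolding laguerre_fun_def[abs_def] by (intro continuous_intros) auto

lemma measurable_laguerre_fun [measurable]: "laguerre_fun k l \<in> borel_measurable borel"
  by (intro borel_measurable_continuous_onI continuous_laguerre_fun)

lemma measurable_laguerre_gauss [measurable]: "laguerre_gauss r l \<in> borel_measurable borel"
  unfolding laguerre_gauss_def[abs_def] by measurable

lemma laguerre_fun_minus: "laguerre_fun k l (- z) = laguerre_fun k l z"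
  by (simp add: laguerre_fun_def)

definition laguerre_mass :: "nat \<Rightarrow> real \<Rightarrow> real" where
  "laguerre_mass n l = (2 * pi / \<bar>l\<bar>) ^ n"

lemma laguerre_mass_pos: "l \<noteq> 0 \<Longrightarrow> 0 < laguerre_mass n l"
  by (simp add: laguerre_mass_def)

text \<open>The exponent is quadratic in v, with a real linear term from shifting the second
  Gaussian and a phase from the twist. Integration leaves a Gaussian in w with parameter (a b + 1) /
  (a + b), where the twist contributes the 1; without it the parameter would be that of an ordinary
  convolution of Gaussians.\<close>

lemma
  fixes w :: "complex ^ 'n::finite"
  assumes l: "l \<noteq> 0" and r: "\<bar>r\<bar> < 1" and s: "\<bar>s\<bar> < 1"
  shows twisted_gauss: "(\<integral>v. complex_of_real (laguerre_gauss r l v * laguerre_gauss s l (w - v)) * cis (l / 2 * sympl v w) \<partial>lborel) =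
    complex_of_real (laguerre_mass CARD('n) l * laguerre_gauss (r * s) l w)"
proof -
  define \<kappa> where "\<kappa> = \<bar>l\<bar> / 4"
  define a where "a = (1 + r) / (1 - r)"
  define b where "b = (1 + s) / (1 - s)"
  have \<kappa>: "\<kappa> > 0" using l by (simp add: \<kappa>_def)
  have ab: "a > 0" "b > 0" using r s by (simp_all add: a_def b_def)
  have rs: "\<bar>r * s\<bar> < 1" using r s by (simp add: abs_mult mult_strict_mono[of "\<bar>r\<bar>" 1 "\<bar>s\<bar>" 1, simplified])
  let ?A = "\<kappa> * (a + b)" and ?u = "(2 * \<kappa> * b) *\<^sub>R w" and ?v = "(l / 2) *\<^sub>R mult_i w"
  let ?c = "exp (- (\<kappa> * b) * (norm w)\<^sup>2) / ((1 - r) ^ CARD('n) * (1 - s) ^ CARD('n))"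
  have A: "?A > 0" using \<kappa> ab by simp
  have frac: "x / p * (y / q) = c / (p * q) * e" if "x * y = c * e" for x y c e p q :: real
    using that by simp
  have eq: "complex_of_real (laguerre_gauss r l v * laguerre_gauss s l (w - v)) * cis (l / 2 * sympl v w) =
      complex_of_real ?c * (complex_of_real (exp (- ?A * (norm v)\<^sup>2 + ?u \<bullet> v)) * cis (?v \<bullet> v))" for v
  proof -
    have nrm: "(norm (w - v))\<^sup>2 = (norm w)\<^sup>2 - 2 * (w \<bullet> v) + (norm v)\<^sup>2"
      by (simp add: power2_norm_eq_inner inner_diff_left inner_diff_right inner_commute)
    have "- (\<kappa> * a) * (norm v)\<^sup>2 + - (\<kappa> * b) * (norm (w - v))\<^sup>2 = - (\<kappa> * b) * (norm w)\<^sup>2 + (- ?A * (norm v)\<^sup>2 + ?u \<bullet> v)"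
      unfolding nrm by (simp add: algebra_simps)
    then have "exp (- (\<kappa> * a) * (norm v)\<^sup>2) * exp (- (\<kappa> * b) * (norm (w - v))\<^sup>2) =
        exp (- (\<kappa> * b) * (norm w)\<^sup>2) * exp (- ?A * (norm v)\<^sup>2 + ?u \<bullet> v)"
      by (simp only: mult_exp_exp)
    then have "laguerre_gauss r l v * laguerre_gauss s l (w - v) = ?c * exp (- ?A * (norm v)\<^sup>2 + ?u \<bullet> v)"
      unfolding laguerre_gauss_def \<kappa>_def[symmetric] a_def[symmetric] b_def[symmetric] by (rule frac)
    moreover have "?v \<bullet> v = l / 2 * sympl v w" by (simp add: sympl_eq_inner)
    ultimately show ?thesis by (simp only: of_real_mult mult.assoc)
  qed
  \<comment> \<open>The real and the imaginary linear term are orthogonal because the symplectic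
    form vanishes on the diagonal; no phase remains.\<close>
  have uv: "?u \<bullet> ?v = 0"
    by (simp add: inner_commute[of w] flip: sympl_eq_inner)
  have ex: "- (\<kappa> * b) * (norm w)\<^sup>2 + ((norm ?u)\<^sup>2 - (norm ?v)\<^sup>2) / (4 * ?A) =
      - (\<bar>l\<bar> / 4 * ((1 + r * s) / (1 - r * s))) * (norm w)\<^sup>2"
  proof -
    have nu: "(norm ?u)\<^sup>2 = 4 * \<kappa>\<^sup>2 * b\<^sup>2 * (norm w)\<^sup>2"
      by (simp add: power_mult_distrib)
    have nv: "(norm ?v)\<^sup>2 = 4 * \<kappa>\<^sup>2 * (norm w)\<^sup>2"
      by (simp add: power_mult_distrib norm_mult_i \<kappa>_def power_divide)
    have f1: "((norm ?u)\<^sup>2 - (norm ?v)\<^sup>2) / (4 * ?A) = \<kappa> * ((b\<^sup>2 - 1) / (a + b)) * (norm w)\<^sup>2"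
    proof -
      have "(4 * K\<^sup>2 * B * N - 4 * K\<^sup>2 * N) / (4 * (K * S)) = K * ((B - 1) / S) * N" if "K \<noteq> 0" "S \<noteq> 0" for K B N S :: real
        using that by (simp add: field_simps power2_eq_square)
      then show ?thesis unfolding nu nv using \<kappa> ab by simp
    qed
    have f2: "b - (b\<^sup>2 - 1) / (a + b) = (a * b + 1) / (a + b)"
      using ab by (simp add: field_simps power2_eq_square)
    \<comment> \<open>The addition theorem of coth: for a = coth x and b = coth y the left side is
      coth (x + y), which corresponds to multiplying r and s.\<close>
    have f3: "(a * b + 1) / (a + b) = (1 + r * s) / (1 - r * s)"
    proof -
      have nz: "1 - r \<noteq> 0" "1 - s \<noteq> 0" "1 - r * s \<noteq> 0" using r s rs by auto
      have "a * b + 1 = (2 + 2 * (r * s)) / ((1 - r) * (1 - s))"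
        using nz unfolding a_def b_def by (simp add: divide_simps) (simp add: algebra_simps)
      moreover have "a + b = (2 - 2 * (r * s)) / ((1 - r) * (1 - s))"
        using nz unfolding a_def b_def by (simp add: divide_simps) (simp add: algebra_simps)
      moreover have "(2 + 2 * x) / (2 - 2 * x) = (1 + x) / (1 - x)" if "1 - x \<noteq> 0" for x :: real
        using that by (simp add: divide_simps) (simp add: algebra_simps)
      ultimately show ?thesis using nz by simp
    qed
    have "(b\<^sup>2 - 1) / (a + b) = b - (1 + r * s) / (1 - r * s)"
      using f2 f3 by linarith
    with f1 have e1: "((norm ?u)\<^sup>2 - (norm ?v)\<^sup>2) / (4 * ?A) = \<kappa> * (b - (1 + r * s) / (1 - r * s)) * (norm w)\<^sup>2"
      by (simp only:)
    show ?thesis unfolding e1 \<kappa>_def[symmetric] by (simp add: algebra_simps)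
  qed
  have dim: "sqrt (pi / ?A) ^ DIM(complex ^ 'n) = (pi / ?A) ^ CARD('n)"
    using A by (simp add: power_mult mult.commute[of "CARD('n)"])
  have pre: "(pi / ?A) ^ CARD('n) / ((1 - r) ^ CARD('n) * (1 - s) ^ CARD('n)) = laguerre_mass CARD('n) l / (1 - r * s) ^ CARD('n)"
  proof -
    have nz: "1 - r \<noteq> 0" "1 - s \<noteq> 0" "1 - r * s \<noteq> 0" using r s rs by auto
    have "a + b = (2 - 2 * (r * s)) / ((1 - r) * (1 - s))"
      using nz unfolding a_def b_def by (simp add: divide_simps) (simp add: algebra_simps)
    then have "(a + b) * ((1 - r) * (1 - s)) = 2 - 2 * (r * s)" using nz by simp
    then have e: "?A * ((1 - r) * (1 - s)) = \<kappa> * (2 - 2 * (r * s))" by (simp only: mult.assoc)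
    have "pi / (?A * ((1 - r) * (1 - s))) = (2 * pi / \<bar>l\<bar>) / (1 - r * s)"
      unfolding e unfolding \<kappa>_def using l nz by (simp add: divide_simps)
    then have "(pi / (?A * ((1 - r) * (1 - s)))) ^ CARD('n) = ((2 * pi / \<bar>l\<bar>) / (1 - r * s)) ^ CARD('n)"
      by (simp only:)
    then show ?thesis
      by (simp only: power_divide power_mult_distrib laguerre_mass_def divide_divide_eq_left)
  qed
  have "(\<integral>v. complex_of_real (laguerre_gauss r l v * laguerre_gauss s l (w - v)) * cis (l / 2 * sympl v w) \<partial>lborel) =
      complex_of_real ?c * (complex_of_real (sqrt (pi / ?A) ^ DIM(complex ^ 'n) * exp (((norm ?u)\<^sup>2 - (norm ?v)\<^sup>2) / (4 * ?A))) * cis (?u \<bullet> ?v / (2 * ?A)))"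
    unfolding eq integral_mult_right_zero integral_gauss[OF A] ..
  also have "\<dots> = complex_of_real (?c * ((pi / ?A) ^ CARD('n) * exp (((norm ?u)\<^sup>2 - (norm ?v)\<^sup>2) / (4 * ?A))))"
    unfolding uv dim by simp
  also have "?c * ((pi / ?A) ^ CARD('n) * exp (((norm ?u)\<^sup>2 - (norm ?v)\<^sup>2) / (4 * ?A))) =
      (pi / ?A) ^ CARD('n) / ((1 - r) ^ CARD('n) * (1 - s) ^ CARD('n)) *
      exp (- (\<kappa> * b) * (norm w)\<^sup>2 + ((norm ?u)\<^sup>2 - (norm ?v)\<^sup>2) / (4 * ?A))"
    unfolding exp_add by (simp only: times_divide_eq_left times_divide_eq_right mult_ac)
  also have "\<dots> = laguerre_mass CARD('n) l * laguerre_gauss (r * s) l w"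
    unfolding ex pre laguerre_gauss_def by (simp only: times_divide_eq_left times_divide_eq_right mult_ac)
  finally show ?thesis .
qed

text \<open>The bound of \<open>laguerre_fun_abs_sum_le\<close> at r = 1/4: there (1 - 3r) / (1 - r)
  = 1/3, which turns |l| / 4 into |l| / 12, and 1 / (1 - r) = 4/3.\<close>

definition laguerre_dom :: "real \<Rightarrow> complex ^ 'n \<Rightarrow> real" where
  "laguerre_dom l z = (4 / 3) ^ CARD('n) * exp (- (\<bar>l\<bar> / 12) * (norm z)\<^sup>2)"

lemma laguerre_fun_sum_le_dom:
  assumes "\<bar>r\<bar> \<le> 1 / 4"
  shows "(\<Sum>k<N. \<bar>r ^ k * laguerre_fun k l (z :: complex ^ 'n::finite)\<bar>) \<le> laguerre_dom l z"
proof -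
  have "(\<Sum>k<N. \<bar>r ^ k * laguerre_fun k l z\<bar>) \<le> (\<Sum>k<N. (1 / 4) ^ k * \<bar>laguerre_fun k l z\<bar>)"
    using assms by (intro sum_mono) (auto simp: abs_mult power_abs intro!: mult_right_mono power_mono simp del: power_divide)
  also have "\<dots> \<le> exp (- (\<bar>l\<bar> / 4 * ((1 - 3 * (1/4)) / (1 - 1/4))) * (norm z)\<^sup>2) / (1 - 1/4) ^ CARD('n)"
    by (rule laguerre_fun_abs_sum_le) auto
  also have "\<dots> = laguerre_dom l z"
    by (simp add: laguerre_dom_def power_divide)
  finally show ?thesis .
qed

lemma laguerre_fun_le_dom:
  assumes "\<bar>r\<bar> \<le> 1 / 4"
  shows "\<bar>r ^ k * laguerre_fun k l (z :: complex ^ 'n::finite)\<bar> \<le> laguerre_dom l z"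
proof -
  have "\<bar>r ^ k * laguerre_fun k l z\<bar> \<le> (\<Sum>j<Suc k. \<bar>r ^ j * laguerre_fun j l z\<bar>)"
    by (auto intro: sum_nonneg)
  with laguerre_fun_sum_le_dom[OF assms, of l z "Suc k"] show ?thesis by linarith
qed

lemma laguerre_gauss_le_dom:
  assumes "\<bar>r\<bar> \<le> 1 / 4"
  shows "\<bar>laguerre_gauss r l (z :: complex ^ 'n::finite)\<bar> \<le> laguerre_dom l z"
proof -
  have s: "(\<lambda>k. r ^ k * laguerre_fun k l z) sums laguerre_gauss r l z"
    by (rule laguerre_fun_generating_function) (use assms in simp)
  have "(\<lambda>N. \<bar>\<Sum>k<N. r ^ k * laguerre_fun k l z\<bar>) \<longlonglongrightarrow> \<bar>laguerre_gauss r l z\<bar>"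
    using s unfolding sums_def by (rule tendsto_rabs)
  moreover have "\<bar>\<Sum>k<N. r ^ k * laguerre_fun k l z\<bar> \<le> laguerre_dom l z" for N
    using order_trans[OF sum_abs laguerre_fun_sum_le_dom[OF assms, of l z N]] .
  ultimately show ?thesis by (intro LIMSEQ_le_const2) auto
qed

lemma laguerre_dom_nonneg: "0 \<le> laguerre_dom l z"
  by (simp add: laguerre_dom_def)

lemma laguerre_dom_le: "laguerre_dom l (z :: complex ^ 'n::finite) \<le> (4 / 3) ^ CARD('n)"
  by (simp add: laguerre_dom_def mult_left_le)

lemma laguerre_gauss_le: "\<bar>r\<bar> \<le> 1 / 4 \<Longrightarrow> \<bar>laguerre_gauss r l (z :: complex ^ 'n::finite)\<bar> \<le> (4 / 3) ^ CARD('n)"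
  by (rule order_trans[OF laguerre_gauss_le_dom laguerre_dom_le])

lemma integrable_laguerre_dom: "l \<noteq> 0 \<Longrightarrow> integrable lborel (laguerre_dom l :: complex ^ 'n::finite \<Rightarrow> real)"
  unfolding laguerre_dom_def[abs_def] by (intro integrable_mult_right integrable_gauss_mass) simp

text \<open>Only the left factor is expanded; h stays an arbitrary bounded function, so the lemma
  serves first with a Gaussian and then with a Laguerre function as right factor.\<close>

lemma twisted_series:
  fixes w :: "complex ^ 'n::finite" and h :: "complex ^ 'n \<Rightarrow> real"
  assumes l: "l \<noteq> 0" and r: "\<bar>r\<bar> \<le> 1 / 4" and [measurable]: "h \<in> borel_measurable borel"
    and h: "\<And>v. \<bar>h v\<bar> \<le> C"
  shows "(\<lambda>j. (\<integral>v. complex_of_real (laguerre_fun j l v * h v) * cis (l / 2 * sympl v w) \<partial>lborel) * complex_of_real (r ^ j))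
    sums (\<integral>v. complex_of_real (laguerre_gauss r l v * h v) * cis (l / 2 * sympl v w) \<partial>lborel)"
proof -
  let ?f = "\<lambda>j v. complex_of_real (r ^ j * laguerre_fun j l v) * (complex_of_real (h v) * cis (l / 2 * sympl v w))"
  have "(\<lambda>j. \<integral>v. ?f j v \<partial>lborel) sums (\<integral>v. (\<Sum>j. ?f j v) \<partial>lborel)"
  proof (rule integral_sums_dominated)
    show "integrable lborel (\<lambda>v::complex^'n. laguerre_dom l v * C)"
      by (intro integrable_mult_left integrable_laguerre_dom l)
    show "(\<Sum>i<N. cmod (?f i v)) \<le> laguerre_dom l v * C" for N v
    proof -
      have "(\<Sum>i<N. cmod (?f i v)) = (\<Sum>i<N. \<bar>r ^ i * laguerre_fun i l v\<bar>) * \<bar>h v\<bar>"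
        unfolding sum_distrib_right by (intro sum.cong) (simp_all only: norm_mult norm_of_real norm_cis mult_1_right)
      also have "\<dots> \<le> laguerre_dom l v * C"
        by (intro mult_mono laguerre_fun_sum_le_dom r h laguerre_dom_nonneg) simp
      finally show ?thesis .
    qed
  qed measurable
  moreover have "(\<Sum>j. ?f j v) = complex_of_real (laguerre_gauss r l v * h v) * cis (l / 2 * sympl v w)" for v
  proof -
    have "(\<lambda>j. complex_of_real (r ^ j * laguerre_fun j l v)) sums complex_of_real (laguerre_gauss r l v)"
      using laguerre_fun_generating_function[of r l v] r by (intro sums_of_real) simp
    from sums_mult2[OF this, of "complex_of_real (h v) * cis (l / 2 * sympl v w)"] show ?thesis
      by (simp only: sums_iff of_real_mult mult.assoc)
  qed
  moreover have "(\<integral>v. ?f j v \<partial>lborel) =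
      (\<integral>v. complex_of_real (laguerre_fun j l v * h v) * cis (l / 2 * sympl v w) \<partial>lborel) * complex_of_real (r ^ j)" for j
    unfolding integral_mult_left_zero[symmetric] by (intro Bochner_Integration.integral_cong refl) (simp only: of_real_mult mult_ac)
  ultimately show ?thesis by (simp only:)
qed

text \<open>Comparison of the coefficients of r^j in the product formula for two Gaussians, with s
  fixed.\<close>

lemma twisted_laguerre_gauss:
  fixes w :: "complex ^ 'n::finite"
  assumes l: "l \<noteq> 0" and s: "\<bar>s\<bar> < 1 / 4"
  shows "(\<integral>v. complex_of_real (laguerre_fun j l v * laguerre_gauss s l (w - v)) * cis (l / 2 * sympl v w) \<partial>lborel) =
    complex_of_real (laguerre_mass CARD('n) l * laguerre_fun j l w) * complex_of_real (s ^ j)" (is "?a j = ?b j")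
proof (rule power_series_unique[where \<epsilon>="1/4"])
  fix r :: real assume r: "\<bar>r\<bar> < 1 / 4"
  show "(\<lambda>j. ?a j * complex_of_real (r ^ j)) sums
     (\<integral>v. complex_of_real (laguerre_gauss r l v * laguerre_gauss s l (w - v)) * cis (l / 2 * sympl v w) \<partial>lborel)"
    by (intro twisted_series[OF l, where C="(4/3) ^ CARD('n)"] laguerre_gauss_le) (use r s in auto)
  have "(\<integral>v. complex_of_real (laguerre_gauss r l v * laguerre_gauss s l (w - v)) * cis (l / 2 * sympl v w) \<partial>lborel) =
      complex_of_real (laguerre_mass CARD('n) l * laguerre_gauss (r * s) l w)"
    using r s by (intro twisted_gauss l) auto
  moreover have "(\<lambda>j. complex_of_real (laguerre_mass CARD('n) l * ((r * s) ^ j * laguerre_fun j l w))) sums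
      complex_of_real (laguerre_mass CARD('n) l * laguerre_gauss (r * s) l w)"
  proof (intro sums_of_real sums_mult laguerre_fun_generating_function)
    have "\<bar>r * s\<bar> \<le> 1/4 * 1/4" unfolding abs_mult using mult_mono[of "\<bar>r\<bar>" "1/4" "\<bar>s\<bar>" "1/4"] r s by simp
    then show "\<bar>r * s\<bar> < 1" by simp
  qed
  ultimately show "(\<lambda>j. ?b j * complex_of_real (r ^ j)) sums
     (\<integral>v. complex_of_real (laguerre_gauss r l v * laguerre_gauss s l (w - v)) * cis (l / 2 * sympl v w) \<partial>lborel)"
    by (simp add: power_mult_distrib mult_ac)
qed simp

lemma integral_reflect:
  fixes f :: "'a::euclidean_space \<Rightarrow> 'b :: {banach, second_countable_topology}"
  assumes "integrable lborel f"
  shows "(\<integral>v. f (w - v) \<partial>lborel) = (\<integral>v. f v \<partial>lborel)"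
  using integral_lborel_affine[OF assms, of "-1" w] by simp

lemma integrable_laguerre_bounded:
  fixes h :: "complex ^ 'n::finite \<Rightarrow> real" and \<theta> :: "complex ^ 'n::finite \<Rightarrow> real"
  assumes l: "l \<noteq> 0" and [measurable]: "h \<in> borel_measurable borel" "\<theta> \<in> borel_measurable borel" and h: "\<And>v. \<bar>h v\<bar> \<le> C"
  shows "integrable lborel (\<lambda>v. complex_of_real (laguerre_fun k l v * h v) * cis (\<theta> v))"
proof (rule Bochner_Integration.integrable_bound)
  show "integrable lborel (\<lambda>v :: complex^'n. 4 ^ k * laguerre_dom l v * C)"
    by (intro integrable_mult_left integrable_mult_right integrable_laguerre_dom l)
  have "\<bar>laguerre_fun k l v\<bar> \<le> 4 ^ k * laguerre_dom l v" for v :: "complex ^ 'n"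
    using laguerre_fun_le_dom[of "1/4" k l v] by (simp add: abs_mult field_simps)
  then show "AE v in lborel. norm (complex_of_real (laguerre_fun k l v * h v) * cis (\<theta> v)) \<le> norm (4 ^ k * laguerre_dom l v * C)"
    by (intro AE_I2 order_trans[OF _ abs_ge_self[THEN order_trans[OF _ eq_refl[OF real_norm_def[symmetric]]]]])
      (auto simp: norm_mult abs_mult intro!: mult_mono h mult_nonneg_nonneg laguerre_dom_nonneg)
qed measurable

lemma laguerre_fun_bounded: "\<exists>C. \<forall>v :: complex ^ 'n::finite. \<bar>laguerre_fun k l v\<bar> \<le> C"
proof (intro exI allI)
  fix v :: "complex ^ 'n"
  show "\<bar>laguerre_fun k l v\<bar> \<le> 4 ^ k * (4 / 3) ^ CARD('n)"
    using order_trans[OF laguerre_fun_le_dom[of "1/4" k l v] laguerre_dom_le] by (simp add: abs_mult field_simps)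
qed

text \<open>Comparison of the coefficients of s^k in the previous identity. Up to the factor M, the
  Laguerre functions are mutually annihilating idempotents for twisted convolution.\<close>

lemma twisted_laguerre:
  fixes w :: "complex ^ 'n::finite"
  assumes l: "l \<noteq> 0"
  shows "(\<integral>v. complex_of_real (laguerre_fun j l v * laguerre_fun k l (w - v)) * cis (l / 2 * sympl v w) \<partial>lborel) =
    (if j = k then complex_of_real (laguerre_mass CARD('n) l * laguerre_fun k l w) else 0)" (is "?a k = ?b k")
proof (rule power_series_unique[where \<epsilon>="1/4"])
  fix s :: real assume s: "\<bar>s\<bar> < 1 / 4"
  let ?S = "\<integral>v. complex_of_real (laguerre_fun j l v * laguerre_gauss s l (w - v)) * cis (l / 2 * sympl v w) \<partial>lborel"
  obtain C where C: "\<And>v :: complex ^ 'n. \<bar>laguerre_fun j l v\<bar> \<le> C" using laguerre_fun_bounded by blast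
  have sym: "sympl (w - v) w = - sympl v w" for v by (simp add: sympl_diff_left)
  \<comment> \<open>\<open>twisted_series\<close> expands the left factor, but now the right one
    carries s. The reflection v \<mapsto> w - v exchanges the factors and reverses the sign of the
    phase, that is, conjugates the integral.\<close>
  have refl: "(\<integral>v. complex_of_real (laguerre_fun j l v * h (w - v)) * cis (l / 2 * sympl v w) \<partial>lborel) =
      cnj (\<integral>v. complex_of_real (h v * laguerre_fun j l (w - v)) * cis (l / 2 * sympl v w) \<partial>lborel)"
    if hm[measurable]: "h \<in> borel_measurable borel" and h: "\<And>v. \<bar>h v\<bar> \<le> B" for h B
  proof -
    have "integrable lborel (\<lambda>v. complex_of_real (laguerre_fun j l v * h (w - v)) * cis (l / 2 * sympl v w))"
      using h by (intro integrable_laguerre_bounded[OF l, where C=B]) auto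
    from integral_reflect[OF this, of w, symmetric] show ?thesis
      by (simp add: sym mult_ac cis_cnj[symmetric] flip: Bochner_Integration.integral_cnj)
  qed
  have "(\<lambda>k. (\<integral>v. complex_of_real (laguerre_fun k l v * laguerre_fun j l (w - v)) * cis (l / 2 * sympl v w) \<partial>lborel) * complex_of_real (s ^ k))
    sums (\<integral>v. complex_of_real (laguerre_gauss s l v * laguerre_fun j l (w - v)) * cis (l / 2 * sympl v w) \<partial>lborel)"
    by (rule twisted_series[OF l, where C=C]) (use s C in auto)
  then have "(\<lambda>k. cnj (\<integral>v. complex_of_real (laguerre_fun k l v * laguerre_fun j l (w - v)) * cis (l / 2 * sympl v w) \<partial>lborel) * complex_of_real (s ^ k))
    sums cnj (\<integral>v. complex_of_real (laguerre_gauss s l v * laguerre_fun j l (w - v)) * cis (l / 2 * sympl v w) \<partial>lborel)"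
    by (subst (asm) sums_cnj[symmetric]) simp
  moreover have "?a k = cnj (\<integral>v. complex_of_real (laguerre_fun k l v * laguerre_fun j l (w - v)) * cis (l / 2 * sympl v w) \<partial>lborel)" for k
  proof -
    obtain B where "\<And>v :: complex ^ 'n. \<bar>laguerre_fun k l v\<bar> \<le> B" using laguerre_fun_bounded by blast
    then show ?thesis by (intro refl) auto
  qed
  moreover have "?S = cnj (\<integral>v. complex_of_real (laguerre_gauss s l v * laguerre_fun j l (w - v)) * cis (l / 2 * sympl v w) \<partial>lborel)"
    by (rule refl, simp, rule laguerre_gauss_le) (use s in simp)
  ultimately show "(\<lambda>k. ?a k * complex_of_real (s ^ k)) sums ?S" by (simp only:)
  have "(\<lambda>k. if k = j then complex_of_real (laguerre_mass CARD('n) l * laguerre_fun j l w) * complex_of_real (s ^ j) else 0) sums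
     (complex_of_real (laguerre_mass CARD('n) l * laguerre_fun j l w) * complex_of_real (s ^ j))"
    using sums_single[of j "\<lambda>k. complex_of_real (laguerre_mass CARD('n) l * laguerre_fun j l w) * complex_of_real (s ^ j)"] by simp
  moreover have "?S = complex_of_real (laguerre_mass CARD('n) l * laguerre_fun j l w) * complex_of_real (s ^ j)"
    by (rule twisted_laguerre_gauss[OF l s])
  moreover have "(\<lambda>k. ?b k * complex_of_real (s ^ k)) =
      (\<lambda>k. if k = j then complex_of_real (laguerre_mass CARD('n) l * laguerre_fun j l w) * complex_of_real (s ^ j) else 0)"
    by auto
  ultimately show "(\<lambda>k. ?b k * complex_of_real (s ^ k)) sums ?S" by (simp only:)
qed simp

text \<open>The idempotent identity at w = 0, where the twist disappears and evenness turns the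
  product into a square.\<close>

lemma
  assumes l: "l \<noteq> 0"
  shows integrable_laguerre_fun_square: "integrable lborel (\<lambda>v :: complex ^ 'n::finite. (laguerre_fun k l v)\<^sup>2)"
    and integral_laguerre_fun_square:
      "(\<integral>v. (laguerre_fun k l (v :: complex ^ 'n))\<^sup>2 \<partial>lborel) = laguerre_mass CARD('n) l * laguerre_fun k l (0 :: complex ^ 'n)"
proof -
  obtain C where C: "\<And>v :: complex ^ 'n. \<bar>laguerre_fun k l v\<bar> \<le> C" using laguerre_fun_bounded by blast
  have "integrable lborel (\<lambda>v :: complex ^ 'n. complex_of_real (laguerre_fun k l v * laguerre_fun k l v) * cis 0)"
    using C by (intro integrable_laguerre_bounded[OF l, where C=C]) auto
  from integrable_Re[OF this] show "integrable lborel (\<lambda>v :: complex ^ 'n. (laguerre_fun k l v)\<^sup>2)"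
    by (simp add: power2_eq_square)
  have "complex_of_real (\<integral>v. (laguerre_fun k l (v :: complex ^ 'n))\<^sup>2 \<partial>lborel) =
      complex_of_real (laguerre_mass CARD('n) l * laguerre_fun k l (0 :: complex ^ 'n))"
    using twisted_laguerre[OF l, of k k "0 :: complex ^ 'n"]
    by (simp add: laguerre_fun_minus power2_eq_square flip: integral_complex_of_real)
  then show "(\<integral>v. (laguerre_fun k l (v :: complex ^ 'n))\<^sup>2 \<partial>lborel) = laguerre_mass CARD('n) l * laguerre_fun k l (0 :: complex ^ 'n)"
    by (simp only: of_real_eq_iff)
qed

text \<open>By \<phi>_k \<times> \<phi>_k = M \<phi>_k, the quantity M |\<phi>_k(u)| is the modulus
  of a twisted product, which 2ab \<le> a^2 + b^2 bounds by the squared L^2 norm M \<phi>_k(0). No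
  extremal property of the Laguerre polynomials enters.\<close>

lemma abs_laguerre_fun_le:
  assumes l: "l \<noteq> 0"
  shows "\<bar>laguerre_fun k l (u :: complex ^ 'n::finite)\<bar> \<le> laguerre_fun k l (0 :: complex ^ 'n)"
proof -
  let ?\<phi> = "laguerre_fun k l :: complex ^ 'n \<Rightarrow> real"
  obtain C where C: "\<And>v. \<bar>?\<phi> v\<bar> \<le> C" using laguerre_fun_bounded by blast
  have sq: "integrable lborel (\<lambda>v. (?\<phi> v)\<^sup>2)" by (rule integrable_laguerre_fun_square[OF l])
  have sq': "integrable lborel (\<lambda>v. (?\<phi> (u - v))\<^sup>2)"
    using integrable_lborel_affine[OF sq, of "-1" u] by simp
  have "laguerre_mass CARD('n) l * \<bar>?\<phi> u\<bar> = cmod (complex_of_real (laguerre_mass CARD('n) l * ?\<phi> u))"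
    using laguerre_mass_pos[OF l, of "CARD('n)"] by (simp add: norm_mult)
  also have "\<dots> = cmod (\<integral>v. complex_of_real (?\<phi> v * ?\<phi> (u - v)) * cis (l / 2 * sympl v u) \<partial>lborel)"
    using twisted_laguerre[OF l, of k k u] by (simp only: refl if_True)
  also have "\<dots> \<le> (\<integral>v. ((?\<phi> v)\<^sup>2 + (?\<phi> (u - v))\<^sup>2) / 2 \<partial>lborel)"
  proof (rule Bochner_Integration.integral_norm_bound_integral)
    show "integrable lborel (\<lambda>v. complex_of_real (?\<phi> v * ?\<phi> (u - v)) * cis (l / 2 * sympl v u))"
      using C by (intro integrable_laguerre_bounded[OF l, where C=C]) auto
    show "norm (complex_of_real (?\<phi> v * ?\<phi> (u - v)) * cis (l / 2 * sympl v u)) \<le> ((?\<phi> v)\<^sup>2 + (?\<phi> (u - v))\<^sup>2) / 2" for v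
      using cmod_mult_le_squares[of "complex_of_real (?\<phi> v)" "complex_of_real (?\<phi> (u - v))"]
      by (simp add: norm_mult)
  qed (use sq sq' in simp)
  also have "\<dots> = ((\<integral>v. (?\<phi> v)\<^sup>2 \<partial>lborel) + (\<integral>v. (?\<phi> (u - v))\<^sup>2 \<partial>lborel)) / 2"
    using sq sq' by simp
  also have "\<dots> = laguerre_mass CARD('n) l * ?\<phi> 0"
    unfolding integral_reflect[OF sq] integral_laguerre_fun_square[OF l] by simp
  finally show ?thesis using laguerre_mass_pos[OF l, of "CARD('n)"] by simp
qed

text \<open>The sign of the phase is that of the central coordinate of (z,t)^(-1) (w,0), which is -
  t - \<open>sympl z w / 2\<close>.\<close>

definition twisted_conv :: "nat \<Rightarrow> real \<Rightarrow> (complex ^ 'n::finite \<Rightarrow> complex) \<Rightarrow> complex ^ 'n \<Rightarrow> complex" where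
  "twisted_conv k l g w = (\<integral>z. g z * (complex_of_real (laguerre_fun k l (w - z)) * cis (- (l / 2) * sympl z w)) \<partial>lborel)"

definition twisted_form :: "nat \<Rightarrow> real \<Rightarrow> (complex ^ 'n::finite \<Rightarrow> complex) \<Rightarrow> complex" where
  "twisted_form k l g = (\<integral>p. g (fst p) * cnj (g (snd p)) *
    (complex_of_real (laguerre_fun k l (fst p - snd p)) * cis (- (l / 2) * sympl (fst p) (snd p))) \<partial>lborel)"

text \<open>After the translation v = w - z' the integral is \<phi>_k \<times> \<phi>_k at z - z'.
  The phases combine by bilinearity and leave the twist of z and z' as a factor, so up to M the
  kernel reproduces itself like that of a projection.\<close>

lemma twisted_kernel:
  fixes z z' :: "complex ^ 'n::finite"
  assumes l: "l \<noteq> 0"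
  shows "(\<integral>w. (complex_of_real (laguerre_fun k l (w - z)) * cis (- (l / 2) * sympl z w)) *
      cnj (complex_of_real (laguerre_fun k l (w - z')) * cis (- (l / 2) * sympl z' w)) \<partial>lborel) =
    complex_of_real (laguerre_mass CARD('n) l) *
      (complex_of_real (laguerre_fun k l (z - z')) * cis (- (l / 2) * sympl z z'))"
proof -
  let ?\<phi> = "laguerre_fun k l :: complex ^ 'n \<Rightarrow> real"
  let ?u = "z - z'"
  let ?F = "\<lambda>v. complex_of_real (?\<phi> v * ?\<phi> (?u - v)) * cis (l / 2 * sympl v ?u)"
  obtain C where C: "\<And>v. \<bar>?\<phi> v\<bar> \<le> C" using laguerre_fun_bounded by blast
  have i: "integrable lborel ?F"
    using C by (intro integrable_laguerre_bounded[OF l, where C=C]) auto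
  \<comment> \<open>The argument \<open>- z' + 1 *\<^sub>R w\<close> has the shape of the affine
    substitution rule with scale 1.\<close>
  have eq: "(complex_of_real (?\<phi> (w - z)) * cis (- (l / 2) * sympl z w)) *
      cnj (complex_of_real (?\<phi> (w - z')) * cis (- (l / 2) * sympl z' w)) =
      cis (- (l / 2) * sympl z z') * ?F (- z' + 1 *\<^sub>R w)" for w
  proof -
    have "?\<phi> (?u - (- z' + 1 *\<^sub>R w)) = ?\<phi> (w - z)"
      using laguerre_fun_minus[of k l "w - z"] by simp
    moreover have "- z' + 1 *\<^sub>R w = w - z'" by simp
    moreover have S: "sympl (w - z') ?u = sympl z' w - sympl z w + sympl z z'"
      using sympl_swap[of "w - z'" ?u] sympl_add_right[of ?u "w - z'" z']
      by (simp add: sympl_diff_left)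
    moreover have "cis (- (l / 2) * sympl z w) * cis (l / 2 * sympl z' w) = cis (- (l / 2) * sympl z z') * cis (l / 2 * sympl (w - z') ?u)"
      unfolding S cis_mult by (rule arg_cong[where f=cis]) (simp add: field_simps)
    moreover have "cnj (complex_of_real (?\<phi> (w - z')) * cis (- (l / 2) * sympl z' w)) =
      complex_of_real (?\<phi> (w - z')) * cis (l / 2 * sympl z' w)"
      by (simp add: cis_cnj)
    ultimately show ?thesis
      by (simp only: of_real_mult) (simp only: mult_ac)
  qed
  have "(\<integral>w. (complex_of_real (?\<phi> (w - z)) * cis (- (l / 2) * sympl z w)) *
      cnj (complex_of_real (?\<phi> (w - z')) * cis (- (l / 2) * sympl z' w)) \<partial>lborel) =
      cis (- (l / 2) * sympl z z') * (\<integral>w. ?F (- z' + 1 *\<^sub>R w) \<partial>lborel)"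
    unfolding eq by (rule integral_mult_right_zero)
  also have "(\<integral>w. ?F (- z' + 1 *\<^sub>R w) \<partial>lborel) = (\<integral>w. ?F w \<partial>lborel)"
    using integral_lborel_affine[OF i, of 1 "- z'"] by simp
  also have "\<dots> = complex_of_real (laguerre_mass CARD('n) l * ?\<phi> ?u)"
    unfolding twisted_laguerre[OF l] by simp
  finally show ?thesis by (simp only: of_real_mult mult_ac)
qed

context
  fixes l :: real and g :: "complex ^ 'n::finite \<Rightarrow> complex"
  assumes l: "l \<noteq> 0" and g: "integrable lborel g"
begin

text \<open>An instance of the kernel form: the twisted kernel is bounded by \<phi>_k(0), and its
  square norm in w is M \<phi>_k(0) by translation invariance. Its reproducing property puts M
  \<phi>_k into the quadratic form.\<close>

lemma
  shows integrable_twisted_form: "integrable lborel (\<lambda>p. g (fst p) * cnj (g (snd p)) *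
      (complex_of_real (laguerre_fun k l (fst p - snd p)) * cis (- (l / 2) * sympl (fst p) (snd p))))"
    and nn_integral_twisted_conv:
      "sq_norm (twisted_conv k l g) = ennreal (laguerre_mass CARD('n) l * Re (twisted_form k l g))"
    and twisted_form_nonneg: "0 \<le> Re (twisted_form k l g)"
proof -
  let ?\<kappa> = "\<lambda>z w :: complex ^ 'n. complex_of_real (laguerre_fun k l (w - z)) * cis (- (l / 2) * sympl z w)"
  have m: "(\<lambda>(z, w). ?\<kappa> z w) \<in> borel_measurable borel"
    unfolding split_beta' by measurable
  have b: "cmod (?\<kappa> z w) \<le> laguerre_fun k l (0 :: complex ^ 'n)" for z w
    by (simp add: norm_mult abs_laguerre_fun_le[OF l])
  have s: "sq_norm (?\<kappa> z) \<le> ennreal (laguerre_mass CARD('n) l * laguerre_fun k l (0 :: complex ^ 'n))" for z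
  proof -
    have sq: "integrable lborel (\<lambda>v :: complex ^ 'n. (laguerre_fun k l v)\<^sup>2)" by (rule integrable_laguerre_fun_square[OF l])
    have "sq_norm (?\<kappa> z) = (\<integral>\<^sup>+ w. ennreal ((laguerre_fun k l (- z + 1 *\<^sub>R w))\<^sup>2) \<partial>lborel)"
      by (simp add: norm_mult power_mult_distrib)
    also have "\<dots> = (\<integral>\<^sup>+ w. ennreal ((laguerre_fun k l (w :: complex ^ 'n))\<^sup>2) \<partial>lborel)"
      by (subst nn_integral_lborel_affine[of "\<lambda>w. ennreal ((laguerre_fun k l w)\<^sup>2)" 1 "- z"]) auto
    also have "\<dots> = ennreal (laguerre_mass CARD('n) l * laguerre_fun k l (0 :: complex ^ 'n))"
      by (subst nn_integral_eq_integral[OF sq]) (auto simp: integral_laguerre_fun_square[OF l])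
    finally show ?thesis by simp
  qed
  let ?f = "\<lambda>p. g (fst p) * cnj (g (snd p)) *
      (complex_of_real (laguerre_fun k l (fst p - snd p)) * cis (- (l / 2) * sympl (fst p) (snd p)))"
  have M: "laguerre_mass CARD('n) l > 0" by (rule laguerre_mass_pos[OF l])
  have K: "(\<lambda>p. g (fst p) * cnj (g (snd p)) * (\<integral>y. ?\<kappa> (fst p) y * cnj (?\<kappa> (snd p) y) \<partial>lborel)) =
      (\<lambda>p. complex_of_real (laguerre_mass CARD('n) l) * ?f p)"
    unfolding twisted_kernel[OF l] by (intro ext) (simp only: mult_ac)
  have I: "(\<integral>p. complex_of_real (laguerre_mass CARD('n) l) * ?f p \<partial>lborel) =
      complex_of_real (laguerre_mass CARD('n) l) * twisted_form k l g"
    unfolding twisted_form_def by (rule integral_mult_right_zero)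
  note kf = integrable_kernel_form[OF g m b s, unfolded K] nn_integral_kernel_form[OF g m b s, unfolded K I]
    kernel_form_nonneg[OF g m b s, unfolded K I]
  have "integrable lborel (\<lambda>p. complex_of_real (1 / laguerre_mass CARD('n) l) * (complex_of_real (laguerre_mass CARD('n) l) * ?f p))"
    by (rule integrable_mult_right[OF kf(1)])
  then show "integrable lborel ?f"
    using M by (simp only: mult.assoc[symmetric] of_real_mult[symmetric]) simp
  show "sq_norm (twisted_conv k l g) = ennreal (laguerre_mass CARD('n) l * Re (twisted_form k l g))"
    using kf(2) by (simp add: twisted_conv_def)
  show "0 \<le> Re (twisted_form k l g)"
    using kf(3) M by (simp add: zero_le_mult_iff)
qed

text \<open>The endpoint p = 1 on one ray: in the quadratic form the kernel is replaced by its
  maximum.\<close>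

lemma nn_integral_twisted_conv_le:
  "sq_norm (twisted_conv k l g) \<le>
    ennreal (laguerre_mass CARD('n) l * laguerre_fun k l (0 :: complex ^ 'n) * (\<integral>z. cmod (g z) \<partial>lborel)\<^sup>2)"
proof -
  have gi: "integrable lborel (\<lambda>z. complex_of_real (cmod (g z)))" using g by simp
  have "Re (twisted_form k l g) \<le> cmod (twisted_form k l g)" by (rule complex_Re_le_cmod)
  also have "\<dots> \<le> (\<integral>p. laguerre_fun k l (0 :: complex ^ 'n) * Re (complex_of_real (cmod (g (fst p))) * complex_of_real (cmod (g (snd p)))) \<partial>lborel)"
    unfolding twisted_form_def
  proof (rule Bochner_Integration.integral_norm_bound_integral[OF integrable_twisted_form])
    show "integrable lborel (\<lambda>p. laguerre_fun k l (0 :: complex ^ 'n) * Re (complex_of_real (cmod (g (fst p))) * complex_of_real (cmod (g (snd p)))))"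
      by (intro integrable_mult_right integrable_Re integrable_tensor gi)
    show "norm (g (fst p) * cnj (g (snd p)) * (complex_of_real (laguerre_fun k l (fst p - snd p)) * cis (- (l / 2) * sympl (fst p) (snd p)))) \<le>
      laguerre_fun k l (0 :: complex ^ 'n) * Re (complex_of_real (cmod (g (fst p))) * complex_of_real (cmod (g (snd p))))" for p
      using mult_right_mono[OF abs_laguerre_fun_le[OF l, of k "fst p - snd p"], of "cmod (g (fst p)) * cmod (g (snd p))"]
      by (simp add: norm_mult mult_ac)
  qed
  also have "\<dots> = laguerre_fun k l (0 :: complex ^ 'n) * Re ((\<integral>z. complex_of_real (cmod (g z)) \<partial>lborel) * (\<integral>z. complex_of_real (cmod (g z)) \<partial>lborel))"
    unfolding integral_tensor[OF gi gi, symmetric] by (subst integral_mult_right_zero, subst integral_Re[OF integrable_tensor[OF gi gi]]) (rule refl)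
  also have "\<dots> = laguerre_fun k l (0 :: complex ^ 'n) * (\<integral>z. cmod (g z) \<partial>lborel)\<^sup>2"
    by (simp add: power2_eq_square)
  finally show ?thesis
    unfolding nn_integral_twisted_conv using laguerre_mass_pos[OF l, of "CARD('n)"]
    by (intro ennreal_leI) (simp add: mult.assoc)
qed

text \<open>Here r runs through all of [0,1), beyond the range of \<open>laguerre_dom\<close>. The
  majorant comes instead from |\<phi>_k| \<le> \<phi>_k(0), because the generating function at the
  origin is finite for every r < 1.\<close>

lemma twisted_form_abel_sum:
  assumes r: "0 \<le> r" "r < 1"
  shows "(\<lambda>k. r ^ k * Re (twisted_form k l g)) sums
    (Re (gauss_form (\<bar>l\<bar> / 4 * ((1 + r) / (1 - r))) (\<lambda>z w. - (l / 2) * sympl z w) g) / (1 - r) ^ CARD('n))"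
proof -
  let ?f = "\<lambda>k p. complex_of_real (r ^ k) * (g (fst p) * cnj (g (snd p)) *
      (complex_of_real (laguerre_fun k l (fst p - snd p)) * cis (- (l / 2) * sympl (fst p) (snd p))))"
  let ?\<tau> = "\<bar>l\<bar> / 4 * ((1 + r) / (1 - r))"
  have gm[measurable]: "g \<in> borel_measurable borel"
    using g borel_measurable_integrable by auto
  have "(\<lambda>k. \<integral>p. ?f k p \<partial>lborel) sums (\<integral>p. (\<Sum>k. ?f k p) \<partial>lborel)"
  proof (rule integral_sums_dominated)
    show "?f k \<in> borel_measurable lborel" for k
      by (intro borel_measurable_times borel_measurable_const borel_measurable_integrable[OF integrable_twisted_form])
    have gi: "integrable lborel (\<lambda>z. complex_of_real (cmod (g z)))" using g by simp
    show "integrable lborel (\<lambda>p. laguerre_gauss r l (0 :: complex ^ 'n) * Re (complex_of_real (cmod (g (fst p))) * complex_of_real (cmod (g (snd p)))))"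
      by (intro integrable_mult_right integrable_Re integrable_tensor gi)
    show "(\<Sum>k<N. norm (?f k p)) \<le> laguerre_gauss r l (0 :: complex ^ 'n) * Re (complex_of_real (cmod (g (fst p))) * complex_of_real (cmod (g (snd p))))" for N p
    proof -
      have "(\<Sum>k<N. norm (?f k p)) = (\<Sum>k<N. r ^ k * \<bar>laguerre_fun k l (fst p - snd p)\<bar>) * (cmod (g (fst p)) * cmod (g (snd p)))"
        unfolding sum_distrib_right using r by (intro sum.cong) (auto simp: norm_mult norm_power)
      also have "(\<Sum>k<N. r ^ k * \<bar>laguerre_fun k l (fst p - snd p)\<bar>) \<le> (\<Sum>k<N. r ^ k * laguerre_fun k l (0 :: complex ^ 'n))"
        using r by (intro sum_mono mult_left_mono abs_laguerre_fun_le[OF l]) auto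
      also have "\<dots> \<le> (\<Sum>k. r ^ k * laguerre_fun k l (0 :: complex ^ 'n))"
      proof (rule sum_le_suminf)
        show "summable (\<lambda>k. r ^ k * laguerre_fun k l (0 :: complex ^ 'n))"
          using laguerre_fun_generating_function[of r l "0 :: complex ^ 'n"] r by (auto simp: sums_iff)
        show "0 \<le> r ^ k * laguerre_fun k l (0 :: complex ^ 'n)" for k
          using r order_trans[OF abs_ge_zero abs_laguerre_fun_le[OF l, of k "0 :: complex ^ 'n"]] by simp
      qed simp
      also have "\<dots> = laguerre_gauss r l (0 :: complex ^ 'n)"
        using laguerre_fun_generating_function[of r l "0 :: complex ^ 'n"] r by (auto simp: sums_iff)
      finally show ?thesis by (simp add: mult_right_mono)
    qed
  qed
  moreover have "(\<Sum>k. ?f k p) = complex_of_real (1 / (1 - r) ^ CARD('n)) * (g (fst p) * cnj (g (snd p)) *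
      (complex_of_real (exp (- ?\<tau> * (norm (fst p - snd p))\<^sup>2)) * cis (- (l / 2) * sympl (fst p) (snd p))))" for p
  proof -
    let ?c = "g (fst p) * cnj (g (snd p)) * cis (- (l / 2) * sympl (fst p) (snd p))"
    have "(\<lambda>k. complex_of_real (r ^ k * laguerre_fun k l (fst p - snd p)) * ?c) sums
        (complex_of_real (laguerre_gauss r l (fst p - snd p)) * ?c)"
      by (intro sums_mult2 sums_of_real laguerre_fun_generating_function) (use r in simp)
    moreover have "complex_of_real (r ^ k * laguerre_fun k l (fst p - snd p)) * ?c = ?f k p" for k
      by (simp only: of_real_mult mult_ac)
    ultimately have "(\<Sum>k. ?f k p) = complex_of_real (laguerre_gauss r l (fst p - snd p)) * ?c"
      by (simp only: sums_iff)
    moreover have "laguerre_gauss r l (fst p - snd p) = 1 / (1 - r) ^ CARD('n) * exp (- ?\<tau> * (norm (fst p - snd p))\<^sup>2)"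
      unfolding laguerre_gauss_def by simp
    ultimately show ?thesis by (simp only: of_real_mult mult_ac)
  qed
  moreover have "(\<integral>p. ?f k p \<partial>lborel) = complex_of_real (r ^ k) * twisted_form k l g" for k
    unfolding twisted_form_def by (rule integral_mult_right_zero)
  ultimately have "(\<lambda>k. complex_of_real (r ^ k) * twisted_form k l g) sums
     (complex_of_real (1 / (1 - r) ^ CARD('n)) * gauss_form ?\<tau> (\<lambda>z w. - (l / 2) * sympl z w) g)"
    unfolding gauss_form_def by (simp only: integral_mult_right_zero)
  from sums_Re[OF this] show ?thesis by (simp del: of_real_power of_real_divide)
qed

text \<open>With r = 1 - 1/(N + 2) the parameter \<tau> is |l| (2N + 3) / 4, which tends to
  infinity. The generating function carries 1 / (1 - r)^n; splitting off the (\<tau> / \<pi>)^n of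
  the approximate identity leaves (4 \<pi> / (|l| (1 + r)))^n, which tends to M. The other factor M
  stems from the kernel.\<close>

lemma twisted_conv_abel_limit:
  defines "r \<equiv> \<lambda>N::nat. 1 - 1 / (real N + 2)"
  defines "\<tau> \<equiv> \<lambda>N. \<bar>l\<bar> / 4 * ((1 + r N) / (1 - r N))"
  shows "(\<lambda>N. ennreal (laguerre_mass CARD('n) l * (4 * pi / (\<bar>l\<bar> * (1 + r N))) ^ CARD('n) *
      Re (complex_of_real (sqrt (\<tau> N / pi) ^ DIM(complex ^ 'n)) * gauss_form (\<tau> N) (\<lambda>z w. - (l / 2) * sympl z w) g)))
    \<longlonglongrightarrow> (\<Sum>k. sq_norm (twisted_conv k l g))"
    and "\<tau> N > 0" and "filterlim \<tau> at_top sequentially"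
    and "(\<lambda>N. laguerre_mass CARD('n) l * (4 * pi / (\<bar>l\<bar> * (1 + r N))) ^ CARD('n)) \<longlonglongrightarrow> (laguerre_mass CARD('n) l)\<^sup>2"
    and "0 \<le> laguerre_mass CARD('n) l * (4 * pi / (\<bar>l\<bar> * (1 + r N))) ^ CARD('n)"
proof -
  have r01: "0 \<le> r N" "r N < 1" for N by (simp_all add: r_def)
  have "(\<lambda>N. 1 / (real N + 2)) \<longlonglongrightarrow> 0"
    using LIMSEQ_ignore_initial_segment[OF lim_1_over_n[where 'a=real], of 2] by (simp add: add.commute)
  then have "r \<longlonglongrightarrow> 1 - 0" unfolding r_def
    by (intro tendsto_diff tendsto_const)
  then have r1: "r \<longlonglongrightarrow> 1" by simp
  have \<tau>eq: "\<tau> N = \<bar>l\<bar> / 4 * (2 * real N + 3)" for N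
    unfolding \<tau>_def r_def by (simp add: field_simps)
  show \<tau>0: "\<tau> N > 0" for N using l by (simp add: \<tau>eq)
  show "filterlim \<tau> at_top sequentially"
    unfolding \<tau>eq[abs_def]
    by (rule filterlim_tendsto_pos_mult_at_top[OF tendsto_const _ filterlim_at_top_mono[OF filterlim_real_sequentially]])
      (use l in auto)
  have "(\<lambda>N. (4 * pi / (\<bar>l\<bar> * (1 + r N))) ^ CARD('n)) \<longlonglongrightarrow> (4 * pi / (\<bar>l\<bar> * (1 + 1))) ^ CARD('n)"
    using l by (intro tendsto_intros r1) auto
  then have "(\<lambda>N. (4 * pi / (\<bar>l\<bar> * (1 + r N))) ^ CARD('n)) \<longlonglongrightarrow> laguerre_mass CARD('n) l"
    by (simp add: laguerre_mass_def)
  from tendsto_mult[OF tendsto_const this]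
  show "(\<lambda>N. laguerre_mass CARD('n) l * (4 * pi / (\<bar>l\<bar> * (1 + r N))) ^ CARD('n)) \<longlonglongrightarrow> (laguerre_mass CARD('n) l)\<^sup>2"
    unfolding power2_eq_square .
  let ?M = "laguerre_mass CARD('n) l"
  have M: "?M > 0" by (rule laguerre_mass_pos[OF l])
  show "0 \<le> ?M * (4 * pi / (\<bar>l\<bar> * (1 + r N))) ^ CARD('n)" for N
    using M r01[of N] by simp
  \<comment> \<open>The terms are nonnegative, so the Abel means increase to the sum even when it is
    infinite.\<close>
  have lim: "(\<lambda>N. \<integral>\<^sup>+ k. ennreal (?M * Re (twisted_form k l g) * r N ^ k) \<partial>count_space UNIV) \<longlonglongrightarrow>
      (\<integral>\<^sup>+ k. ennreal (?M * Re (twisted_form k l g)) \<partial>count_space UNIV)"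
  proof (rule nn_integral_approach)
    show "0 \<le> ?M * Re (twisted_form k l g)" for k
      using M twisted_form_nonneg by simp
    show "r N ^ k \<le> r (Suc N) ^ k" for N k
      using r01 by (intro power_mono) (auto simp: r_def field_simps)
    show "(\<lambda>N. r N ^ k) \<longlonglongrightarrow> 1" for k
      using tendsto_power[OF r1, of k] by simp
  qed auto
  have val: "(\<integral>\<^sup>+ k. ennreal (?M * Re (twisted_form k l g) * r N ^ k) \<partial>count_space UNIV) =
      ennreal (?M * (4 * pi / (\<bar>l\<bar> * (1 + r N))) ^ CARD('n) *
      Re (complex_of_real (sqrt (\<tau> N / pi) ^ DIM(complex ^ 'n)) * gauss_form (\<tau> N) (\<lambda>z w. - (l / 2) * sympl z w) g))" for N
  proof -
    let ?G = "gauss_form (\<tau> N) (\<lambda>z w. - (l / 2) * sympl z w) g"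
    have "(\<integral>\<^sup>+ k. ennreal (?M * Re (twisted_form k l g) * r N ^ k) \<partial>count_space UNIV) =
        (\<Sum>k. ennreal (?M * (r N ^ k * Re (twisted_form k l g))))"
      by (simp add: nn_integral_count_space_nat mult_ac)
    also have "\<dots> = ennreal (?M * (Re ?G / (1 - r N) ^ CARD('n)))"
      unfolding \<tau>_def
      by (intro suminf_ennreal_eq sums_mult twisted_form_abel_sum r01)
        (use M twisted_form_nonneg r01 in auto)
    also have "Re ?G / (1 - r N) ^ CARD('n) = (4 * pi / (\<bar>l\<bar> * (1 + r N))) ^ CARD('n) *
       Re (complex_of_real (sqrt (\<tau> N / pi) ^ DIM(complex ^ 'n)) * ?G)"
    proof -
      have "sqrt (\<tau> N / pi) ^ DIM(complex ^ 'n) = (\<tau> N / pi) ^ CARD('n)"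
        using \<tau>0[of N] by (simp add: power_mult mult.commute[of "CARD('n)"])
      moreover have "4 * pi / (\<bar>l\<bar> * (1 + r N)) * (\<tau> N / pi) = 1 / (1 - r N)"
        unfolding \<tau>_def using l r01[of N] by (simp add: divide_simps)
      then have "(4 * pi / (\<bar>l\<bar> * (1 + r N))) ^ CARD('n) * (\<tau> N / pi) ^ CARD('n) = 1 / (1 - r N) ^ CARD('n)"
        by (simp only: power_mult_distrib[symmetric]) (simp add: power_divide)
      moreover have "Re (complex_of_real a * z) = a * Re z" for a z by simp
      ultimately have "(4 * pi / (\<bar>l\<bar> * (1 + r N))) ^ CARD('n) *
          Re (complex_of_real (sqrt (\<tau> N / pi) ^ DIM(complex ^ 'n)) * ?G) = 1 / (1 - r N) ^ CARD('n) * Re ?G"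
        by (simp only: mult.assoc[symmetric])
      then show ?thesis by simp
    qed
    finally show ?thesis by (simp only: mult.assoc)
  qed
  show "(\<lambda>N. ennreal (?M * (4 * pi / (\<bar>l\<bar> * (1 + r N))) ^ CARD('n) *
      Re (complex_of_real (sqrt (\<tau> N / pi) ^ DIM(complex ^ 'n)) * gauss_form (\<tau> N) (\<lambda>z w. - (l / 2) * sympl z w) g)))
    \<longlonglongrightarrow> (\<Sum>k. sq_norm (twisted_conv k l g))"
    using lim unfolding val nn_integral_twisted_conv nn_integral_count_space_nat .
qed

lemma twisted_bessel:
  "(\<Sum>k. sq_norm (twisted_conv k l g)) \<le>
    ennreal ((laguerre_mass CARD('n) l)\<^sup>2) * sq_norm g"
proof (rule gauss_form_limit_le[OF twisted_conv_abel_limit(2) _ _ _ twisted_conv_abel_limit(1)])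
  show "g \<in> borel_measurable borel" using g borel_measurable_integrable by auto
qed (use laguerre_mass_pos[OF l, of "CARD('n)"] twisted_conv_abel_limit(4,5) in simp_all)

lemma twisted_plancherel:
  assumes cont: "continuous_on UNIV g" and bdd: "\<And>z. cmod (g z) \<le> C"
  shows "(\<Sum>k. sq_norm (twisted_conv k l g)) =
    ennreal ((laguerre_mass CARD('n) l)\<^sup>2) * sq_norm g"
proof (rule gauss_form_limit_eq[OF twisted_conv_abel_limit(2) _ _ _ twisted_conv_abel_limit(1) g cont bdd _ _ twisted_conv_abel_limit(3)])
  show "continuous_on UNIV (\<lambda>p. - (l / 2) * sympl (fst p) (snd p :: complex ^ 'n))"
    by (intro continuous_intros)
qed (use laguerre_mass_pos[OF l, of "CARD('n)"] twisted_conv_abel_limit(4,5) in simp_all)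

end

section \<open>The Fourier transform in the central variable\<close>

definition fourier :: "(real \<Rightarrow> complex) \<Rightarrow> real \<Rightarrow> complex" where
  "fourier h l = (\<integral>t. h t * cis (- l * t) \<partial>lborel)"

context
  fixes h :: "real \<Rightarrow> complex"
  assumes h: "integrable lborel h"
begin

lemma measurable_fourier: "fourier h \<in> borel_measurable borel"
proof -
  have [measurable]: "h \<in> borel_measurable borel" using h borel_measurable_integrable by auto
  show ?thesis unfolding fourier_def[abs_def] by measurable
qed

text \<open>The damping is split evenly between the two copies of the kernel, exp (- \<epsilon> l^2
  / 2) each, which makes the kernel square integrable in l. The integral over l is then a Gaussian
  in t - t' with \<tau> = 1 / (4 \<epsilon>).\<close>

lemma nn_integral_fourier_gauss:
  assumes \<epsilon>: "\<epsilon> > 0"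
  shows "(\<integral>\<^sup>+ l. ennreal ((cmod (fourier h l))\<^sup>2 * exp (- \<epsilon> * l\<^sup>2)) \<partial>lborel) =
    ennreal (sqrt (pi / \<epsilon>) * Re (gauss_form (1 / (4 * \<epsilon>)) (\<lambda>_ _. 0) h))"
proof -
  let ?\<kappa> = "\<lambda>t l :: real. complex_of_real (exp (- (\<epsilon> / 2) * l\<^sup>2)) * cis (- l * t)"
  have m: "(\<lambda>(t, l). ?\<kappa> t l) \<in> borel_measurable borel"
  proof -
    have "continuous_on UNIV (\<lambda>p :: real \<times> real. ?\<kappa> (fst p) (snd p))"
      unfolding cis_conv_exp by (intro continuous_intros)
    then show ?thesis unfolding split_beta' by (rule borel_measurable_continuous_onI)
  qed
  have b: "cmod (?\<kappa> t l) \<le> 1" for t l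
    using \<epsilon> by (simp add: norm_mult)
  have n2: "(cmod (?\<kappa> t l))\<^sup>2 = exp (- \<epsilon> * l\<^sup>2)" for t l
    by (simp add: norm_mult power2_eq_square flip: exp_add)
  have s: "sq_norm (?\<kappa> t) \<le> ennreal (sqrt (pi / \<epsilon>) ^ DIM(real))" for t
    unfolding n2 using nn_integral_gauss_translate[OF \<epsilon>, of "0::real"] by simp
  have K: "(\<integral>l. ?\<kappa> t l * cnj (?\<kappa> t' l) \<partial>lborel) =
      complex_of_real (sqrt (pi / \<epsilon>)) * (complex_of_real (exp (- (1 / (4 * \<epsilon>)) * (norm (t - t'))\<^sup>2)) * cis 0)" for t t'
  proof -
    have "?\<kappa> t l * cnj (?\<kappa> t' l) = complex_of_real (exp (- \<epsilon> * l\<^sup>2 + 0 * l)) * cis (- (t - t') * l)" for l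
    proof -
      have "exp (- (\<epsilon> / 2) * l\<^sup>2) * exp (- (\<epsilon> / 2) * l\<^sup>2) = exp (- \<epsilon> * l\<^sup>2 + 0 * l)"
        by (simp flip: exp_add)
      moreover have "cis (- l * t) * cis (l * t') = cis (- (t - t') * l)"
        by (simp add: cis_mult algebra_simps)
      moreover have "cnj (?\<kappa> t' l) = complex_of_real (exp (- (\<epsilon> / 2) * l\<^sup>2)) * cis (l * t')"
        by (simp add: cis_cnj)
      moreover have "complex_of_real a * x * (complex_of_real a * y) = complex_of_real (a * a) * (x * y)" for a x y
        by simp
      ultimately show ?thesis by (simp only:)
    qed
    then have "(\<integral>l. ?\<kappa> t l * cnj (?\<kappa> t' l) \<partial>lborel) =
        complex_of_real (sqrt (pi / \<epsilon>) * exp ((0\<^sup>2 - (- (t - t'))\<^sup>2) / (4 * \<epsilon>))) * cis (0 * - (t - t') / (2 * \<epsilon>))"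
      by (simp only: integral_gauss_real[OF \<epsilon>])
    then show ?thesis by (simp add: power2_commute)
  qed
  have "(\<integral>t. h t * ?\<kappa> t l \<partial>lborel) = complex_of_real (exp (- (\<epsilon> / 2) * l\<^sup>2)) * fourier h l" for l
    unfolding fourier_def integral_mult_right_zero[symmetric] by (intro Bochner_Integration.integral_cong refl) (simp only: mult_ac)
  then have "(cmod (\<integral>t. h t * ?\<kappa> t l \<partial>lborel))\<^sup>2 = (cmod (fourier h l))\<^sup>2 * exp (- \<epsilon> * l\<^sup>2)" for l
    by (simp add: norm_mult power_mult_distrib power2_eq_square[of "exp _"] flip: exp_add)
  moreover have "(\<lambda>p. h (fst p) * cnj (h (snd p)) * (\<integral>l. ?\<kappa> (fst p) l * cnj (?\<kappa> (snd p) l) \<partial>lborel)) =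
     (\<lambda>p. complex_of_real (sqrt (pi / \<epsilon>)) * (h (fst p) * cnj (h (snd p)) *
       (complex_of_real (exp (- (1 / (4 * \<epsilon>)) * (norm (fst p - snd p))\<^sup>2)) * cis 0)))"
    unfolding K by (intro ext) (simp only: mult_ac)
  moreover have "Re (complex_of_real a * z) = a * Re z" for a z by simp
  ultimately show ?thesis
    using nn_integral_kernel_form[OF h m b s] unfolding gauss_form_def by (simp only: integral_mult_right_zero)
qed

text \<open>Here \<epsilon> = 1 / (N + 1), so \<tau> = (N + 1) / 4, and sqrt (\<pi> / \<epsilon>) =
  2 \<pi> sqrt (\<tau> / \<pi>) isolates the constant of Plancherel's formula.\<close>

lemma fourier_abel_limit:
  "(\<lambda>N. ennreal (2 * pi * Re (complex_of_real (sqrt ((real N + 1) / 4 / pi) ^ DIM(real)) * gauss_form ((real N + 1) / 4) (\<lambda>_ _. 0) h)))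
    \<longlonglongrightarrow> sq_norm (fourier h)"
proof -
  have "(\<lambda>N. \<integral>\<^sup>+ l. ennreal ((cmod (fourier h l))\<^sup>2 * exp (- (1 / (real N + 1)) * l\<^sup>2)) \<partial>lborel)
    \<longlonglongrightarrow> sq_norm (fourier h)"
  proof (rule nn_integral_approach)
    have "1 / (real (Suc N) + 1) \<le> 1 / (real N + 1)" for N by (simp add: field_simps)
    then show "exp (- (1 / (real N + 1)) * l\<^sup>2) \<le> exp (- (1 / (real (Suc N) + 1)) * l\<^sup>2)" for N l
      by (subst exp_le_cancel_iff) (intro mult_right_mono, simp_all)
    have "(\<lambda>N. exp (- (1 / (real N + 1)) * l\<^sup>2)) \<longlonglongrightarrow> exp (- 0 * l\<^sup>2)" for l
      using LIMSEQ_ignore_initial_segment[OF lim_1_over_n[where 'a=real], of 1]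
      by (intro tendsto_intros) (simp add: add.commute)
    then show "(\<lambda>N. exp (- (1 / (real N + 1)) * l\<^sup>2)) \<longlonglongrightarrow> 1" for l by simp
  qed (use measurable_fourier in measurable)
  moreover have "sqrt (pi / (1 / (real N + 1))) * Re (gauss_form (1 / (4 * (1 / (real N + 1)))) (\<lambda>_ _. 0) h) =
     2 * pi * Re (complex_of_real (sqrt ((real N + 1) / 4 / pi) ^ DIM(real)) * gauss_form ((real N + 1) / 4) (\<lambda>_ _. 0) h)" for N
  proof -
    have "sqrt (pi / (1 / (real N + 1))) = 2 * pi * sqrt ((real N + 1) / 4 / pi)"
      by (rule real_sqrt_unique) (simp_all add: power_mult_distrib power2_eq_square field_simps)
    then show ?thesis by simp
  qed
  moreover have "(\<integral>\<^sup>+ l. ennreal ((cmod (fourier h l))\<^sup>2 * exp (- (1 / (real N + 1)) * l\<^sup>2)) \<partial>lborel) =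
      ennreal (sqrt (pi / (1 / (real N + 1))) * Re (gauss_form (1 / (4 * (1 / (real N + 1)))) (\<lambda>_ _. 0) h))" for N
    by (rule nn_integral_fourier_gauss) simp
  ultimately show ?thesis by (simp only:)
qed

lemma fourier_bessel:
  "sq_norm (fourier h) \<le> ennreal (2 * pi) * sq_norm h"
proof (rule gauss_form_limit_le[OF _ _ _ _ fourier_abel_limit])
  show "h \<in> borel_measurable borel" using h borel_measurable_integrable by auto
qed auto

lemma fourier_plancherel:
  assumes "continuous_on UNIV h" "\<And>t. cmod (h t) \<le> C"
  shows "sq_norm (fourier h) = ennreal (2 * pi) * sq_norm h"
proof (rule gauss_form_limit_eq[OF _ _ _ _ fourier_abel_limit h assms])
  show "filterlim (\<lambda>N. (real N + 1) / 4) at_top sequentially"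
  proof (rule filterlim_at_top_mono)
    show "filterlim (\<lambda>N. 1 / 4 * real N) at_top sequentially"
      by (rule filterlim_tendsto_pos_mult_at_top[OF tendsto_const _ filterlim_real_sequentially]) simp
  qed auto
qed auto

end

section \<open>Functions bounded by the decay weight and their partial Fourier transforms\<close>

lemma decay_weight_Pair: "decay_weight (x, y) = decay_weight x * decay_weight y"
  unfolding decay_weight_def Basis_prod_def
  by (subst prod.union_disjoint) (auto simp: prod.reindex inj_on_def)

text \<open>This class contains the Schwartz functions and is stable under truncation, under sums,
  under f \<mapsto> f |f|^(p-2) for p > 2 and under the Fourier transform in the central
  variable.\<close>

definition dominated :: "('a::euclidean_space \<Rightarrow> complex) \<Rightarrow> bool" where
  "dominated f \<longleftrightarrow> f \<in> borel_measurable borel \<and> (\<exists>C. \<forall>x. cmod (f x) \<le> C * decay_weight x)"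

lemma dominatedE:
  assumes "dominated f"
  obtains C where "0 \<le> C" "\<And>x. cmod (f x) \<le> C * decay_weight x" "\<And>x. cmod (f x) \<le> C"
proof -
  from assms obtain C where C: "\<And>x. cmod (f x) \<le> C * decay_weight x" by (auto simp: dominated_def)
  have "0 \<le> C * decay_weight (undefined::'a)" using order_trans[OF norm_ge_zero C] .
  then have "0 \<le> C" using decay_weight_pos[of "undefined::'a"] by (simp add: zero_le_mult_iff)
  moreover have "cmod (f x) \<le> C" for x
    using C[of x] mult_left_mono[OF decay_weight_le_1[of x] \<open>0 \<le> C\<close>] by simp
  ultimately show ?thesis using that C by blast
qed

lemma dominated_measurable: "dominated f \<Longrightarrow> f \<in> borel_measurable borel"
  by (simp add: dominated_def)

lemma dominated_integrable:
  assumes "dominated f" shows "integrable lborel f"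
proof -
  obtain C where C: "0 \<le> C" "\<And>x. cmod (f x) \<le> C * decay_weight x" "\<And>x. cmod (f x) \<le> C"
    by (rule dominatedE[OF assms]) (rule that)
  show ?thesis
  proof (rule Bochner_Integration.integrable_bound)
    show "integrable lborel (\<lambda>x::'a. C * decay_weight x)" by (intro integrable_mult_right integrable_decay_weight)
    show "AE x in lborel. norm (f x) \<le> norm (C * decay_weight x)"
      using C(2) by (auto intro!: AE_I2 intro: order_trans[OF _ abs_ge_self])
  qed (use dominated_measurable[OF assms] in simp)
qed

lemma dominated_mono:
  assumes "dominated f" "g \<in> borel_measurable borel" "\<And>x. cmod (g x) \<le> K * cmod (f x)"
  shows "dominated g"
proof -
  obtain C where C: "0 \<le> C" "\<And>x. cmod (f x) \<le> C * decay_weight x" "\<And>x. cmod (f x) \<le> C"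
    by (rule dominatedE[OF assms(1)]) (rule that)
  have "cmod (g x) \<le> (\<bar>K\<bar> * C) * decay_weight x" for x
  proof -
    have "cmod (g x) \<le> \<bar>K\<bar> * cmod (f x)"
      using assms(3)[of x] mult_right_mono[OF abs_ge_self[of K], of "cmod (f x)"] by simp
    also have "\<dots> \<le> \<bar>K\<bar> * (C * decay_weight x)" by (intro mult_left_mono C(2)) simp
    finally show ?thesis by (simp add: mult.assoc)
  qed
  then show ?thesis using assms(2) by (auto simp: dominated_def)
qed

lemma dominated_add:
  assumes "dominated f" "dominated g" shows "dominated (\<lambda>x. f x + g x)"
proof -
  obtain C where C: "0 \<le> C" "\<And>x. cmod (f x) \<le> C * decay_weight x" "\<And>x. cmod (f x) \<le> C"
    by (rule dominatedE[OF assms(1)]) (rule that)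
  obtain D where D: "0 \<le> D" "\<And>x. cmod (g x) \<le> D * decay_weight x" "\<And>x. cmod (g x) \<le> D"
    by (rule dominatedE[OF assms(2)]) (rule that)
  have "cmod (f x + g x) \<le> (C + D) * decay_weight x" for x
    using norm_triangle_ineq[of "f x" "g x"] C(2)[of x] D(2)[of x] by (simp add: distrib_right)
  then show ?thesis using assms by (auto simp: dominated_def)
qed

lemma dominated_section:
  assumes "dominated f" shows "dominated (\<lambda>t. f (z, t))"
proof -
  obtain C where C: "0 \<le> C" "\<And>x. cmod (f x) \<le> C * decay_weight x" "\<And>x. cmod (f x) \<le> C"
    by (rule dominatedE[OF assms]) (rule that)
  have [measurable]: "f \<in> borel_measurable borel" by (rule dominated_measurable[OF assms])
  have "cmod (f (z, t)) \<le> C * decay_weight z * decay_weight t" for t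
    using C(2)[of "(z, t)"] by (simp add: decay_weight_Pair mult.assoc)
  moreover have "(\<lambda>t. f (z, t)) \<in> borel_measurable borel" by measurable
  ultimately show ?thesis by (auto simp: dominated_def)
qed

definition partial_fourier :: "real \<Rightarrow> ('a \<times> real \<Rightarrow> complex) \<Rightarrow> 'a \<Rightarrow> complex" where
  "partial_fourier l f z = fourier (\<lambda>t. f (z, t)) l"

lemma measurable_partial_fourier:
  fixes f :: "'a::euclidean_space \<times> real \<Rightarrow> complex"
  assumes [measurable]: "f \<in> borel_measurable borel" "u \<in> borel_measurable M" "v \<in> borel_measurable M"
  shows "(\<lambda>x. partial_fourier (u x) f (v x)) \<in> borel_measurable M"
  unfolding partial_fourier_def fourier_def by measurable

context
  fixes f :: "'a::euclidean_space \<times> real \<Rightarrow> complex"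
  assumes f: "dominated f"
begin

lemma cmod_partial_fourier_le: "cmod (partial_fourier l f z) \<le> (\<integral>t. cmod (f (z, t)) \<partial>lborel)"
proof -
  have "cmod (partial_fourier l f z) \<le> (\<integral>t. cmod (f (z, t) * cis (- l * t)) \<partial>lborel)"
    unfolding partial_fourier_def fourier_def by (rule integral_norm_bound)
  then show ?thesis by (simp add: norm_mult)
qed

lemma dominated_partial_fourier: "dominated (partial_fourier l f)"
proof -
  obtain C where C: "0 \<le> C" "\<And>x. cmod (f x) \<le> C * decay_weight x" "\<And>x. cmod (f x) \<le> C"
    by (rule dominatedE[OF f]) (rule that)
  have "cmod (partial_fourier l f z) \<le> (C * (\<integral>t. decay_weight (t::real) \<partial>lborel)) * decay_weight z" for z
  proof -
    have "(\<integral>t. cmod (f (z, t)) \<partial>lborel) \<le> (\<integral>t. C * decay_weight z * decay_weight (t::real) \<partial>lborel)"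
    proof (rule Bochner_Integration.integral_mono)
      show "integrable lborel (\<lambda>t. cmod (f (z, t)))"
        by (intro integrable_norm dominated_integrable dominated_section f)
      show "integrable lborel (\<lambda>t::real. C * decay_weight z * decay_weight t)"
        by (intro integrable_mult_right integrable_decay_weight)
      show "cmod (f (z, t)) \<le> C * decay_weight z * decay_weight t" for t
        using C(2)[of "(z, t)"] by (simp add: decay_weight_Pair mult.assoc)
    qed
    with cmod_partial_fourier_le[of l z] show ?thesis by (simp add: mult_ac)
  qed
  moreover have "partial_fourier l f \<in> borel_measurable borel"
    using measurable_partial_fourier[OF dominated_measurable[OF f], of "\<lambda>_. l" borel "\<lambda>x. x"] by simp
  ultimately show ?thesis by (auto simp: dominated_def)
qed

lemma integral_partial_fourier_le:
  "(\<integral>z. cmod (partial_fourier l f z) \<partial>lborel) \<le> (\<integral>x. cmod (f x) \<partial>lborel)"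
proof -
  have i: "integrable (lborel \<Otimes>\<^sub>M lborel) (\<lambda>x. cmod (f x))"
    using integrable_norm[OF dominated_integrable[OF f]] by (simp add: lborel_prod)
  have "(\<integral>z. cmod (partial_fourier l f z) \<partial>lborel) \<le> (\<integral>z. \<integral>t. cmod (f (z, t)) \<partial>lborel \<partial>lborel)"
    by (intro Bochner_Integration.integral_mono integrable_norm dominated_integrable dominated_partial_fourier
        lborel_pair.integrable_fst' i cmod_partial_fourier_le)
  also have "\<dots> = (\<integral>x. cmod (f x) \<partial>lborel)"
    using lborel_pair.integral_fst'[OF i] by (simp add: lborel_prod)
  finally show ?thesis .
qed

lemma continuous_partial_fourier:
  assumes cont: "continuous_on UNIV f"
  shows "continuous_on UNIV (partial_fourier l f)"
  unfolding continuous_on_sequentially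
proof (intro allI ballI impI, elim conjE)
  fix x :: "nat \<Rightarrow> 'a" and a assume x: "x \<longlonglongrightarrow> a"
  obtain C where C: "0 \<le> C" "\<And>x. cmod (f x) \<le> C * decay_weight x" "\<And>x. cmod (f x) \<le> C"
    by (rule dominatedE[OF f]) (rule that)
  have [measurable]: "f \<in> borel_measurable borel" by (rule dominated_measurable[OF f])
  have "(\<lambda>N. \<integral>t. f (x N, t) * cis (- l * t) \<partial>lborel) \<longlonglongrightarrow> (\<integral>t. f (a, t) * cis (- l * t) \<partial>lborel)"
  proof (rule integral_dominated_convergence)
    show "integrable lborel (\<lambda>t::real. C * decay_weight t)"
      by (intro integrable_mult_right integrable_decay_weight)
    show "AE t in lborel. (\<lambda>N. f (x N, t) * cis (- l * t)) \<longlonglongrightarrow> f (a, t) * cis (- l * t)"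
    proof (rule AE_I2)
      fix t
      have "isCont f (a, t)" using cont by (simp add: continuous_on_eq_continuous_at)
      from isCont_tendsto_compose[OF this tendsto_Pair[OF x tendsto_const]]
      show "(\<lambda>N. f (x N, t) * cis (- l * t)) \<longlonglongrightarrow> f (a, t) * cis (- l * t)"
        by (intro tendsto_intros)
    qed
    show "AE t in lborel. norm (f (x N, t) * cis (- l * t)) \<le> C * decay_weight t" for N
    proof (rule AE_I2)
      fix t
      have "cmod (f (x N, t)) \<le> (C * decay_weight t) * decay_weight (x N)"
        using C(2)[of "(x N, t)"] by (simp add: decay_weight_Pair mult_ac)
      also have "\<dots> \<le> C * decay_weight t"
        using C(1) decay_weight_le_1[of "x N"] decay_weight_pos[of t] by (intro mult_left_le) (auto simp: less_imp_le)
      finally show "norm (f (x N, t) * cis (- l * t)) \<le> C * decay_weight t" by (simp add: norm_mult)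
    qed
  qed measurable
  then show "(partial_fourier l f \<circ> x) \<longlonglongrightarrow> partial_fourier l f a"
    by (simp add: partial_fourier_def fourier_def o_def)
qed

lemma nn_integral_partial_fourier:
  "(\<integral>\<^sup>+ l. sq_norm (partial_fourier l f) \<partial>lborel) =
    (\<integral>\<^sup>+ z. sq_norm (fourier (\<lambda>t. f (z, t))) \<partial>lborel)"
proof -
  have "(\<lambda>p. ennreal ((cmod (partial_fourier (snd p) f (fst p)))\<^sup>2)) \<in> borel_measurable (lborel \<Otimes>\<^sub>M lborel)"
    using measurable_partial_fourier[OF dominated_measurable[OF f], of snd "lborel \<Otimes>\<^sub>M lborel" fst] by measurable
  from lborel_pair.Fubini[OF this] show ?thesis by (simp add: partial_fourier_def)
qed

lemma nn_integral_sections: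
  "(\<integral>\<^sup>+ z. sq_norm (\<lambda>t. f (z, t)) \<partial>lborel) = sq_norm f"
proof -
  have "(\<lambda>x. ennreal ((cmod (f x))\<^sup>2)) \<in> borel_measurable (lborel \<Otimes>\<^sub>M lborel)"
    using dominated_measurable[OF f] by (simp add: lborel_prod)
  from lborel.nn_integral_fst[OF this] show ?thesis by (simp add: lborel_prod)
qed

lemma partial_fourier_bessel:
  "(\<integral>\<^sup>+ l. sq_norm (partial_fourier l f) \<partial>lborel) \<le>
    ennreal (2 * pi) * sq_norm f"
proof -
  have [measurable]: "f \<in> borel_measurable borel" by (rule dominated_measurable[OF f])
  have "(\<integral>\<^sup>+ l. sq_norm (partial_fourier l f) \<partial>lborel) \<le>
     (\<integral>\<^sup>+ z. ennreal (2 * pi) * (sq_norm (\<lambda>t. f (z, t))) \<partial>lborel)"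
    unfolding nn_integral_partial_fourier
    by (intro nn_integral_mono fourier_bessel dominated_integrable dominated_section f)
  also have "\<dots> = ennreal (2 * pi) * sq_norm f"
    unfolding nn_integral_sections[symmetric] by (rule nn_integral_cmult) measurable
  finally show ?thesis .
qed

lemma partial_fourier_plancherel:
  assumes cont: "continuous_on UNIV f"
  shows "(\<integral>\<^sup>+ l. sq_norm (partial_fourier l f) \<partial>lborel) =
    ennreal (2 * pi) * sq_norm f"
proof -
  have [measurable]: "f \<in> borel_measurable borel" by (rule dominated_measurable[OF f])
  obtain C where C: "0 \<le> C" "\<And>x. cmod (f x) \<le> C * decay_weight x" "\<And>x. cmod (f x) \<le> C"
    by (rule dominatedE[OF f]) (rule that)
  have "(\<integral>\<^sup>+ l. sq_norm (partial_fourier l f) \<partial>lborel) =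
     (\<integral>\<^sup>+ z. ennreal (2 * pi) * (sq_norm (\<lambda>t. f (z, t))) \<partial>lborel)"
    unfolding nn_integral_partial_fourier
    by (intro nn_integral_cong fourier_plancherel[where C=C] dominated_integrable dominated_section f C(3)
        continuous_on_compose2[OF cont] continuous_intros) auto
  also have "\<dots> = ennreal (2 * pi) * sq_norm f"
    unfolding nn_integral_sections[symmetric] by (rule nn_integral_cmult) measurable
  finally show ?thesis .
qed

end

section \<open>The Plancherel formula on the fan\<close>

lemma measurable_laguerre_fun' [measurable (raw)]:
  fixes v :: "'a \<Rightarrow> complex ^ 'n::finite"
  assumes [measurable]: "u \<in> borel_measurable M" "v \<in> borel_measurable M"
  shows "(\<lambda>x. laguerre_fun k (u x) (v x)) \<in> borel_measurable M"
proof -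
  have "continuous_on UNIV (poly p)" for p :: "real poly" by (intro continuous_intros)
  then have [measurable]: "poly p \<in> borel_measurable borel" for p :: "real poly"
    by (rule borel_measurable_continuous_onI)
  show ?thesis unfolding laguerre_fun_def by measurable
qed

lemma fan_ray_sets: "fan_ray n k \<in> sets (restrict_space borel (fan n))"
proof -
  have "fan_ray n k = fan n \<inter> {a. fst a \<noteq> 0 \<and> snd a = (2 * real k + real n) * \<bar>fst a\<bar>}"
    by (auto simp: fan_ray_def fan_def)
  moreover have "{a :: real \<times> real. fst a \<noteq> 0 \<and> snd a = (2 * real k + real n) * \<bar>fst a\<bar>} \<in> sets borel"
    by measurable
  ultimately show ?thesis by (auto simp: sets_restrict_space)
qed

text \<open>The index is constant on each of countably many Borel pieces: piece 0 is the limiting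
  ray, piece \<open>Suc k\<close> the ray \<open>R_k\<close>.\<close>

lemma measurable_fan_index:
  fixes \<Phi> :: "nat \<Rightarrow> real \<times> real \<Rightarrow> 'c::topological_space"
  assumes \<Phi>: "\<And>k. \<Phi> k \<in> borel_measurable borel"
  shows "(\<lambda>a. \<Phi> (fan_index n a) a) \<in> borel_measurable (restrict_space borel (fan n))"
proof (rule measurable_piecewise_restrict2[where A="\<lambda>j. case j of 0 \<Rightarrow> {(0, \<tau>) | \<tau>. \<tau> \<ge> 0} | Suc k \<Rightarrow> fan_ray n k"])
  have "{(0, \<tau>) | \<tau>. \<tau> \<ge> (0::real)} = fan n \<inter> {a :: real \<times> real. fst a = 0 \<and> snd a \<ge> 0}"
    by (auto simp: fan_def)
  moreover have "{a :: real \<times> real. fst a = 0 \<and> snd a \<ge> 0} \<in> sets borel" by measurable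
  ultimately have "{(0, \<tau>) | \<tau>. \<tau> \<ge> (0::real)} \<in> sets (restrict_space borel (fan n))"
    by (auto simp: sets_restrict_space)
  then show "(case j of 0 \<Rightarrow> {(0, \<tau>) | \<tau>. \<tau> \<ge> 0} | Suc k \<Rightarrow> fan_ray n k) \<in> sets (restrict_space borel (fan n))" for j
    using fan_ray_sets by (cases j) auto
  show "space (restrict_space borel (fan n)) = (\<Union>j. case j of 0 \<Rightarrow> {(0, \<tau>) | \<tau>. \<tau> \<ge> 0} | Suc k \<Rightarrow> fan_ray n k)"
  proof -
    have "(\<Union>j. case j of 0 \<Rightarrow> A | Suc k \<Rightarrow> B k) = A \<union> (\<Union>k. B k)" for A and B :: "nat \<Rightarrow> (real \<times> real) set"
      by (subst UNIV_nat_eq) (simp add: image_image)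
    then show ?thesis by (simp add: space_restrict_space fan_def Un_commute)
  qed
  show "\<exists>h \<in> borel_measurable (restrict_space borel (fan n)). \<forall>a \<in> (case j of 0 \<Rightarrow> {(0, \<tau>) | \<tau>. \<tau> \<ge> 0} | Suc k \<Rightarrow> fan_ray n k). \<Phi> (fan_index n a) a = h a" for j
  proof (cases j)
    case 0
    \<comment> \<open>No \<open>R_k\<close> meets the limiting ray, so the index there is
      unspecified but the same at all points.\<close>
    have "fan_index n (0, \<tau>) = (THE k. False)" for \<tau>
      unfolding fan_index_def by (rule arg_cong[where f=The]) (auto simp: fan_ray_def)
    then show ?thesis using 0 measurable_restrict_space1[OF \<Phi>]
      by (intro bexI[of _ "\<Phi> (THE k. False)"]) auto
  next
    case (Suc k)
    then show ?thesis using measurable_restrict_space1[OF \<Phi>] fan_index_eq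
      by (intro bexI[of _ "\<Phi> k"]) auto
  qed
qed

text \<open>For a frozen index k the integrand is jointly measurable in all variables, also where a
  is not on \<open>R_k\<close>; the true index is inserted afterwards.\<close>

lemma measurable_strichartz_norm:
  fixes f :: "'n::finite heisenberg \<Rightarrow> complex"
  assumes [measurable]: "f \<in> borel_measurable borel"
  shows "(\<lambda>a. sq_norm (strichartz f a)) \<in> borel_measurable (restrict_space borel (fan CARD('n)))"
proof -
  define \<Phi> where "\<Phi> k a = (\<integral>\<^sup>+ w. ennreal ((cmod (of_real (fan_coeff CARD('n) k) *
     (\<integral>x. f x * (exp (\<i> * of_real (fst a * (- snd x - sympl (fst x) w / 2))) *
        of_real (laguerre_fun k (fst a) (w - fst x))) \<partial>lborel)))\<^sup>2) \<partial>(lborel :: (complex ^ 'n) measure))"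
    for k and a :: "real \<times> real"
  have "\<Phi> k \<in> borel_measurable borel" for k
    unfolding \<Phi>_def[abs_def] by measurable
  then have "(\<lambda>a. \<Phi> (fan_index CARD('n) a) a) \<in> borel_measurable (restrict_space borel (fan CARD('n)))"
    by (rule measurable_fan_index)
  moreover have "snd (heis_mult (heis_inv x) (w, 0)) = - snd x - sympl (fst x) w / 2"
    "fst (heis_mult (heis_inv x) (w, 0)) = w - fst x" for x :: "'n heisenberg" and w
    by (simp_all add: heis_mult_def heis_inv_def sympl_def sum_negf)
  ultimately show ?thesis
    by (simp add: \<Phi>_def strichartz_def fan_char_def)
qed

text \<open>The character factors into the Fourier kernel in t, the twist and the Laguerre function.
  Integrating first in t is justified by |\<phi>_k| \<le> \<phi>_k(0) and the integrability of
  f.\<close>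

lemma strichartz_fan_point:
  fixes f :: "'n::finite heisenberg \<Rightarrow> complex"
  assumes f: "dominated f" and l: "l \<noteq> 0"
  shows "strichartz f (fan_point CARD('n) (l, k)) w =
    of_real (fan_coeff CARD('n) k) * twisted_conv k l (partial_fourier l f) w"
proof -
  have [measurable]: "f \<in> borel_measurable borel" by (rule dominated_measurable[OF f])
  let ?H = "\<lambda>z t. f (z, t) * cis (- l * t) * (of_real (laguerre_fun k l (w - z)) * cis (- (l / 2) * sympl z w))"
  have idx: "fan_index CARD('n) (fan_point CARD('n) (l, k)) = k" "fst (fan_point CARD('n) (l, k)) = l"
    using l by (auto simp: fan_point_def fan_ray_def intro!: fan_index_eq)
  have eq: "f x * fan_char (fan_point CARD('n) (l, k)) (heis_mult (heis_inv x) (w, 0)) = ?H (fst x) (snd x)" for x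
  proof -
    have "snd (heis_mult (heis_inv x) (w, 0)) = - snd x - sympl (fst x) w / 2"
      "fst (heis_mult (heis_inv x) (w, 0)) = w - fst x"
      by (simp_all add: heis_mult_def heis_inv_def sympl_def sum_negf)
    moreover have "exp (\<i> * of_real (l * (- snd x - sympl (fst x) w / 2))) = cis (- l * snd x) * cis (- (l / 2) * sympl (fst x) w)"
      unfolding cis_mult by (simp add: cis_conv_exp algebra_simps)
    ultimately show ?thesis unfolding fan_char_def idx by (simp add: mult_ac)
  qed
  have i: "integrable (lborel \<Otimes>\<^sub>M lborel) (\<lambda>x. ?H (fst x) (snd x))"
  proof -
    have "integrable lborel (\<lambda>x. ?H (fst x) (snd x))"
    proof (rule Bochner_Integration.integrable_bound)
      show "integrable lborel (\<lambda>x. laguerre_fun k l (0 :: complex ^ 'n) * cmod (f x))"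
        by (intro integrable_mult_right integrable_norm dominated_integrable f)
      show "AE x in lborel. norm (?H (fst x) (snd x)) \<le> norm (laguerre_fun k l (0 :: complex ^ 'n) * cmod (f x))"
      proof (rule AE_I2)
        fix x
        have "norm (?H (fst x) (snd x)) = \<bar>laguerre_fun k l (w - fst x)\<bar> * cmod (f x)"
          by (simp add: norm_mult)
        also have "\<dots> \<le> laguerre_fun k l (0 :: complex ^ 'n) * cmod (f x)"
          by (intro mult_right_mono abs_laguerre_fun_le l) simp
        finally show "norm (?H (fst x) (snd x)) \<le> norm (laguerre_fun k l (0 :: complex ^ 'n) * cmod (f x))"
          using abs_ge_self order_trans by (simp only: real_norm_def)
      qed
    qed measurable
    then show ?thesis by (simp add: lborel_prod)
  qed
  have "(\<integral>x. ?H (fst x) (snd x) \<partial>lborel) = (\<integral>z. \<integral>t. ?H z t \<partial>lborel \<partial>lborel)"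
    using lborel_pair.integral_fst'[OF i] by (simp add: lborel_prod)
  also have "\<dots> = twisted_conv k l (partial_fourier l f) w"
    unfolding twisted_conv_def partial_fourier_def fourier_def by (simp only: integral_mult_left_zero)
  finally show ?thesis unfolding strichartz_def idx eq by simp
qed

text \<open>The reciprocal is the binomial coefficient \<open>(k + (n - 1)) choose k\<close>, a
  positive integer.\<close>

lemma fan_coeff_bounds: "0 < fan_coeff CARD('n::finite) k" "fan_coeff CARD('n) k \<le> 1"
proof -
  show p: "0 < fan_coeff CARD('n) k" by (simp add: fan_coeff_def)
  have "1 / fan_coeff CARD('n) k = real ((k + (CARD('n) - 1)) choose k)"
    using laguerre_fun_0[of k 1, where 'n='n] by (simp add: laguerre_fun_def poly_laguerre_0)
  moreover have "(k + (CARD('n) - 1)) choose k \<ge> 1"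
    using zero_less_binomial[OF le_add1[of k "CARD('n) - 1"]] by linarith
  ultimately have "1 \<le> 1 / fan_coeff CARD('n) k" by (simp only: real_of_nat_ge_one_iff)
  then show "fan_coeff CARD('n) k \<le> 1" using p by (simp add: field_simps)
qed

text \<open>The factor |\<lambda>|^n is included so that the integrand of \<open>fan_norm\<close>
  becomes a pure power, the energy to the exponent q / 2.\<close>

definition fan_energy :: "('n::finite heisenberg \<Rightarrow> complex) \<Rightarrow> real \<times> nat \<Rightarrow> ennreal" where
  "fan_energy f x = ennreal (\<bar>fst x\<bar> ^ CARD('n)) *
     (sq_norm (strichartz f (fan_point CARD('n) x)))"

text \<open>The measure \<mu> in the coordinates (\<lambda>, k): the density |\<lambda>|^(2n) of
  \<nu>_2 times |\<lambda>|^(-n).\<close>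

definition fan_base :: "nat \<Rightarrow> (real \<times> nat) measure" where
  "fan_base n = density (lborel \<Otimes>\<^sub>M count_space UNIV)
     (\<lambda>x. ennreal ((2 * pi) powi (- 2 * int n - 1) * fan_coeff n (snd x) powi (- 2) * \<bar>fst x\<bar> ^ n))"

lemma sets_fan_base [measurable_cong]: "sets (fan_base n) = sets (lborel \<Otimes>\<^sub>M count_space UNIV)"
  by (simp add: fan_base_def)

lemma measurable_fan_energy [measurable]:
  assumes [measurable]: "f \<in> borel_measurable borel"
  shows "fan_energy f \<in> borel_measurable (lborel \<Otimes>\<^sub>M count_space UNIV)"
proof -
  have [measurable]: "(\<lambda>x. sq_norm (strichartz f (fan_point CARD('a) x)))
      \<in> borel_measurable (lborel \<Otimes>\<^sub>M count_space UNIV)"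
    by (rule measurable_compose[OF measurable_fan_point measurable_strichartz_norm]) fact
  show ?thesis unfolding fan_energy_def[abs_def] by measurable
qed

lemma fan_energy_eq:
  fixes f :: "'n::finite heisenberg \<Rightarrow> complex"
  assumes f: "dominated f" and l: "l \<noteq> 0"
  shows "fan_energy f (l, k) = ennreal (\<bar>l\<bar> ^ CARD('n) * (fan_coeff CARD('n) k)\<^sup>2) *
    (sq_norm (twisted_conv k l (partial_fourier l f)))"
proof -
  have m: "twisted_conv k l (partial_fourier l f) \<in> borel_measurable borel"
  proof -
    have [measurable]: "partial_fourier l f \<in> borel_measurable borel"
      by (rule dominated_measurable[OF dominated_partial_fourier[OF f]])
    show ?thesis unfolding twisted_conv_def[abs_def] by measurable
  qed
  have "(sq_norm (strichartz f (fan_point CARD('n) (l, k)))) =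
     (\<integral>\<^sup>+ w. ennreal ((fan_coeff CARD('n) k)\<^sup>2) * ennreal ((cmod (twisted_conv k l (partial_fourier l f) w))\<^sup>2) \<partial>lborel)"
    unfolding strichartz_fan_point[OF f l]
    by (intro nn_integral_cong) (simp add: norm_mult power_mult_distrib ennreal_mult)
  also have "\<dots> = ennreal ((fan_coeff CARD('n) k)\<^sup>2) * (sq_norm (twisted_conv k l (partial_fourier l f)))"
    using m by (intro nn_integral_cmult) measurable
  finally show ?thesis by (simp add: fan_energy_def ennreal_mult mult.assoc)
qed

lemma laguerre_mass_power: "l \<noteq> 0 \<Longrightarrow> laguerre_mass n l * \<bar>l\<bar> ^ n = (2 * pi) ^ n"
  by (simp add: laguerre_mass_def power_divide)

lemma fan_energy_le:
  fixes f :: "'n::finite heisenberg \<Rightarrow> complex"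
  assumes f: "dominated f"
  shows "fan_energy f x \<le> ennreal ((2 * pi) ^ CARD('n) * (\<integral>x. cmod (f x) \<partial>lborel)\<^sup>2)"
proof (cases "fst x = 0")
  case True
  then show ?thesis by (simp add: fan_energy_def power_0_left)
next
  case False
  obtain l k where x: "x = (l, k)" by (cases x)
  have l: "l \<noteq> 0" using False x by simp
  let ?c = "fan_coeff CARD('n) k" and ?M = "laguerre_mass CARD('n) l" and ?g = "partial_fourier l f"
  note c = fan_coeff_bounds[of k, where 'n='n]
  have "fan_energy f x \<le> ennreal (\<bar>l\<bar> ^ CARD('n) * ?c\<^sup>2) * ennreal (?M * laguerre_fun k l (0 :: complex ^ 'n) * (\<integral>z. cmod (?g z) \<partial>lborel)\<^sup>2)"
    unfolding x fan_energy_eq[OF f l]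
    by (intro mult_left_mono nn_integral_twisted_conv_le[OF l] dominated_integrable dominated_partial_fourier f) simp
  also have "\<dots> = ennreal (\<bar>l\<bar> ^ CARD('n) * ?c\<^sup>2 * (?M * laguerre_fun k l (0 :: complex ^ 'n) * (\<integral>z. cmod (?g z) \<partial>lborel)\<^sup>2))"
    by (rule ennreal_mult'[symmetric]) simp
  \<comment> \<open>The power of |\<lambda>| cancels that in M, and one factor c cancels
    \<phi>_k(0).\<close>
  also have "\<bar>l\<bar> ^ CARD('n) * ?c\<^sup>2 * (?M * laguerre_fun k l (0 :: complex ^ 'n) * (\<integral>z. cmod (?g z) \<partial>lborel)\<^sup>2) =
      (2 * pi) ^ CARD('n) * (?c * (\<integral>z. cmod (?g z) \<partial>lborel)\<^sup>2)"
    unfolding laguerre_fun_0 laguerre_mass_power[OF l, of "CARD('n)", symmetric] using c by (simp add: power2_eq_square)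
  also have "ennreal \<dots> \<le> ennreal ((2 * pi) ^ CARD('n) * (1 * (\<integral>x. cmod (f x) \<partial>lborel)\<^sup>2))"
    by (intro ennreal_leI mult_left_mono mult_mono power_mono integral_partial_fourier_le f c) auto
  finally show ?thesis by simp
qed

lemma nn_integral_fan_base:
  assumes [measurable]: "\<phi> \<in> borel_measurable (lborel \<Otimes>\<^sub>M count_space UNIV)"
  shows "(\<integral>\<^sup>+ x. \<phi> x \<partial>fan_base n) = (\<integral>\<^sup>+ l. (\<Sum>k. ennreal ((2 * pi) powi (- 2 * int n - 1) * fan_coeff n k powi (- 2) * \<bar>l\<bar> ^ n) * \<phi> (l, k)) \<partial>lborel)"
  unfolding fan_base_def
  by (subst nn_integral_density, measurable)
    (subst sigma_finite_measure.nn_integral_fst[symmetric, OF sigma_finite_measure_count_space],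
      simp_all add: nn_integral_count_space_nat)

text \<open>The factor c^(-2) of the measure and the c^2 of the transform cancel term by term, so
  what remains is the unweighted sum over k of Bessel's inequality. The point l = 0 is a null
  set.\<close>

lemma nn_integral_fan_energy:
  fixes f :: "'n::finite heisenberg \<Rightarrow> complex"
  assumes f: "dominated f"
  shows "(\<integral>\<^sup>+ x. fan_energy f x \<partial>fan_base CARD('n)) =
    (\<integral>\<^sup>+ l. ennreal ((2 * pi) powi (- 2 * int CARD('n) - 1) * \<bar>l\<bar> ^ (2 * CARD('n))) *
      (\<Sum>k. sq_norm (twisted_conv k l (partial_fourier l f))) \<partial>lborel)"
proof -
  have [measurable]: "f \<in> borel_measurable borel" by (rule dominated_measurable[OF f])
  let ?K = "(2 * pi) powi (- 2 * int CARD('n) - 1)"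
  let ?S = "\<lambda>l k. sq_norm (twisted_conv k l (partial_fourier l f))"
  have "(\<integral>\<^sup>+ x. fan_energy f x \<partial>fan_base CARD('n)) =
    (\<integral>\<^sup>+ l. (\<Sum>k. ennreal (?K * fan_coeff CARD('n) k powi (- 2) * \<bar>l\<bar> ^ CARD('n)) * fan_energy f (l, k)) \<partial>lborel)"
    by (rule nn_integral_fan_base) measurable
  also have "\<dots> = (\<integral>\<^sup>+ l. ennreal (?K * \<bar>l\<bar> ^ (2 * CARD('n))) * (\<Sum>k. ?S l k) \<partial>lborel)"
  proof (rule nn_integral_cong_AE)
    show "AE l in lborel. (\<Sum>k. ennreal (?K * fan_coeff CARD('n) k powi (- 2) * \<bar>l\<bar> ^ CARD('n)) * fan_energy f (l, k)) =
      ennreal (?K * \<bar>l\<bar> ^ (2 * CARD('n))) * (\<Sum>k. ?S l k)"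
    proof (rule AE_mp[OF AE_lborel_singleton[of 0]], rule AE_I2, rule impI)
      fix l :: real assume l: "l \<noteq> 0"
      have "ennreal (?K * fan_coeff CARD('n) k powi (- 2) * \<bar>l\<bar> ^ CARD('n)) * fan_energy f (l, k) =
          ennreal (?K * \<bar>l\<bar> ^ (2 * CARD('n))) * ?S l k" for k
      proof -
        note c = fan_coeff_bounds[of k, where 'n='n]
        have e: "?K * fan_coeff CARD('n) k powi (- 2) * \<bar>l\<bar> ^ CARD('n) * (\<bar>l\<bar> ^ CARD('n) * (fan_coeff CARD('n) k)\<^sup>2) = ?K * \<bar>l\<bar> ^ (2 * CARD('n))"
          using c(1) by (simp add: power_int_minus power2_eq_square field_simps) (simp add: power_mult power2_eq_square)
        have nn: "0 \<le> \<bar>l\<bar> ^ CARD('n) * (fan_coeff CARD('n) k)\<^sup>2" by simp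
        have "ennreal (?K * fan_coeff CARD('n) k powi (- 2) * \<bar>l\<bar> ^ CARD('n)) * (ennreal (\<bar>l\<bar> ^ CARD('n) * (fan_coeff CARD('n) k)\<^sup>2) * X) =
            ennreal (?K * fan_coeff CARD('n) k powi (- 2) * \<bar>l\<bar> ^ CARD('n) * (\<bar>l\<bar> ^ CARD('n) * (fan_coeff CARD('n) k)\<^sup>2)) * X" for X
          unfolding ennreal_mult''[OF nn] by (rule mult.assoc[symmetric])
        then show ?thesis
          unfolding fan_energy_eq[OF f l] e .
      qed
      then show "(\<Sum>k. ennreal (?K * fan_coeff CARD('n) k powi (- 2) * \<bar>l\<bar> ^ CARD('n)) * fan_energy f (l, k)) =
        ennreal (?K * \<bar>l\<bar> ^ (2 * CARD('n))) * (\<Sum>k. ?S l k)"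
        by (simp add: ennreal_suminf_cmult)
    qed
  qed
  finally show ?thesis .
qed

text \<open>Since |l|^(2n) M^2 = (2 \<pi>)^(2n), one factor 1 / (2 \<pi>) is left over, and the
  central variable uses it up.\<close>

lemma fan_constant:
  assumes "l \<noteq> 0"
  shows "ennreal ((2 * pi) powi (- 2 * int n - 1) * \<bar>l\<bar> ^ (2 * n)) * (ennreal ((laguerre_mass n l)\<^sup>2) * X) = ennreal (1 / (2 * pi)) * X"
proof -
  have "x powi (- 2 * int n - 1) = 1 / (x * (x ^ n)\<^sup>2)" for x :: real
  proof -
    have e: "- 2 * int n - 1 = - int (Suc (2 * n))" by simp
    show ?thesis
      unfolding e power_int_minus power_int_of_nat by (simp add: power_even_eq divide_inverse)
  qed
  moreover have "\<bar>l\<bar> ^ (2 * n) * (laguerre_mass n l)\<^sup>2 = ((2 * pi) ^ n)\<^sup>2"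
    unfolding laguerre_mass_power[OF assms, symmetric] by (simp add: power_mult_distrib power_mult[symmetric] mult.commute)
  ultimately have "(2 * pi) powi (- 2 * int n - 1) * \<bar>l\<bar> ^ (2 * n) * (laguerre_mass n l)\<^sup>2 = 1 / (2 * pi)"
    by (simp only: mult.assoc) simp
  then show ?thesis
    by (simp only: mult.assoc[symmetric] ennreal_mult''[OF zero_le_power2, symmetric])
qed

lemma inverse_two_pi: "ennreal (1 / (2 * pi)) * (ennreal (2 * pi) * X) = X"
  by (simp add: mult.assoc[symmetric] ennreal_mult[symmetric])

context
  fixes f :: "'n::finite heisenberg \<Rightarrow> complex"
  assumes f: "dominated f"
begin

lemma measurable_norm_partial_fourier:
  "(\<lambda>l. sq_norm (partial_fourier l f)) \<in> borel_measurable lborel"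
proof -
  note [measurable (raw)] = measurable_partial_fourier[OF dominated_measurable[OF f]]
  show ?thesis by measurable
qed

lemma fan_bessel:
  "(\<integral>\<^sup>+ x. fan_energy f x \<partial>fan_base CARD('n)) \<le> sq_norm f"
proof -
  have "(\<integral>\<^sup>+ x. fan_energy f x \<partial>fan_base CARD('n)) \<le>
     (\<integral>\<^sup>+ l. ennreal (1 / (2 * pi)) * (sq_norm (partial_fourier l f)) \<partial>lborel)"
    unfolding nn_integral_fan_energy[OF f]
  proof (rule nn_integral_mono_AE, rule AE_mp[OF AE_lborel_singleton[of 0]], rule AE_I2, rule impI)
    fix l :: real assume l: "l \<noteq> 0"
    show "ennreal ((2 * pi) powi (- 2 * int CARD('n) - 1) * \<bar>l\<bar> ^ (2 * CARD('n))) *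
      (\<Sum>k. sq_norm (twisted_conv k l (partial_fourier l f))) \<le>
      ennreal (1 / (2 * pi)) * sq_norm (partial_fourier l f)"
      unfolding fan_constant[OF l, of "CARD('n)", symmetric]
      by (intro mult_left_mono twisted_bessel[OF l] dominated_integrable dominated_partial_fourier f) simp
  qed
  also have "\<dots> = ennreal (1 / (2 * pi)) * (\<integral>\<^sup>+ l. sq_norm (partial_fourier l f) \<partial>lborel)"
    by (rule nn_integral_cmult[OF measurable_norm_partial_fourier])
  also have "\<dots> \<le> ennreal (1 / (2 * pi)) * (ennreal (2 * pi) * (sq_norm f))"
    by (intro mult_left_mono partial_fourier_bessel f) simp
  finally show ?thesis unfolding inverse_two_pi .
qed

lemma fan_plancherel:
  assumes cont: "continuous_on UNIV f"
  shows "(\<integral>\<^sup>+ x. fan_energy f x \<partial>fan_base CARD('n)) = sq_norm f"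
proof -
  have "(\<integral>\<^sup>+ x. fan_energy f x \<partial>fan_base CARD('n)) =
     (\<integral>\<^sup>+ l. ennreal (1 / (2 * pi)) * (sq_norm (partial_fourier l f)) \<partial>lborel)"
    unfolding nn_integral_fan_energy[OF f]
  proof (rule nn_integral_cong_AE, rule AE_mp[OF AE_lborel_singleton[of 0]], rule AE_I2, rule impI)
    fix l :: real assume l: "l \<noteq> 0"
    obtain C where C: "0 \<le> C" "\<And>z. cmod (partial_fourier l f z) \<le> C * decay_weight z" "\<And>z. cmod (partial_fourier l f z) \<le> C"
      by (rule dominatedE[OF dominated_partial_fourier[OF f]]) (rule that)
    show "ennreal ((2 * pi) powi (- 2 * int CARD('n) - 1) * \<bar>l\<bar> ^ (2 * CARD('n))) *
      (\<Sum>k. sq_norm (twisted_conv k l (partial_fourier l f))) =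
      ennreal (1 / (2 * pi)) * sq_norm (partial_fourier l f)"
      unfolding twisted_plancherel[OF l dominated_integrable[OF dominated_partial_fourier[OF f]] continuous_partial_fourier[OF f cont] C(3)]
      by (rule fan_constant[OF l])
  qed
  also have "\<dots> = ennreal (1 / (2 * pi)) * (\<integral>\<^sup>+ l. sq_norm (partial_fourier l f) \<partial>lborel)"
    by (rule nn_integral_cmult[OF measurable_norm_partial_fourier])
  also have "\<dots> = sq_norm f"
    unfolding partial_fourier_plancherel[OF f cont] by (rule inverse_two_pi)
  finally show ?thesis .
qed

end

section \<open>Interpolation\<close>

lemma nn_integral_powr_Icc:
  assumes t: "0 \<le> t" and a: "0 < a"
  shows "(\<integral>\<^sup>+ s. ennreal (s powr (a - 1)) * indicator {0..t} s \<partial>lborel) = ennreal (t powr a / a)"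
proof -
  have "((\<lambda>s. s powr (a - 1)) has_integral (t powr a / a)) {0..t}"
    using has_integral_powr_from_0[of "a - 1" t] a t by simp
  then have "(\<integral>\<^sup>+ s. ennreal (indicator {0..t} s * s powr (a - 1)) \<partial>lborel) = ennreal (t powr a / a)"
    by (intro nn_integral_has_integral_lebesgue) auto
  moreover have "ennreal (indicator {0..t} s * s powr (a - 1)) = ennreal (s powr (a - 1)) * indicator {0..t} s" for s
    by (auto simp: indicator_def)
  ultimately show ?thesis by simp
qed

lemma dominated_powr_integrable:
  assumes f: "dominated f" and r: "1 \<le> r"
  shows "integrable lborel (\<lambda>x. cmod (f x) powr r)"
proof -
  obtain C where C: "0 \<le> C" "\<And>x. cmod (f x) \<le> C * decay_weight x" "\<And>x. cmod (f x) \<le> C"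
    by (rule dominatedE[OF f]) (rule that)
  have [measurable]: "f \<in> borel_measurable borel" by (rule dominated_measurable[OF f])
  have "cmod (f x) powr r \<le> C powr (r - 1) * cmod (f x)" for x
  proof -
    have "cmod (f x) powr r = cmod (f x) powr (r - 1) * cmod (f x)"
      using powr_add[of "cmod (f x)" "r - 1" 1] by simp
    also have "\<dots> \<le> C powr (r - 1) * cmod (f x)"
      by (intro mult_right_mono powr_mono2) (use C r in auto)
    finally show ?thesis .
  qed
  then have ae: "AE x in lborel. norm (cmod (f x) powr r) \<le> norm (C powr (r - 1) * cmod (f x))"
    by (auto intro!: AE_I2 intro: order_trans[OF _ abs_ge_self])
  have i: "integrable lborel (\<lambda>x. C powr (r - 1) * cmod (f x))"
    by (intro integrable_mult_right integrable_norm dominated_integrable f)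
  show ?thesis
    by (rule Bochner_Integration.integrable_bound[OF i _ ae]) measurable
qed

context
  fixes M :: "'b measure" and T :: "('a::euclidean_space \<Rightarrow> complex) \<Rightarrow> 'b \<Rightarrow> real" and B :: real
  assumes M: "sigma_finite_measure M" and B: "0 < B"
    and T_nonneg: "\<And>f x. 0 \<le> T f x"
    and T_measurable: "\<And>f. dominated f \<Longrightarrow> T f \<in> borel_measurable M"
    and T_add: "\<And>f g x. dominated f \<Longrightarrow> dominated g \<Longrightarrow> T (\<lambda>y. f y + g y) x \<le> 2 * T f x + 2 * T g x"
    and T_sup: "\<And>f x. dominated f \<Longrightarrow> T f x \<le> B * (\<integral>y. cmod (f y) \<partial>lborel)\<^sup>2"
    and T_int: "\<And>f. dominated f \<Longrightarrow> (\<integral>\<^sup>+ x. ennreal (T f x) \<partial>M) \<le> sq_norm f"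
begin

text \<open>The function is cut at the height \<open>h\<close> for which the upper part cannot reach the level \<open>s / 4\<close>.\<close>

lemma level_set_bound:
  fixes f :: "'a \<Rightarrow> complex" and p s :: real
  defines "I \<equiv> \<integral>y. cmod (f y) powr p \<partial>lborel"
  assumes f: "dominated f" and p: "1 < p" and s: "0 < s" and I: "0 < I"
  shows "(\<integral>\<^sup>+ x. indicator {0..T f x} s \<partial>M) \<le> ennreal (4 / s) *
    (\<integral>\<^sup>+ y. ennreal ((cmod (f y))\<^sup>2) * indicator {0..4 * B * I\<^sup>2 * cmod (f y) powr (- 2 * (p - 1))} s \<partial>lborel)"
proof -
  have [measurable]: "f \<in> borel_measurable borel" by (rule dominated_measurable[OF f])
  \<comment> \<open>The value of h^(-2(p-1)) for which B (h^(1-p) I)^2 = s / 4; the bracket bounds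
    the L^1 norm of the upper part \<open>f0\<close>.\<close>
  define R where "R = s / (4 * B * I\<^sup>2)"
  define h where "h = R powr (- 1 / (2 * (p - 1)))"
  have R: "R > 0" using s B I by (simp add: R_def)
  have h: "h > 0" using R by (simp add: h_def)
  have hp: "h powr (- 2 * (p - 1)) = R"
  proof -
    have "- 1 / (2 * c) * (- 2 * c) = 1" if "c \<noteq> 0" for c :: real using that by simp
    from this[of "p - 1"] have e: "- 1 / (2 * (p - 1)) * (- 2 * (p - 1)) = 1" using p by simp
    show ?thesis unfolding h_def powr_powr e using R by simp
  qed
  define f0 where "f0 y = (if h < cmod (f y) then f y else 0)" for y
  define f1 where "f1 y = (if h < cmod (f y) then 0 else f y)" for y
  have "f0 \<in> borel_measurable borel" unfolding f0_def[abs_def] by measurable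
  then have f0: "dominated f0"
    by (rule dominated_mono[OF f, where K=1]) (simp add: f0_def)
  have "f1 \<in> borel_measurable borel" unfolding f1_def[abs_def] by measurable
  then have f1: "dominated f1"
    by (rule dominated_mono[OF f, where K=1]) (simp add: f1_def)
  have sum: "(\<lambda>y. f0 y + f1 y) = f" by (auto simp: f0_def f1_def)
  have "(\<integral>y. cmod (f0 y) \<partial>lborel) \<le> (\<integral>y. h powr (1 - p) * cmod (f y) powr p \<partial>lborel)"
  proof (rule Bochner_Integration.integral_mono)
    show "integrable lborel (\<lambda>y. cmod (f0 y))" by (intro integrable_norm dominated_integrable f0)
    show "integrable lborel (\<lambda>y. h powr (1 - p) * cmod (f y) powr p)"
      by (intro integrable_mult_right dominated_powr_integrable f) (use p in simp)
    show "cmod (f0 y) \<le> h powr (1 - p) * cmod (f y) powr p" for y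
    proof (cases "h < cmod (f y)")
      case True
      have "cmod (f y) = cmod (f y) powr (1 - p) * cmod (f y) powr p"
        using True h by (simp flip: powr_add)
      also have "\<dots> \<le> h powr (1 - p) * cmod (f y) powr p"
        using True h p by (intro mult_right_mono powr_mono2') auto
      finally show ?thesis using True by (simp add: f0_def)
    qed (simp add: f0_def)
  qed
  then have "(\<integral>y. cmod (f0 y) \<partial>lborel) \<le> h powr (1 - p) * I" by (simp add: I_def)
  then have "(\<integral>y. cmod (f0 y) \<partial>lborel)\<^sup>2 \<le> (h powr (1 - p) * I)\<^sup>2"
    by (intro power_mono Bochner_Integration.integral_nonneg) auto
  also have "(h powr (1 - p) * I)\<^sup>2 = R * I\<^sup>2"
  proof -
    have "(h powr (1 - p))\<^sup>2 = h powr (- 2 * (p - 1))"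
      by (simp add: power2_eq_square flip: powr_add)
    then show ?thesis unfolding hp by (simp add: power_mult_distrib)
  qed
  finally have "B * (\<integral>y. cmod (f0 y) \<partial>lborel)\<^sup>2 \<le> B * (R * I\<^sup>2)"
    using B by (intro mult_left_mono) auto
  also have "\<dots> = s / 4" using B I by (simp add: R_def)
  finally have T0: "T f0 x \<le> s / 4" for x using T_sup[OF f0, of x] by simp
  \<comment> \<open>Chebyshev's inequality: where T f reaches s, the upper part accounts for at most
    s / 2, so 2 T f1 is at least s / 2.\<close>
  have "(\<integral>\<^sup>+ x. indicator {0..T f x} s \<partial>M) \<le> (\<integral>\<^sup>+ x. ennreal (4 / s) * ennreal (T f1 x) \<partial>M)"
  proof (rule nn_integral_mono)
    fix x
    show "indicator {0..T f x} s \<le> ennreal (4 / s) * ennreal (T f1 x)"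
    proof (cases "s \<le> T f x")
      case True
      have "T f x \<le> 2 * T f0 x + 2 * T f1 x" using T_add[OF f0 f1, of x] by (simp add: sum)
      with True T0[of x] have "s / 4 \<le> T f1 x" by simp
      then have "1 \<le> 4 / s * T f1 x" using s by (simp add: field_simps)
      then have "ennreal 1 \<le> ennreal (4 / s * T f1 x)" by (rule ennreal_leI)
      also have "\<dots> = ennreal (4 / s) * ennreal (T f1 x)"
        by (rule ennreal_mult) (use s T_nonneg in auto)
      finally show ?thesis using True s by simp
    qed simp
  qed
  also have "\<dots> = ennreal (4 / s) * (\<integral>\<^sup>+ x. ennreal (T f1 x) \<partial>M)"
    using T_measurable[OF f1] by (intro nn_integral_cmult) measurable
  also have "\<dots> \<le> ennreal (4 / s) * sq_norm f1"
    by (intro mult_left_mono T_int f1) simp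
  also have "\<dots> \<le> ennreal (4 / s) *
    (\<integral>\<^sup>+ y. ennreal ((cmod (f y))\<^sup>2) * indicator {0..4 * B * I\<^sup>2 * cmod (f y) powr (- 2 * (p - 1))} s \<partial>lborel)"
  proof (intro mult_left_mono nn_integral_mono)
    fix y
    show "ennreal ((cmod (f1 y))\<^sup>2) \<le> ennreal ((cmod (f y))\<^sup>2) * indicator {0..4 * B * I\<^sup>2 * cmod (f y) powr (- 2 * (p - 1))} s"
    proof (cases "f1 y = 0")
      case False
      \<comment> \<open>The cut |f y| \<le> h is rewritten as a bound on s, the variable of the next
        integration. The power is decreasing, and f y \<noteq> 0 matters because
        \<open>0 powr r\<close> is 0.\<close>
      then have y: "cmod (f y) \<le> h" "f1 y = f y" "f y \<noteq> 0" by (auto simp: f1_def split: if_splits)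
      have "R \<le> cmod (f y) powr (- 2 * (p - 1))"
        unfolding hp[symmetric] using y p by (intro powr_mono2') auto
      then have "s \<le> 4 * B * I\<^sup>2 * cmod (f y) powr (- 2 * (p - 1))"
        using B I by (simp add: R_def field_simps)
      then show ?thesis using y s by simp
    qed simp
  qed simp
  finally show ?thesis .
qed

text \<open>Layer cake: the integral of T^\<sigma> is \<sigma> times that of s^(\<sigma>-1) against
  the measure of the level sets. The level bound lowers the power to s^(\<sigma>-2), integrable at 0
  because \<sigma> > 1, that is, p < 2. Integrating in s first gives |f|^2 |f|^(-2(p-1)(\<sigma>-1))
  = |f|^p. Since 2\<sigma> is the conjugate exponent, the total power of I is 2\<sigma> - 1 = 1 /
  (p-1).\<close>

lemma marcinkiewicz:
  fixes f :: "'a \<Rightarrow> complex" and p :: real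
  defines "\<sigma> \<equiv> p / (p - 1) / 2"
  assumes f: "dominated f" and p: "1 < p" "p < 2"
  shows "(\<integral>\<^sup>+ x. ennreal (T f x powr \<sigma>) \<partial>M) \<le>
    ennreal (4 * \<sigma> / (\<sigma> - 1) * (4 * B) powr (\<sigma> - 1) * (\<integral>y. cmod (f y) powr p \<partial>lborel) powr (1 / (p - 1)))"
proof -
  define I where "I = (\<integral>y. cmod (f y) powr p \<partial>lborel)"
  have [measurable]: "f \<in> borel_measurable borel" by (rule dominated_measurable[OF f])
  have Tm[measurable]: "T f \<in> borel_measurable M" by (rule T_measurable[OF f])
  interpret M: sigma_finite_measure M by (rule M)
  interpret P: pair_sigma_finite M "lborel :: real measure" ..
  have ip: "integrable lborel (\<lambda>y. cmod (f y) powr p)" using f p by (intro dominated_powr_integrable) auto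
  have \<sigma>: "\<sigma> > 1" "\<sigma> - 1 = (2 - p) / (2 * (p - 1))" "2 * \<sigma> - 1 = 1 / (p - 1)"
    using p by (simp_all add: \<sigma>_def field_simps)
  have "I \<ge> 0" unfolding I_def by (intro Bochner_Integration.integral_nonneg) auto
  then consider "I = 0" | "I > 0" by linarith
  then show ?thesis
  proof cases
    case 1
    \<comment> \<open>No cutting height exists for I = 0, but then f vanishes almost everywhere and
      the supremum bound kills T f.\<close>
    then have "AE y in lborel. cmod (f y) powr p = 0"
      unfolding I_def by (subst (asm) integral_nonneg_eq_0_iff_AE[OF ip]) auto
    then have "AE y in lborel. cmod (f y) = 0" by eventually_elim simp
    then have "(\<integral>y. cmod (f y) \<partial>lborel) = 0" by (rule integral_eq_zero_AE)
    then have "T f x = 0" for x using T_sup[OF f, of x] T_nonneg[of f x] by simp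
    then show ?thesis by simp
  next
    case 2
    let ?S = "\<lambda>y. 4 * B * I\<^sup>2 * cmod (f y) powr (- 2 * (p - 1))"
    have S: "?S y \<ge> 0" for y using B by simp
    have e3: "ennreal a * (ennreal b * (ennreal c * X)) = ennreal (a * (b * c)) * X"
      if "0 \<le> a" "0 \<le> b" "0 \<le> c" for a b c X
      using that by (simp add: ennreal_mult mult.assoc)
    have e4: "ennreal a * ennreal b * ennreal c = ennreal (a * b * c)"
      if "0 \<le> a" "0 \<le> b" "0 \<le> c" for a b c
      using that by (simp add: ennreal_mult)
    have Icc[measurable]: "(\<lambda>x. indicator {0..u x} (v x) :: ennreal) \<in> borel_measurable N"
      if [measurable]: "u \<in> borel_measurable N" "v \<in> borel_measurable N" for u v :: "_ \<Rightarrow> real" and N :: "'c measure"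
    proof -
      have "(\<lambda>x. indicator {0..u x} (v x) :: ennreal) = (\<lambda>x. if 0 \<le> v x \<and> v x \<le> u x then 1 else 0)"
        by (auto simp: indicator_def)
      then show ?thesis by simp
    qed
    have "(\<integral>\<^sup>+ x. ennreal (T f x powr \<sigma>) \<partial>M) =
      (\<integral>\<^sup>+ x. \<integral>\<^sup>+ s. ennreal \<sigma> * (ennreal (s powr (\<sigma> - 1)) * indicator {0..T f x} s) \<partial>lborel \<partial>M)"
    proof (rule nn_integral_cong)
      fix x
      have "(\<integral>\<^sup>+ s. ennreal \<sigma> * (ennreal (s powr (\<sigma> - 1)) * indicator {0..T f x} s) \<partial>lborel) =
          ennreal \<sigma> * ennreal (T f x powr \<sigma> / \<sigma>)"
        by (subst nn_integral_cmult, measurable) (use nn_integral_powr_Icc[OF T_nonneg[of f x], of \<sigma>] \<sigma>(1) in simp)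
      also have "\<dots> = ennreal (T f x powr \<sigma>)"
        using \<sigma>(1) by (subst ennreal_mult[symmetric]) auto
      finally show "ennreal (T f x powr \<sigma>) =
        (\<integral>\<^sup>+ s. ennreal \<sigma> * (ennreal (s powr (\<sigma> - 1)) * indicator {0..T f x} s) \<partial>lborel)" ..
    qed
    also have "\<dots> = (\<integral>\<^sup>+ s. \<integral>\<^sup>+ x. ennreal \<sigma> * (ennreal (s powr (\<sigma> - 1)) * indicator {0..T f x} s) \<partial>M \<partial>lborel)"
      by (rule P.Fubini'[symmetric]) (simp add: split_beta', measurable)
    also have "\<dots> \<le> (\<integral>\<^sup>+ s. \<integral>\<^sup>+ y. ennreal (4 * \<sigma>) * ennreal ((cmod (f y))\<^sup>2) * (ennreal (s powr (\<sigma> - 1 - 1)) * indicator {0..?S y} s) \<partial>lborel \<partial>lborel)"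
    proof (rule nn_integral_mono)
      fix s :: real
      show "(\<integral>\<^sup>+ x. ennreal \<sigma> * (ennreal (s powr (\<sigma> - 1)) * indicator {0..T f x} s) \<partial>M) \<le>
        (\<integral>\<^sup>+ y. ennreal (4 * \<sigma>) * ennreal ((cmod (f y))\<^sup>2) * (ennreal (s powr (\<sigma> - 1 - 1)) * indicator {0..?S y} s) \<partial>lborel)"
      proof (cases "s > 0")
        case True
        have "(\<integral>\<^sup>+ x. ennreal \<sigma> * (ennreal (s powr (\<sigma> - 1)) * indicator {0..T f x} s) \<partial>M) =
            ennreal \<sigma> * (ennreal (s powr (\<sigma> - 1)) * (\<integral>\<^sup>+ x. indicator {0..T f x} s \<partial>M))"
          by (subst nn_integral_cmult, measurable) (subst nn_integral_cmult, measurable)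
        also have "\<dots> \<le> ennreal \<sigma> * (ennreal (s powr (\<sigma> - 1)) * (ennreal (4 / s) * (\<integral>\<^sup>+ y. ennreal ((cmod (f y))\<^sup>2) * indicator {0..?S y} s \<partial>lborel)))"
          unfolding I_def by (intro mult_left_mono level_set_bound f True) (use p 2 in \<open>simp_all add: I_def\<close>)
        also have "\<dots> = ennreal (\<sigma> * (s powr (\<sigma> - 1) * (4 / s))) * (\<integral>\<^sup>+ y. ennreal ((cmod (f y))\<^sup>2) * indicator {0..?S y} s \<partial>lborel)"
          by (rule e3) (use \<sigma>(1) True in auto)
        also have "\<sigma> * (s powr (\<sigma> - 1) * (4 / s)) = 4 * \<sigma> * s powr (\<sigma> - 1 - 1)"
          using True by (subst (2) powr_diff) simp
        also have "ennreal (4 * \<sigma> * s powr (\<sigma> - 1 - 1)) * (\<integral>\<^sup>+ y. ennreal ((cmod (f y))\<^sup>2) * indicator {0..?S y} s \<partial>lborel) =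
          (\<integral>\<^sup>+ y. ennreal (4 * \<sigma> * s powr (\<sigma> - 1 - 1)) * (ennreal ((cmod (f y))\<^sup>2) * indicator {0..?S y} s) \<partial>lborel)"
          by (rule nn_integral_cmult[symmetric]) measurable
        also have "\<dots> = (\<integral>\<^sup>+ y. ennreal (4 * \<sigma>) * ennreal ((cmod (f y))\<^sup>2) * (ennreal (s powr (\<sigma> - 1 - 1)) * indicator {0..?S y} s) \<partial>lborel)"
        proof -
          have e: "ennreal (4 * \<sigma> * s powr (\<sigma> - 1 - 1)) = ennreal (4 * \<sigma>) * ennreal (s powr (\<sigma> - 1 - 1))"
            by (rule ennreal_mult'') simp
          show ?thesis unfolding e by (intro nn_integral_cong) (simp only: mult_ac)
        qed
        finally show ?thesis .
      next
        case False
        have "ennreal (s powr (\<sigma> - 1)) * indicator {0..T f x} s = 0" for x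
          using False by (cases "s = 0") auto
        then show ?thesis by (simp only: mult_zero_right nn_integral_0_iff_AE) simp
      qed
    qed
    also have "\<dots> = (\<integral>\<^sup>+ y. \<integral>\<^sup>+ s. ennreal (4 * \<sigma>) * ennreal ((cmod (f y))\<^sup>2) * (ennreal (s powr (\<sigma> - 1 - 1)) * indicator {0..?S y} s) \<partial>lborel \<partial>lborel)"
      by (rule lborel_pair.Fubini') (simp add: split_beta', measurable)
    also have "\<dots> = (\<integral>\<^sup>+ y. ennreal (4 * \<sigma> / (\<sigma> - 1) * (4 * B * I\<^sup>2) powr (\<sigma> - 1)) * ennreal (cmod (f y) powr p) \<partial>lborel)"
    proof (rule nn_integral_cong)
      fix y
      have "(\<integral>\<^sup>+ s. ennreal (4 * \<sigma>) * ennreal ((cmod (f y))\<^sup>2) * (ennreal (s powr (\<sigma> - 1 - 1)) * indicator {0..?S y} s) \<partial>lborel) =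
         ennreal (4 * \<sigma>) * ennreal ((cmod (f y))\<^sup>2) * ennreal (?S y powr (\<sigma> - 1) / (\<sigma> - 1))"
        by (subst nn_integral_cmult, measurable) (use nn_integral_powr_Icc[OF S[of y], of "\<sigma> - 1"] \<sigma>(1) in simp)
      also have "\<dots> = ennreal (4 * \<sigma> * (cmod (f y))\<^sup>2 * (?S y powr (\<sigma> - 1) / (\<sigma> - 1)))"
        by (rule e4) (use \<sigma>(1) in auto)
      also have "4 * \<sigma> * (cmod (f y))\<^sup>2 * (?S y powr (\<sigma> - 1) / (\<sigma> - 1)) = 4 * \<sigma> / (\<sigma> - 1) * (4 * B * I\<^sup>2) powr (\<sigma> - 1) * cmod (f y) powr p"
      proof (cases "f y = 0")
        case False
        have "- 2 * (p - 1) * (\<sigma> - 1) = p - 2" unfolding \<sigma>(2) using p by (simp add: field_simps)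
        then have "?S y powr (\<sigma> - 1) = (4 * B * I\<^sup>2) powr (\<sigma> - 1) * cmod (f y) powr (p - 2)"
          using B by (subst powr_mult) (auto simp: powr_powr)
        moreover have "(cmod (f y))\<^sup>2 * cmod (f y) powr (p - 2) = cmod (f y) powr p"
          using False powr_add[of "cmod (f y)" 2 "p - 2"] by simp
        ultimately show ?thesis by (simp add: field_simps)
      qed simp
      also have "ennreal (4 * \<sigma> / (\<sigma> - 1) * (4 * B * I\<^sup>2) powr (\<sigma> - 1) * cmod (f y) powr p) =
        ennreal (4 * \<sigma> / (\<sigma> - 1) * (4 * B * I\<^sup>2) powr (\<sigma> - 1)) * ennreal (cmod (f y) powr p)"
        by (rule ennreal_mult'') simp
      finally show "(\<integral>\<^sup>+ s. ennreal (4 * \<sigma>) * ennreal ((cmod (f y))\<^sup>2) * (ennreal (s powr (\<sigma> - 1 - 1)) * indicator {0..?S y} s) \<partial>lborel) =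
        ennreal (4 * \<sigma> / (\<sigma> - 1) * (4 * B * I\<^sup>2) powr (\<sigma> - 1)) * ennreal (cmod (f y) powr p)" .
    qed
    also have "\<dots> = ennreal (4 * \<sigma> / (\<sigma> - 1) * (4 * B * I\<^sup>2) powr (\<sigma> - 1)) * ennreal I"
      by (subst nn_integral_cmult, measurable) (use nn_integral_eq_integral[OF ip] in \<open>simp add: I_def\<close>)
    also have "\<dots> = ennreal (4 * \<sigma> / (\<sigma> - 1) * (4 * B * I\<^sup>2) powr (\<sigma> - 1) * I)"
      using \<sigma>(1) 2 by (intro ennreal_mult[symmetric]) auto
    also have "4 * \<sigma> / (\<sigma> - 1) * (4 * B * I\<^sup>2) powr (\<sigma> - 1) * I = 4 * \<sigma> / (\<sigma> - 1) * (4 * B) powr (\<sigma> - 1) * I powr (1 / (p - 1))"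
    proof -
      have a: "(4 * B * I\<^sup>2) powr (\<sigma> - 1) = (4 * B) powr (\<sigma> - 1) * (I powr 2) powr (\<sigma> - 1)"
        using B 2 by (subst powr_mult) auto
      have "(I powr 2) powr (\<sigma> - 1) * I = I powr (2 * (\<sigma> - 1) + 1)"
        unfolding powr_powr powr_add using 2 by simp
      also have "2 * (\<sigma> - 1) + 1 = 1 / (p - 1)" using \<sigma>(3) by simp
      finally have "(I powr 2) powr (\<sigma> - 1) * I = I powr (1 / (p - 1))" .
      then show ?thesis unfolding a by (simp only: mult.assoc)
    qed
    finally show ?thesis by (simp only: I_def)
  qed
qed

end

section \<open>The Hausdorff--Young inequality\<close>

lemma partial_fourier_add:
  assumes f: "dominated f" and g: "dominated g"
  shows "partial_fourier l (\<lambda>x. f x + g x) z = partial_fourier l f z + partial_fourier l g z"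
proof -
  have i: "integrable lborel (\<lambda>t. h (z, t) * cis (- l * t))" if h: "dominated h" for h
  proof (rule Bochner_Integration.integrable_bound)
    show i: "integrable lborel (\<lambda>t. h (z, t))" by (intro dominated_integrable dominated_section h)
    have [measurable]: "(\<lambda>t. h (z, t)) \<in> borel_measurable borel"
      by (rule dominated_measurable[OF dominated_section[OF h]])
    show "(\<lambda>t. h (z, t) * cis (- l * t)) \<in> borel_measurable lborel" by measurable
  qed (simp add: norm_mult)
  show ?thesis unfolding partial_fourier_def fourier_def
    by (simp only: distrib_right Bochner_Integration.integral_add[OF i[OF f] i[OF g]])
qed

lemma twisted_conv_add:
  assumes l: "l \<noteq> 0" and f: "integrable lborel f" and g: "integrable lborel g"
  shows "twisted_conv k l (\<lambda>z. f z + g z) w = twisted_conv k l f w + twisted_conv k l g w"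
proof -
  have i: "integrable lborel (\<lambda>z. h z * (complex_of_real (laguerre_fun k l (w - z)) * cis (- (l / 2) * sympl z w)))"
    if h: "integrable lborel h" for h
  proof (rule Bochner_Integration.integrable_bound)
    show "integrable lborel (\<lambda>z. laguerre_fun k l (0 :: complex ^ 'a) * cmod (h z))" using h by simp
    have [measurable]: "h \<in> borel_measurable borel" using h borel_measurable_integrable by auto
    show "(\<lambda>z. h z * (complex_of_real (laguerre_fun k l (w - z)) * cis (- (l / 2) * sympl z w))) \<in> borel_measurable lborel"
      by measurable
    have "cmod (h z) * \<bar>laguerre_fun k l (w - z)\<bar> \<le> laguerre_fun k l (0 :: complex ^ 'a) * cmod (h z)" for z
      using mult_left_mono[OF abs_laguerre_fun_le[OF l, of k "w - z"] norm_ge_zero[of "h z"]] by (simp add: mult.commute)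
    then show "AE z in lborel. norm (h z * (complex_of_real (laguerre_fun k l (w - z)) * cis (- (l / 2) * sympl z w)))
        \<le> norm (laguerre_fun k l (0 :: complex ^ 'a) * cmod (h z))"
      by (auto intro!: AE_I2 intro: order_trans[OF _ abs_ge_self] simp: norm_mult)
  qed
  show ?thesis unfolding twisted_conv_def
    by (simp only: distrib_right Bochner_Integration.integral_add[OF i[OF f] i[OF g]])
qed

lemma measurable_strichartz_fan_point:
  fixes f :: "'n::finite heisenberg \<Rightarrow> complex"
  assumes f: "dominated f" and l: "l \<noteq> 0"
  shows "strichartz f (fan_point CARD('n) (l, k)) \<in> borel_measurable borel"
proof -
  have [measurable]: "partial_fourier l f \<in> borel_measurable borel"
    by (rule dominated_measurable[OF dominated_partial_fourier[OF f]])
  show ?thesis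
    unfolding strichartz_fan_point[OF f l, abs_def] twisted_conv_def[abs_def] by measurable
qed

text \<open>Interpolation and square roots are carried out in the reals; by
  \<open>fan_energy_finite\<close> nothing is lost on dominated functions.\<close>

definition energy :: "('n::finite heisenberg \<Rightarrow> complex) \<Rightarrow> real \<times> nat \<Rightarrow> real" where
  "energy f x = enn2real (fan_energy f x)"

lemma energy_nonneg: "0 \<le> energy f x"
  by (simp add: energy_def)

lemma fan_energy_finite: "dominated f \<Longrightarrow> fan_energy f x < top"
  using fan_energy_le[of f x] by (simp add: le_less_trans)

lemma fan_energy_eq_energy: "dominated f \<Longrightarrow> fan_energy f x = ennreal (energy f x)"
  unfolding energy_def by (simp add: fan_energy_finite)

lemma energy_le:
  fixes f :: "'n::finite heisenberg \<Rightarrow> complex"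
  assumes f: "dominated f"
  shows "energy f x \<le> (2 * pi) ^ CARD('n) * (\<integral>x. cmod (f x) \<partial>lborel)\<^sup>2"
  using fan_energy_le[OF f, of x] unfolding fan_energy_eq_energy[OF f]
  by (subst (asm) ennreal_le_iff) auto

lemma measurable_energy:
  assumes "dominated f" shows "energy f \<in> borel_measurable (fan_base n)"
proof -
  have [measurable]: "f \<in> borel_measurable borel" by (rule dominated_measurable[OF assms])
  show ?thesis unfolding energy_def[abs_def] by measurable
qed

lemma ennreal_add_double:
  "0 \<le> a \<Longrightarrow> 0 \<le> b \<Longrightarrow> 0 \<le> c \<Longrightarrow> ennreal (a + b + 2 * c) = (ennreal a + ennreal b) + 2 * ennreal c"
  by (simp add: ennreal_mult)

text \<open>Minkowski's inequality squared, by Cauchy-Schwarz in w. The cross term is kept sharp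
  because \<open>duality_bound\<close> cancels the two squares exactly; interpolation is content
  with \<open>energy_add_le2\<close>.\<close>

lemma energy_add_le:
  fixes f g :: "'n::finite heisenberg \<Rightarrow> complex"
  assumes f: "dominated f" and g: "dominated g"
  shows "energy (\<lambda>y. f y + g y) x \<le> energy f x + energy g x + 2 * sqrt (energy f x * energy g x)"
proof (cases "fst x = 0")
  case True
  then show ?thesis by (simp add: energy_def fan_energy_def power_0_left)
next
  case False
  obtain l k where x: "x = (l, k)" by (cases x)
  have l: "l \<noteq> 0" using False x by simp
  let ?S = "\<lambda>h. strichartz h (fan_point CARD('n) x)"
  let ?N = "\<lambda>h. sq_norm (?S h)"
  let ?c = "\<bar>l\<bar> ^ CARD('n)"
  have c: "?c > 0" using l by simp
  have fg: "dominated (\<lambda>y. f y + g y)" by (rule dominated_add[OF f g])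
  have S: "?S (\<lambda>y. f y + g y) w = ?S f w + ?S g w" for w
    unfolding x strichartz_fan_point[OF fg l] strichartz_fan_point[OF f l] strichartz_fan_point[OF g l]
    by (simp only: partial_fourier_add[OF f g, abs_def] twisted_conv_add[OF l dominated_integrable[OF dominated_partial_fourier[OF f]]
          dominated_integrable[OF dominated_partial_fourier[OF g]]] distrib_left)
  have [measurable]: "?S f \<in> borel_measurable borel" "?S g \<in> borel_measurable borel"
    unfolding x using f g l by (auto intro: measurable_strichartz_fan_point)
  have fin: "?N h = ennreal (energy h x / ?c)" if h: "dominated h" for h :: "'n heisenberg \<Rightarrow> complex"
  proof -
    have e: "ennreal ?c * ?N h = ennreal (energy h x)"
      using fan_energy_eq_energy[OF h, of x] by (simp add: fan_energy_def x)
    have "?N h = ennreal (1 / ?c) * (ennreal ?c * ?N h)"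
      using c by (simp add: mult.assoc[symmetric] ennreal_mult[symmetric])
    also have "\<dots> = ennreal (1 / ?c * energy h x)"
      unfolding e using c by (intro ennreal_mult[symmetric]) (auto simp: energy_nonneg)
    finally show ?thesis by simp
  qed
  define X where "X = (\<integral>\<^sup>+ w. ennreal (cmod (?S f w)) * ennreal (cmod (?S g w)) \<partial>lborel)"
  have "X\<^sup>2 \<le> (\<integral>\<^sup>+ w. (ennreal (cmod (?S f w)))\<^sup>2 \<partial>lborel) * (\<integral>\<^sup>+ w. (ennreal (cmod (?S g w)))\<^sup>2 \<partial>lborel)"
    unfolding X_def by (rule Cauchy_Schwarz_nn_integral) measurable
  also have "\<dots> = ?N f * ?N g" by (simp add: ennreal_power)
  also have "\<dots> = ennreal (energy f x / ?c * (energy g x / ?c))"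
    unfolding fin[OF f] fin[OF g] using c by (intro ennreal_mult[symmetric]) (auto simp: energy_nonneg)
  also have "\<dots> = (ennreal (sqrt (energy f x * energy g x) / ?c))\<^sup>2"
    using c by (subst ennreal_power) (auto simp: energy_nonneg power_divide power2_eq_square[of ?c])
  finally have XX: "X\<^sup>2 \<le> (ennreal (sqrt (energy f x * energy g x) / ?c))\<^sup>2" .
  have sq: "X \<le> ennreal y" if "X\<^sup>2 \<le> (ennreal y)\<^sup>2" "0 \<le> y" for y
  proof (cases X rule: ennreal_cases)
    case (real r)
    then have "ennreal (r\<^sup>2) \<le> ennreal (y\<^sup>2)" using that by (simp add: ennreal_power)
    then have "r\<^sup>2 \<le> y\<^sup>2" by (subst (asm) ennreal_le_iff) auto
    then show ?thesis using real that(2) by (auto intro: ennreal_leI power2_le_imp_le)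
  next
    case top
    then show ?thesis using that by (simp add: power2_eq_square ennreal_mult_top top_unique ennreal_mult_eq_top_iff)
  qed
  have X: "X \<le> ennreal (sqrt (energy f x * energy g x) / ?c)"
    by (rule sq[OF XX]) (use c in \<open>simp add: energy_nonneg\<close>)
  have "?N (\<lambda>y. f y + g y) \<le> (\<integral>\<^sup>+ w. (ennreal ((cmod (?S f w))\<^sup>2) + ennreal ((cmod (?S g w))\<^sup>2)) +
      2 * (ennreal (cmod (?S f w)) * ennreal (cmod (?S g w))) \<partial>lborel)"
  proof (rule nn_integral_mono)
    fix w
    let ?a = "cmod (?S f w)" and ?b = "cmod (?S g w)"
    have "(cmod (?S f w + ?S g w))\<^sup>2 \<le> (?a + ?b)\<^sup>2"
      by (intro power_mono norm_triangle_ineq) simp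
    also have "\<dots> = ?a\<^sup>2 + ?b\<^sup>2 + 2 * (?a * ?b)" by (simp add: power2_eq_square algebra_simps)
    finally have "ennreal ((cmod (?S f w + ?S g w))\<^sup>2) \<le> ennreal (?a\<^sup>2 + ?b\<^sup>2 + 2 * (?a * ?b))"
      by (rule ennreal_leI)
    also have "\<dots> = (ennreal (?a\<^sup>2) + ennreal (?b\<^sup>2)) + 2 * (ennreal ?a * ennreal ?b)"
      by (simp add: ennreal_mult)
    finally show "ennreal ((cmod (?S (\<lambda>y. f y + g y) w))\<^sup>2) \<le> \<dots>" unfolding S .
  qed
  also have "\<dots> = (?N f + ?N g) + 2 * X"
    unfolding X_def by (subst nn_integral_add, measurable, subst nn_integral_add, measurable, subst nn_integral_cmult, measurable)
  also have "\<dots> \<le> (?N f + ?N g) + 2 * ennreal (sqrt (energy f x * energy g x) / ?c)"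
    by (intro add_left_mono mult_left_mono X) simp
  also have "\<dots> = ennreal (energy f x / ?c + energy g x / ?c + 2 * (sqrt (energy f x * energy g x) / ?c))"
    unfolding fin[OF f] fin[OF g] using c by (intro ennreal_add_double[symmetric]) (auto simp: energy_nonneg)
  finally have "ennreal (energy (\<lambda>y. f y + g y) x / ?c) \<le> ennreal (energy f x / ?c + energy g x / ?c + 2 * (sqrt (energy f x * energy g x) / ?c))"
    unfolding fin[OF fg] .
  then have "energy (\<lambda>y. f y + g y) x / ?c \<le> energy f x / ?c + energy g x / ?c + 2 * (sqrt (energy f x * energy g x) / ?c)"
    by (subst (asm) ennreal_le_iff) (use c in \<open>auto simp: energy_nonneg intro!: add_nonneg_nonneg\<close>)
  also have "\<dots> = (energy f x + energy g x + 2 * sqrt (energy f x * energy g x)) / ?c"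
    by (simp add: add_divide_distrib)
  finally show ?thesis using c by (simp only: divide_le_cancel)
qed

lemma energy_add_le2:
  assumes f: "dominated f" and g: "dominated g"
  shows "energy (\<lambda>y. f y + g y) x \<le> 2 * energy f x + 2 * energy g x"
proof -
  have "2 * sqrt (energy f x * energy g x) \<le> energy f x + energy g x"
    using arith_geo_mean_sqrt[OF energy_nonneg energy_nonneg, of f x g x] by simp
  with energy_add_le[OF f g, of x] show ?thesis by simp
qed

lemma sigma_finite_fan_base: "sigma_finite_measure (fan_base n)"
proof -
  interpret C: sigma_finite_measure "count_space (UNIV :: nat set)" by (rule sigma_finite_measure_count_space)
  interpret P: pair_sigma_finite "lborel :: real measure" "count_space (UNIV :: nat set)" ..
  show ?thesis
    unfolding fan_base_def by (subst P.sigma_finite_iff_density_finite) auto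
qed

lemma energy_bessel:
  fixes f :: "'n::finite heisenberg \<Rightarrow> complex"
  assumes f: "dominated f"
  shows "(\<integral>\<^sup>+ x. ennreal (energy f x) \<partial>fan_base CARD('n)) \<le> sq_norm f"
  using fan_bessel[OF f] by (simp add: fan_energy_eq_energy[OF f])

lemma energy_plancherel:
  fixes f :: "'n::finite heisenberg \<Rightarrow> complex"
  assumes f: "dominated f" and "continuous_on UNIV f"
  shows "(\<integral>\<^sup>+ x. ennreal (energy f x) \<partial>fan_base CARD('n)) = sq_norm f"
  using fan_plancherel[OF f assms(2)] by (simp add: fan_energy_eq_energy[OF f])

text \<open>The constant of \<open>marcinkiewicz\<close> for \<sigma> = p' / 2 and B = (2
  \<pi>)^n.\<close>

definition hy_const :: "nat \<Rightarrow> real \<Rightarrow> real" where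
  "hy_const n p = 4 * (p / (p - 1) / 2) / (p / (p - 1) / 2 - 1) * (4 * (2 * pi) ^ n) powr (p / (p - 1) / 2 - 1)"

lemma hy_const_pos: "1 < p \<Longrightarrow> p < 2 \<Longrightarrow> 0 < hy_const n p"
  unfolding hy_const_def by (intro mult_pos_pos divide_pos_pos) (auto simp: field_simps)

lemma hausdorff_young:
  fixes f :: "'n::finite heisenberg \<Rightarrow> complex"
  assumes f: "dominated f" and p: "1 < p" "p < 2"
  shows "(\<integral>\<^sup>+ x. ennreal (energy f x powr (p / (p - 1) / 2)) \<partial>fan_base CARD('n)) \<le>
    ennreal (hy_const CARD('n) p * (\<integral>y. cmod (f y) powr p \<partial>lborel) powr (1 / (p - 1)))"
  unfolding hy_const_def
  by (rule marcinkiewicz[OF sigma_finite_fan_base _ energy_nonneg measurable_energy energy_add_le2 energy_le energy_bessel f p]) simp_all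

text \<open>At each point g is a nonnegative multiple of f, so |f + g|^2 has the cross term 2 |f|^p
  without any phase. Comparing Plancherel's formula for f + g with those for f and g leaves a
  comparison of the cross terms, so no sesquilinear version of the formula is required.\<close>

lemma duality_bound:
  fixes f :: "'n::finite heisenberg \<Rightarrow> complex"
  assumes f: "dominated f" and cont: "continuous_on UNIV f" and p: "2 < p"
  defines "g \<equiv> \<lambda>y. f y * complex_of_real (cmod (f y) powr (p - 2))"
  shows "dominated g"
    and "ennreal (\<integral>y. cmod (f y) powr p \<partial>lborel) \<le> (\<integral>\<^sup>+ x. ennreal (sqrt (energy f x * energy g x)) \<partial>fan_base CARD('n))"
proof -
  have fm[measurable]: "f \<in> borel_measurable borel" by (rule dominated_measurable[OF f])
  obtain C where C: "0 \<le> C" "\<And>x. cmod (f x) \<le> C * decay_weight x" "\<And>x. cmod (f x) \<le> C"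
    by (rule dominatedE[OF f]) (rule that)
  have gm[measurable]: "g \<in> borel_measurable borel" unfolding g_def by measurable
  show g: "dominated g"
  proof (rule dominated_mono[OF f gm])
    show "cmod (g y) \<le> C powr (p - 2) * cmod (f y)" for y
      using powr_mono2[of "p - 2" "cmod (f y)" C] C(3)[of y] p
      by (simp add: g_def norm_mult mult.commute mult_left_mono)
  qed
  have gc: "continuous_on UNIV g"
    unfolding g_def using p by (intro continuous_intros cont continuous_on_powr') auto
  have fg: "dominated (\<lambda>y. f y + g y)" by (rule dominated_add[OF f g])
  have fgc: "continuous_on UNIV (\<lambda>y. f y + g y)" by (intro continuous_intros cont gc)
  have i2: "integrable lborel (\<lambda>y. (cmod (h y))\<^sup>2)" if "dominated h" for h :: "'n heisenberg \<Rightarrow> complex"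
    using dominated_powr_integrable[OF that, of 2] by simp
  have ip: "integrable lborel (\<lambda>y. cmod (f y) powr p)" using p by (intro dominated_powr_integrable f) simp
  define I where "I = (\<integral>y. cmod (f y) powr p \<partial>lborel)"
  define A where "A = (\<integral>y. (cmod (f y))\<^sup>2 \<partial>lborel)"
  define B where "B = (\<integral>y. (cmod (g y))\<^sup>2 \<partial>lborel)"
  have nn: "0 \<le> I" "0 \<le> A" "0 \<le> B"
    unfolding I_def A_def B_def by (auto intro!: Bochner_Integration.integral_nonneg)
  have pt: "(cmod (f y + g y))\<^sup>2 = (cmod (f y))\<^sup>2 + (cmod (g y))\<^sup>2 + 2 * cmod (f y) powr p" for y
  proof -
    let ?r = "cmod (f y) powr (p - 2)"
    have "f y + g y = f y * complex_of_real (1 + ?r)" by (simp add: g_def distrib_left)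
    then have "cmod (f y + g y) = cmod (f y) * \<bar>1 + ?r\<bar>"
      by (simp only: norm_mult norm_of_real)
    then have "(cmod (f y + g y))\<^sup>2 = (cmod (f y))\<^sup>2 * (1 + ?r)\<^sup>2"
      by (simp add: power_mult_distrib)
    also have "\<dots> = (cmod (f y))\<^sup>2 + (cmod (f y) * ?r)\<^sup>2 + 2 * ((cmod (f y))\<^sup>2 * ?r)"
      by (simp add: power2_eq_square algebra_simps)
    also have "(cmod (f y))\<^sup>2 * ?r = cmod (f y) powr p"
      using powr_add[of "cmod (f y)" 2 "p - 2"] by (cases "f y = 0") simp_all
    finally show ?thesis by (simp add: g_def norm_mult)
  qed
  let ?X = "\<integral>\<^sup>+ x. ennreal (sqrt (energy f x * energy g x)) \<partial>fan_base CARD('n)"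
  note [measurable] = measurable_energy[OF f] measurable_energy[OF g]
  have "ennreal (A + B + 2 * I) = sq_norm (\<lambda>y. f y + g y)"
    unfolding pt A_def B_def I_def using i2[OF f] i2[OF g] ip
    by (subst nn_integral_eq_integral) auto
  also have "\<dots> = (\<integral>\<^sup>+ x. ennreal (energy (\<lambda>y. f y + g y) x) \<partial>fan_base CARD('n))"
    by (rule energy_plancherel[OF fg fgc, symmetric])
  also have "\<dots> \<le> (\<integral>\<^sup>+ x. (ennreal (energy f x) + ennreal (energy g x)) + 2 * ennreal (sqrt (energy f x * energy g x)) \<partial>fan_base CARD('n))"
  proof (rule nn_integral_mono)
    fix x
    have "ennreal (energy (\<lambda>y. f y + g y) x) \<le> ennreal (energy f x + energy g x + 2 * sqrt (energy f x * energy g x))"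
      by (intro ennreal_leI energy_add_le f g)
    also have "\<dots> = (ennreal (energy f x) + ennreal (energy g x)) + 2 * ennreal (sqrt (energy f x * energy g x))"
      by (intro ennreal_add_double) (auto simp: energy_nonneg)
    finally show "ennreal (energy (\<lambda>y. f y + g y) x) \<le> \<dots>" .
  qed
  also have "\<dots> = ((\<integral>\<^sup>+ x. ennreal (energy f x) \<partial>fan_base CARD('n)) + (\<integral>\<^sup>+ x. ennreal (energy g x) \<partial>fan_base CARD('n))) + 2 * ?X"
    by (subst nn_integral_add, measurable, subst nn_integral_add, measurable, subst nn_integral_cmult, measurable)
  also have "\<dots> = (ennreal A + ennreal B) + 2 * ?X"
    unfolding energy_plancherel[OF f cont] energy_plancherel[OF g gc] A_def B_def
    by (subst (1 2) nn_integral_eq_integral) (use i2[OF f] i2[OF g] in auto)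
  also have "ennreal (A + B + 2 * I) = (ennreal A + ennreal B) + 2 * ennreal I"
    by (intro ennreal_add_double nn)
  \<comment> \<open>A and B are finite, so they cancel in [0, \<infinity>].\<close>
  finally have "2 * ennreal I \<le> 2 * ?X"
    by (simp only: ennreal_add_left_cancel_le) (auto simp: ennreal_add_eq_top)
  then show "ennreal I \<le> ?X"
    by (subst (asm) ennreal_mult_le_mult_iff) auto
qed

section \<open>Powers in [0, \<infinity>] and the norms on the fan\<close>

lemma epowr_ennreal: "0 \<le> x \<Longrightarrow> ennreal x epowr r = ennreal (x powr r)"
  by (simp add: epowr_def)

lemma epowr_mono:
  assumes "x \<le> y" "0 \<le> r" shows "x epowr r \<le> y epowr r"
proof (cases y rule: ennreal_cases)
  case (real b)
  then obtain a where a: "x = ennreal a" "0 \<le> a" using assms by (cases x rule: ennreal_cases) (auto simp: top_unique)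
  then have "a \<le> b" using assms(1) real by simp
  then show ?thesis using a real assms(2) by (auto simp: epowr_ennreal intro!: ennreal_leI powr_mono2)
qed (simp add: epowr_def)

lemma epowr_mult_ennreal:
  assumes "0 < c" shows "(ennreal c * x) epowr r = ennreal (c powr r) * x epowr r"
proof (cases x rule: ennreal_cases)
  case (real a)
  then show ?thesis using assms by (simp add: epowr_ennreal powr_mult flip: ennreal_mult)
qed (use assms in \<open>simp add: epowr_def ennreal_mult_top\<close>)

lemma measurable_epowr [measurable (raw)]:
  assumes [measurable]: "f \<in> borel_measurable M"
  shows "(\<lambda>x. f x epowr r) \<in> borel_measurable M"
  unfolding epowr_def by measurable

lemma fan_energy_epowr:
  fixes f :: "'n::finite heisenberg \<Rightarrow> complex"
  assumes r: "0 < r"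
  shows "(sq_norm (strichartz f (fan_point CARD('n) x))) epowr r *
    ennreal (\<bar>fst x\<bar> powr (real CARD('n) * r)) = fan_energy f x epowr r"
proof (cases "fst x = 0")
  \<comment> \<open>For \<lambda> = 0 both sides vanish, even if the norm is infinite, since 0 times
    \<infinity> is 0.\<close>
  case True
  then show ?thesis using r by (simp add: fan_energy_def power_0_left epowr_def)
next
  case False
  have e: "\<bar>fst x\<bar> powr (real CARD('n) * r) = (\<bar>fst x\<bar> ^ CARD('n)) powr r"
    using False by (simp add: powr_powr flip: powr_realpow)
  show ?thesis unfolding fan_energy_def e
    using False by (subst epowr_mult_ennreal) (auto simp: mult.commute)
qed

lemma nn_integral_mu:
  assumes n: "0 < n" and [measurable]: "\<phi> \<in> borel_measurable (restrict_space borel (fan n))"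
  shows "(\<integral>\<^sup>+ a. \<phi> a \<partial>mu n) = (\<integral>\<^sup>+ x. \<phi> (fan_point n x) \<partial>fan_base n)"
proof -
  have [measurable]: "fst \<in> borel_measurable (restrict_space borel (fan n))"
    by (intro measurable_restrict_space1) (simp flip: borel_prod)
  have s: "sets (nu2 n) = sets (restrict_space borel (fan n))" by (simp add: nu2_def)
  have wm[measurable]: "(\<lambda>a. ennreal (\<bar>fst a\<bar> powi (- int n))) \<in> borel_measurable (restrict_space borel (fan n))"
    unfolding power_int_minus power_int_of_nat by measurable
  note [measurable] = measurable_compose[OF measurable_fan_point wm] measurable_compose[OF measurable_fan_point assms(2)]
  let ?W = "\<lambda>x::real \<times> nat. (2 * pi) powi (- 2 * int n - 1) * fan_coeff n (snd x) powi (- 2)"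
  \<comment> \<open>At \<lambda> = 0 the negative power is 0 by convention and both sides
    vanish.\<close>
  have w: "ennreal (?W x * \<bar>fst x\<bar> ^ (2 * n)) * ennreal (\<bar>fst (fan_point n x)\<bar> powi (- int n)) = ennreal (?W x * \<bar>fst x\<bar> ^ n)" for x
  proof -
    have "y ^ (2 * n) * y powi (- int n) = y ^ n" for y :: real
      unfolding power_int_minus power_int_of_nat mult_2 power_add using n by (cases "y = 0") (simp_all add: power_0_left)
    moreover have "fst (fan_point n x) = fst x" by (simp add: fan_point_def split_beta')
    ultimately have "?W x * \<bar>fst x\<bar> ^ (2 * n) * \<bar>fst (fan_point n x)\<bar> powi (- int n) = ?W x * \<bar>fst x\<bar> ^ n"
      by (simp only: mult.assoc)
    moreover have "0 \<le> \<bar>fst (fan_point n x)\<bar> powi (- int n)" by (rule zero_le_power_int) simp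
    ultimately show ?thesis by (simp only: ennreal_mult''[symmetric])
  qed
  have "(\<integral>\<^sup>+ a. \<phi> a \<partial>mu n) = (\<integral>\<^sup>+ a. ennreal (\<bar>fst a\<bar> powi (- int n)) * \<phi> a \<partial>nu2 n)"
    unfolding mu_def by (rule nn_integral_density) (simp_all only: measurable_cong_sets[OF s refl] wm assms(2))
  also have "\<dots> = (\<integral>\<^sup>+ x. ennreal (\<bar>fst (fan_point n x)\<bar> powi (- int n)) * \<phi> (fan_point n x)
      \<partial>density (lborel \<Otimes>\<^sub>M count_space UNIV) (\<lambda>x. ennreal (?W x * \<bar>fst x\<bar> ^ (2 * n))))"
    unfolding nu2_def split_beta' by (rule nn_integral_distr) simp_all
  also have "\<dots> = (\<integral>\<^sup>+ x. ennreal (?W x * \<bar>fst x\<bar> ^ (2 * n)) * (ennreal (\<bar>fst (fan_point n x)\<bar> powi (- int n)) * \<phi> (fan_point n x))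
      \<partial>(lborel \<Otimes>\<^sub>M count_space UNIV))"
    by (rule nn_integral_density) measurable
  also have "\<dots> = (\<integral>\<^sup>+ x. ennreal (?W x * \<bar>fst x\<bar> ^ n) * \<phi> (fan_point n x) \<partial>(lborel \<Otimes>\<^sub>M count_space UNIV))"
    by (simp only: mult.assoc[symmetric] w)
  also have "\<dots> = (\<integral>\<^sup>+ x. \<phi> (fan_point n x) \<partial>fan_base n)"
    unfolding fan_base_def by (rule nn_integral_density[symmetric]) measurable
  finally show ?thesis .
qed

lemma measurable_fan_norm_integrand:
  fixes f :: "'n::finite heisenberg \<Rightarrow> complex"
  assumes f: "dominated f"
  shows "(\<lambda>a. (sq_norm (strichartz f a)) epowr r *
    ennreal (\<bar>fst a\<bar> powr s)) \<in> borel_measurable (restrict_space borel (fan CARD('n)))"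
proof -
  have [measurable]: "fst \<in> borel_measurable (restrict_space borel (fan CARD('n)))"
    by (intro measurable_restrict_space1) (simp flip: borel_prod)
  note [measurable] = measurable_strichartz_norm[OF dominated_measurable[OF f]]
  show ?thesis by measurable
qed

lemma fan_norm_eq:
  fixes f :: "'n::finite heisenberg \<Rightarrow> complex"
  assumes f: "dominated f" and q: "0 < q"
  shows "fan_norm (ennreal q) (strichartz f) = (\<integral>\<^sup>+ x. ennreal (energy f x powr (q / 2)) \<partial>fan_base CARD('n)) epowr (1 / q)"
proof -
  have "(\<integral>\<^sup>+ a. (sq_norm (strichartz f a)) epowr (q / 2) * ennreal (\<bar>fst a\<bar> powr (real CARD('n) * q / 2)) \<partial>mu CARD('n)) =
    (\<integral>\<^sup>+ x. (sq_norm (strichartz f (fan_point CARD('n) x))) epowr (q / 2) *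
      ennreal (\<bar>fst (fan_point CARD('n) x)\<bar> powr (real CARD('n) * q / 2)) \<partial>fan_base CARD('n))"
    by (rule nn_integral_mu[OF _ measurable_fan_norm_integrand[OF f]]) simp
  also have "\<dots> = (\<integral>\<^sup>+ x. ennreal (energy f x powr (q / 2)) \<partial>fan_base CARD('n))"
  proof (rule nn_integral_cong)
    fix x
    have "fst (fan_point CARD('n) x) = fst x" by (simp add: fan_point_def split_beta')
    then show "(sq_norm (strichartz f (fan_point CARD('n) x))) epowr (q / 2) *
      ennreal (\<bar>fst (fan_point CARD('n) x)\<bar> powr (real CARD('n) * q / 2)) = ennreal (energy f x powr (q / 2))"
      using fan_energy_epowr[of "q / 2" f x] q
      by (simp add: fan_energy_eq_energy[OF f] epowr_ennreal energy_nonneg)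
  qed
  finally show ?thesis using q by (simp add: fan_norm_def)
qed

lemma fan_norm_infinity_le:
  fixes f :: "'n::finite heisenberg \<Rightarrow> complex"
  assumes f: "dominated f"
  shows "fan_norm \<infinity> (strichartz f) \<le> ennreal (sqrt ((2 * pi) ^ CARD('n)) * (\<integral>y. cmod (f y) \<partial>lborel))"
proof -
  let ?\<phi> = "\<lambda>a. ennreal (\<bar>fst a\<bar> powr (real CARD('n) / 2)) * (sq_norm (strichartz f a)) epowr (1 / 2)"
  let ?B = "ennreal (sqrt ((2 * pi) ^ CARD('n)) * (\<integral>y. cmod (f y) \<partial>lborel))"
  have s: "sets (mu CARD('n)) = sets (restrict_space borel (fan CARD('n)))"
    by (simp add: mu_def nu2_def)
  have m: "?\<phi> \<in> borel_measurable (mu CARD('n))"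
    using measurable_fan_norm_integrand[OF f, of "1 / 2" "real CARD('n) / 2"]
    unfolding measurable_cong_sets[OF s refl] by (simp only: mult.commute)
  have point: "?\<phi> (fan_point CARD('n) x) \<le> ?B" for x
  proof -
    have "?\<phi> (fan_point CARD('n) x) = ennreal (energy f x powr (1 / 2))"
      using fan_energy_epowr[of "1 / 2" f x]
      by (simp add: fan_energy_eq_energy[OF f] epowr_ennreal energy_nonneg fan_point_def split_beta' mult.commute)
    also have "\<dots> = ennreal (sqrt (energy f x))" by (simp add: powr_half_sqrt energy_nonneg)
    also have "\<dots> \<le> ennreal (sqrt ((2 * pi) ^ CARD('n) * (\<integral>y. cmod (f y) \<partial>lborel)\<^sup>2))"
      by (intro ennreal_leI real_sqrt_le_mono energy_le f)
    also have "sqrt ((2 * pi) ^ CARD('n) * (\<integral>y. cmod (f y) \<partial>lborel)\<^sup>2) = sqrt ((2 * pi) ^ CARD('n)) * (\<integral>y. cmod (f y) \<partial>lborel)"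
      by (simp only: real_sqrt_mult real_sqrt_abs) (simp add: Bochner_Integration.integral_nonneg)
    finally show ?thesis .
  qed
  \<comment> \<open>The bound holds at every point of the fan: on the limiting ray the factor
    \<open>0 powr _\<close> is 0.\<close>
  have "?\<phi> a \<le> ?B" if a: "a \<in> fan CARD('n)" for a
  proof (cases "fst a = 0")
    case False
    then obtain l k where "a = fan_point CARD('n) (l, k)"
      using a by (auto simp: fan_def fan_ray_def fan_point_def)
    then show ?thesis using point by simp
  qed simp
  moreover have "space (mu CARD('n)) = fan CARD('n)"
    using sets_eq_imp_space_eq[OF s] by (simp add: space_restrict_space)
  ultimately have "esssup (mu CARD('n)) ?\<phi> \<le> ?B"
    by (intro esssup_I m AE_I2) simp
  then show ?thesis by (simp add: fan_norm_def)
qed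

lemma lp_norm_eq:
  fixes f :: "'n::finite heisenberg \<Rightarrow> complex"
  assumes f: "dominated f" and p: "1 \<le> p"
  shows "lp_norm p f = ennreal ((\<integral>y. cmod (f y) powr p \<partial>lborel) powr (1 / p))"
proof -
  have "(\<integral>\<^sup>+ y. ennreal (cmod (f y) powr p) \<partial>lborel) = ennreal (\<integral>y. cmod (f y) powr p \<partial>lborel)"
    by (rule nn_integral_eq_integral[OF dominated_powr_integrable[OF f p]]) auto
  then show ?thesis
    unfolding lp_norm_def by (simp add: epowr_ennreal Bochner_Integration.integral_nonneg)
qed

section \<open>Schwartz functions and conjugate exponents\<close>

lemma schwartz_continuous:
  assumes "schwartz f" shows "continuous_on UNIV f"
proof -
  have "f differentiable (at x)" for x using assms unfolding schwartz_def by (auto dest: spec[of _ "[]"])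
  then show ?thesis
    by (auto simp: continuous_on_eq_continuous_at differentiable_imp_continuous_within)
qed

text \<open>Decay of f itself of the orders 0 and 2d suffices in dimension d: the product of the 1 +
  x_b^2 is at most (1 + |x|^2)^d, hence at most 2^d (1 + |x|^(2d)).\<close>

lemma schwartz_dominated:
  fixes f :: "'a::euclidean_space \<Rightarrow> complex"
  assumes f: "schwartz f" shows "dominated f"
proof -
  let ?d = "DIM('a)"
  have b: "bounded (range (\<lambda>x. (norm x) ^ N *\<^sub>R f x))" for N
    using f unfolding schwartz_def by (auto dest: spec[of _ "[]"])
  obtain A where A: "\<And>x. cmod (f x) \<le> A" using b[of 0] by (auto simp: bounded_iff)
  obtain B where B: "\<And>x. (norm x) ^ (2 * ?d) * cmod (f x) \<le> B"
    using b[of "2 * ?d"] by (auto simp: bounded_iff)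
  have "cmod (f x) \<le> (2 ^ ?d * (A + B)) * decay_weight x" for x
  proof -
    let ?P = "\<Prod>b\<in>(Basis :: 'a set). 1 + (x \<bullet> b)\<^sup>2"
    have P: "?P > 0" by (intro prod_pos) (auto intro: add_pos_nonneg)
    have "?P \<le> (\<Prod>b\<in>(Basis :: 'a set). 1 + (norm x)\<^sup>2)"
      by (intro prod_mono) (auto intro!: power_mono simp: Basis_le_norm abs_le_square_iff[symmetric])
    also have "\<dots> = (1 + (norm x)\<^sup>2) ^ ?d" by simp
    also have "\<dots> \<le> (2 * max 1 ((norm x)\<^sup>2)) ^ ?d" by (intro power_mono) auto
    also have "\<dots> = 2 ^ ?d * (max 1 ((norm x)\<^sup>2)) ^ ?d" by (simp add: power_mult_distrib)
    also have "\<dots> \<le> 2 ^ ?d * (1 + (norm x) ^ (2 * ?d))"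
    proof (intro mult_left_mono)
      show "(max 1 ((norm x)\<^sup>2)) ^ ?d \<le> 1 + (norm x) ^ (2 * ?d)"
        by (cases "1 \<le> (norm x)\<^sup>2") (simp_all add: max_def power_mult)
    qed simp
    finally have "?P * cmod (f x) \<le> 2 ^ ?d * (1 + (norm x) ^ (2 * ?d)) * cmod (f x)"
      by (intro mult_right_mono) auto
    also have "\<dots> \<le> 2 ^ ?d * (A + B)"
      using A[of x] B[of x] by (simp add: distrib_left distrib_right mult.assoc add_mono)
    finally have "cmod (f x) \<le> 2 ^ ?d * (A + B) / ?P" using P by (simp add: field_simps)
    moreover have "decay_weight x = 1 / ?P"
      by (simp add: decay_weight_def prod_inversef[symmetric] divide_inverse)
    ultimately show ?thesis by simp
  qed
  moreover have "f \<in> borel_measurable borel"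
    by (rule borel_measurable_continuous_onI[OF schwartz_continuous[OF f]])
  ultimately show ?thesis by (auto simp: dominated_def)
qed

lemma conjugate_exponent:
  fixes p :: real and q :: ennreal
  assumes pq: "1 / ennreal p + 1 / q = 1" and p: "1 \<le> p"
  shows "p = 1 \<Longrightarrow> q = \<infinity>" and "1 < p \<Longrightarrow> q = ennreal (p / (p - 1))"
proof -
  have ip: "1 / ennreal p = ennreal (1 / p)"
    using divide_ennreal[of 1 p] p by simp
  consider "q = \<infinity>" | r where "q = ennreal r" "0 < r"
  proof (cases q rule: ennreal_cases)
    case (real r)
    \<comment> \<open>In [0, \<infinity>] the quotient 1 / 0 is \<infinity>, so q = 0 contradicts
      the hypothesis.\<close>
    have "r \<noteq> 0" using pq real by (auto simp: ennreal_divide_zero)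
    then show ?thesis using real that by auto
  qed (use that in auto)
  then have "(p = 1 \<and> q = \<infinity>) \<or> (1 < p \<and> q = ennreal (p / (p - 1)))"
  proof cases
    case 1
    then have "ennreal (1 / p) = ennreal 1" using pq ip by simp
    then have "1 / p = 1" using p by (subst (asm) ennreal_inj) auto
    then show ?thesis using 1 by simp
  next
    case (2 r)
    then have "1 / q = ennreal (1 / r)" using divide_ennreal[of 1 r] by simp
    then have "ennreal (1 / p + 1 / r) = ennreal 1"
      using pq ip p 2 by (simp add: ennreal_plus)
    then have e: "1 / p + 1 / r = 1" using p 2 by (subst (asm) ennreal_inj) auto
    then have "p \<noteq> 1" using 2 by auto
    moreover have "r = p / (p - 1)" using e p 2 \<open>p \<noteq> 1\<close> by (simp add: field_simps)
    ultimately show ?thesis using p 2 by simp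
  qed
  then show "p = 1 \<Longrightarrow> q = \<infinity>" "1 < p \<Longrightarrow> q = ennreal (p / (p - 1))" by auto
qed

lemma fan_norm_le_lp_norm:
  fixes f :: "'n::finite heisenberg \<Rightarrow> complex"
  assumes f: "dominated f" and p: "1 < p" "p < 2"
  shows "fan_norm (ennreal (p / (p - 1))) (strichartz f) \<le> ennreal (hy_const CARD('n) p powr ((p - 1) / p)) * lp_norm p f"
proof -
  define I where "I = (\<integral>y. cmod (f y) powr p \<partial>lborel)"
  let ?q = "p / (p - 1)"
  have q: "0 < ?q" using p by simp
  have K: "0 < hy_const CARD('n) p" by (rule hy_const_pos[OF p])
  have I: "0 \<le> I" unfolding I_def by (intro Bochner_Integration.integral_nonneg) auto
  have "fan_norm (ennreal ?q) (strichartz f) \<le> ennreal (hy_const CARD('n) p * I powr (1 / (p - 1))) epowr (1 / ?q)"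
    unfolding fan_norm_eq[OF f q] I_def by (intro epowr_mono hausdorff_young[OF f p]) (use p in simp)
  also have "\<dots> = ennreal ((hy_const CARD('n) p * I powr (1 / (p - 1))) powr (1 / ?q))"
    using K by (intro epowr_ennreal) auto
  also have "(hy_const CARD('n) p * I powr (1 / (p - 1))) powr (1 / ?q) = hy_const CARD('n) p powr ((p - 1) / p) * I powr (1 / p)"
  proof -
    have "1 / (p - 1) * ((p - 1) / p) = 1 / p" using p by simp
    then show ?thesis using K p by (subst powr_mult) (auto simp: powr_powr)
  qed
  also have "ennreal \<dots> = ennreal (hy_const CARD('n) p powr ((p - 1) / p)) * lp_norm p f"
    unfolding lp_norm_eq[OF f less_imp_le[OF p(1)]] I_def by (rule ennreal_mult) auto
  finally show ?thesis .
qed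

lemma fan_norm_le_lp_norm_2:
  fixes f :: "'n::finite heisenberg \<Rightarrow> complex"
  assumes f: "dominated f"
  shows "fan_norm (ennreal 2) (strichartz f) \<le> lp_norm 2 f"
proof -
  have "(\<integral>\<^sup>+ x. ennreal (energy f x powr (2 / 2)) \<partial>fan_base CARD('n)) \<le> (\<integral>\<^sup>+ y. ennreal (cmod (f y) powr 2) \<partial>lborel)"
    using energy_bessel[OF f] by (simp add: energy_nonneg)
  then show ?thesis
    unfolding fan_norm_eq[OF f zero_less_numeral] lp_norm_def by (intro epowr_mono) auto
qed

text \<open>Hausdorff-Young is applied to g at the exponent q < 2, whose conjugate is p, and |g|^q =
  |f|^p makes its right side a power of I. The pairing is split by Young's inequality with a free
  parameter D in place of Hoelder's inequality, and the g-term is absorbed into the left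
  side.\<close>

lemma lp_norm_le_fan_norm:
  fixes f :: "'n::finite heisenberg \<Rightarrow> complex"
  assumes f: "dominated f" and cont: "continuous_on UNIV f" and p: "2 < p"
  defines "q \<equiv> p / (p - 1)"
  shows "lp_norm p f \<le> ennreal (hy_const CARD('n) q powr (1 / p)) * fan_norm (ennreal q) (strichartz f)"
proof -
  define g where "g = (\<lambda>y. f y * complex_of_real (cmod (f y) powr (p - 2)))"
  note g = duality_bound[OF f cont p, folded g_def]
  define I where "I = (\<integral>y. cmod (f y) powr p \<partial>lborel)"
  define J where "J = (\<integral>\<^sup>+ x. ennreal (energy f x powr (q / 2)) \<partial>fan_base CARD('n))"
  define K where "K = hy_const CARD('n) q"
  have q: "1 < q" "q < 2" "q / (q - 1) = p" "1 / p + 1 / q = 1" "1 / (q - 1) = p - 1" "q / p = 1 - (p - 2) * (q / p)"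
    using p by (simp_all add: q_def field_simps)
  have K: "0 < K" unfolding K_def by (rule hy_const_pos[OF q(1,2)])
  have I0: "0 \<le> I" unfolding I_def by (intro Bochner_Integration.integral_nonneg) auto
  have lp: "lp_norm p f = ennreal (I powr (1 / p))"
    unfolding I_def using p by (intro lp_norm_eq f) simp
  have fn: "fan_norm (ennreal q) (strichartz f) = J epowr (1 / q)"
    unfolding J_def using q by (intro fan_norm_eq f) simp
  have gI: "(\<integral>y. cmod (g y) powr q \<partial>lborel) = I"
    unfolding I_def
  proof (rule Bochner_Integration.integral_cong[OF refl])
    fix y
    have "cmod (g y) = cmod (f y) powr (p - 1)"
      using powr_add[of "cmod (f y)" 1 "p - 2"] by (simp add: g_def norm_mult)
    moreover have "(p - 1) * q = p" using p by (simp add: q_def)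
    ultimately show "cmod (g y) powr q = cmod (f y) powr p" by (simp add: powr_powr)
  qed
  have hy: "(\<integral>\<^sup>+ x. ennreal (energy g x powr (p / 2)) \<partial>fan_base CARD('n)) \<le> ennreal (K * I powr (p - 1))"
    using hausdorff_young[OF g(1) q(1,2)] by (simp only: q(3,5) gI K_def)
  show ?thesis
  proof (cases "I = 0 \<or> J = top")
    \<comment> \<open>I = 0 makes the left side 0, and J = \<infinity> makes the right side infinite
      because K > 0.\<close>
    case True
    then show ?thesis
      unfolding lp fn K_def[symmetric] using K p by (auto simp: epowr_def ennreal_mult_top)
  next
    case False
    then have I: "I > 0" using I0 by auto
    obtain j where j: "J = ennreal j" "0 \<le> j" using False by (cases J rule: ennreal_cases) auto
    \<comment> \<open>Chosen so that the bound K I^(p-1) / (p D^p) of the g-term equals I /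
      p.\<close>
    define D where "D = (K * I powr (p - 2)) powr (1 / p)"
    have D: "D > 0" using K I by (simp add: D_def)
    have Dp: "D powr p = K * I powr (p - 2)" using K I p by (simp add: D_def powr_powr)
    have young: "sqrt (energy f x * energy g x) \<le> D powr q / q * energy f x powr (q / 2) + 1 / (D powr p * p) * energy g x powr (p / 2)" for x
    proof -
      let ?a = "sqrt (energy f x)" and ?b = "sqrt (energy g x)"
      have "(D * ?a) * (?b / D) \<le> (D * ?a) powr q / q + (?b / D) powr p / p"
        using D energy_nonneg[of f x] energy_nonneg[of g x] q(1,4) p by (intro Youngs_inequality) auto
      moreover have "(D * ?a) * (?b / D) = sqrt (energy f x * energy g x)"
        using D by (simp add: real_sqrt_mult)
      moreover have "(D * ?a) powr q = D powr q * energy f x powr (q / 2)"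
        using D energy_nonneg[of f x] by (simp add: powr_mult powr_half_sqrt[symmetric] powr_powr)
      moreover have "(?b / D) powr p = energy g x powr (p / 2) / D powr p"
        using D energy_nonneg[of g x] by (simp add: powr_divide powr_half_sqrt[symmetric] powr_powr)
      ultimately show ?thesis by simp
    qed
    note [measurable] = measurable_energy[OF f] measurable_energy[OF g(1)]
    have "ennreal I \<le> (\<integral>\<^sup>+ x. ennreal (sqrt (energy f x * energy g x)) \<partial>fan_base CARD('n))"
      unfolding I_def by (rule g(2))
    also have "\<dots> \<le> (\<integral>\<^sup>+ x. ennreal (D powr q / q) * ennreal (energy f x powr (q / 2)) +
        ennreal (1 / (D powr p * p)) * ennreal (energy g x powr (p / 2)) \<partial>fan_base CARD('n))"
    proof (rule nn_integral_mono)
      fix x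
      have "ennreal (sqrt (energy f x * energy g x)) \<le>
         ennreal (D powr q / q * energy f x powr (q / 2) + 1 / (D powr p * p) * energy g x powr (p / 2))"
        by (intro ennreal_leI young)
      also have "\<dots> = ennreal (D powr q / q * energy f x powr (q / 2)) + ennreal (1 / (D powr p * p) * energy g x powr (p / 2))"
        using q p by (intro ennreal_plus) auto
      also have "\<dots> = ennreal (D powr q / q) * ennreal (energy f x powr (q / 2)) +
        ennreal (1 / (D powr p * p)) * ennreal (energy g x powr (p / 2))"
        by (simp only: ennreal_mult''[OF powr_ge_zero])
      finally show "ennreal (sqrt (energy f x * energy g x)) \<le> \<dots>" .
    qed
    also have "\<dots> = ennreal (D powr q / q) * J + ennreal (1 / (D powr p * p)) * (\<integral>\<^sup>+ x. ennreal (energy g x powr (p / 2)) \<partial>fan_base CARD('n))"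
      unfolding J_def by (subst nn_integral_add, measurable, subst nn_integral_cmult, measurable, subst nn_integral_cmult, measurable)
    also have "\<dots> \<le> ennreal (D powr q / q) * J + ennreal (1 / (D powr p * p)) * ennreal (K * I powr (p - 1))"
      by (intro add_left_mono mult_left_mono hy) simp
    also have "\<dots> = ennreal (D powr q / q * j + 1 / (D powr p * p) * (K * I powr (p - 1)))"
    proof -
      have "ennreal a * ennreal b + ennreal c * ennreal d = ennreal (a * b + c * d)"
        if "0 \<le> a" "0 \<le> b" "0 \<le> c" "0 \<le> d" for a b c d
        using that by (simp add: ennreal_mult)
      then show ?thesis unfolding j(1) using q(1) p j(2) K by auto
    qed
    also have "1 / (D powr p * p) * (K * I powr (p - 1)) = I / p"
      unfolding Dp using K I powr_add[of I "p - 2" 1] by simp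
    finally have "I \<le> D powr q / q * j + I / p"
      using q p j I by (subst (asm) ennreal_le_iff) auto
    \<comment> \<open>The g-term is absorbed: subtracting I / p leaves I / q on the left.\<close>
    then have "I * (1 - 1 / p) \<le> D powr q / q * j" by (simp add: algebra_simps)
    also have "1 - 1 / p = 1 / q" using q(4) by simp
    finally have "I \<le> D powr q * j" using q(1) by (simp add: field_simps)
    also have "D powr q = K powr (q / p) * I powr ((p - 2) * (q / p))"
      using K I by (simp add: D_def powr_powr powr_mult)
    \<comment> \<open>D^q contains a power of I itself; moved to the left it leaves the exponent 1 -
      (p - 2) q / p = q / p.\<close>
    finally have "I powr (1 - (p - 2) * (q / p)) \<le> K powr (q / p) * j"
      using I by (simp add: powr_diff field_simps)
    then have "I powr (q / p) \<le> K powr (q / p) * j" using q(6) by simp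
    moreover have e: "q / p * (1 / q) = 1 / p" using q(1) by simp
    ultimately have "(I powr (q / p)) powr (1 / q) \<le> (K powr (q / p) * j) powr (1 / q)"
      using q by (intro powr_mono2) auto
    also have "\<dots> = K powr (1 / p) * j powr (1 / q)"
      by (subst powr_mult) (use j(2) in \<open>simp_all only: powr_powr e powr_ge_zero\<close>)
    also have "(I powr (q / p)) powr (1 / q) = I powr (1 / p)"
      by (simp only: powr_powr e)
    finally have "ennreal (I powr (1 / p)) \<le> ennreal (K powr (1 / p) * j powr (1 / q))"
      by (rule ennreal_leI)
    then show ?thesis
      unfolding lp fn K_def[symmetric] j(1) epowr_ennreal[OF j(2)] by (simp add: ennreal_mult)
  qed
qed

theorem theorem3p1:
  fixes p :: real and q :: ennreal
  assumes "1 / ennreal p + 1 / q = 1"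
  shows "(1 \<le> p \<and> p \<le> 2 \<longrightarrow>
           (\<exists>C::real. 0 \<le> C \<and> (\<forall>f :: 'n::finite heisenberg \<Rightarrow> complex. schwartz f \<longrightarrow>
              fan_norm q (strichartz f) \<le> ennreal C * lp_norm p f))) \<and>
         (2 < p \<longrightarrow>
           (\<exists>C::real. 0 \<le> C \<and> (\<forall>f :: 'n::finite heisenberg \<Rightarrow> complex. schwartz f \<longrightarrow>
              lp_norm p f \<le> ennreal C * fan_norm q (strichartz f))))"
proof (intro conjI impI)
  assume p: "1 \<le> p \<and> p \<le> 2"
  \<comment> \<open>The endpoints are separate because the interpolation constant degenerates at
    both: p / (p - 1) is unbounded as p tends to 1, and \<sigma> - 1 vanishes at p = 2.\<close>
  then consider "p = 1" | "1 < p" "p < 2" | "p = 2" by linarith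
  then show "\<exists>C::real. 0 \<le> C \<and> (\<forall>f :: 'n heisenberg \<Rightarrow> complex. schwartz f \<longrightarrow>
              fan_norm q (strichartz f) \<le> ennreal C * lp_norm p f)"
  proof cases
    case 1
    have q: "q = \<infinity>" using conjugate_exponent(1)[OF assms] 1 by simp
    have "fan_norm q (strichartz f) \<le> ennreal (sqrt ((2 * pi) ^ CARD('n))) * lp_norm p f"
      if "schwartz f" for f :: "'n heisenberg \<Rightarrow> complex"
    proof -
      have f: "dominated f" by (rule schwartz_dominated[OF that])
      have "lp_norm p f = ennreal (\<integral>y. cmod (f y) \<partial>lborel)"
        unfolding 1 using lp_norm_eq[OF f, of 1] by (simp add: Bochner_Integration.integral_nonneg)
      then show ?thesis
        unfolding q using fan_norm_infinity_le[OF f] by (simp add: ennreal_mult' del: real_sqrt_mult)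
    qed
    then show ?thesis by (intro exI[of _ "sqrt ((2 * pi) ^ CARD('n))"]) auto
  next
    case 2
    have q: "q = ennreal (p / (p - 1))" using conjugate_exponent(2)[OF assms] 2 by simp
    show ?thesis
      unfolding q using fan_norm_le_lp_norm[OF schwartz_dominated 2, where 'n='n]
      by (intro exI[of _ "hy_const CARD('n) p powr ((p - 1) / p)"]) auto
  next
    case 3
    have q: "q = ennreal 2" using conjugate_exponent(2)[OF assms] 3 by simp
    show ?thesis
      unfolding q 3 using fan_norm_le_lp_norm_2[OF schwartz_dominated, where 'n='n]
      by (intro exI[of _ 1]) auto
  qed
next
  assume p: "2 < p"
  have q: "q = ennreal (p / (p - 1))" using conjugate_exponent(2)[OF assms] p by simp
  show "\<exists>C::real. 0 \<le> C \<and> (\<forall>f :: 'n heisenberg \<Rightarrow> complex. schwartz f \<longrightarrow>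
              lp_norm p f \<le> ennreal C * fan_norm q (strichartz f))"
    unfolding q using lp_norm_le_fan_norm[OF schwartz_dominated schwartz_continuous p, where 'n='n]
    by (intro exI[of _ "hy_const CARD('n) (p / (p - 1)) powr (1 / p)"]) auto
qed

end
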